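(* Suppose two $n$-braids $\beta_1$ and $\beta_2$ have the same exponent sum. If the traces of the (unreduced) Burau representations of $\beta_1$ and $\beta_2$ differ, i.e. $\operatorname{Tr}(\Phi(\beta_1,s))\ne\operatorname{Tr}(\Phi(\beta_2,s))$, then the sutured (annular) Khovanov homologies $SKh(\overline{\beta_1})$ and $SKh(\overline{\beta_2})$ of their closures differ (are not isomorphic as triply graded vector spaces).
   Context: **Braids.** $B_n$ is the $n$-strand braid group with standard Artin generators $\sigma_1,\dots,\sigma_{n-1}$; with all strands oriented in the same direction, $\sigma_i$ is a positive crossing between strands $i,i+1$ and $\sigma_i^{-1}$ a negative one. The exponent sum of a braid is the number of positive letters minus the number of negative letters in any word in the Artin generators representing it. $\overline\beta$ is the closure of $\beta$, embedded in the natural way in a thickened annulus $A\times I$ (braid axis through the centre of $A$). **Burau representation.** $\Phi(\cdot,s)$ is the classical unreduced Burau representation of $B_n$ with variable $s$: the homomorphism to $GL_n(\mathbb Z[s^{\pm1}])$ sending $\sigma_i$ to the block diagonal matrix $I_{i-1}\oplus\begin{pmatrix}1-s&s\\1&0\end{pmatrix}\oplus I_{n-i-1}$. **Sutured (annular) Khovanov homology** (coefficients in $\mathbb{Z}/2\mathbb{Z}$). Let $D\subset A$ be a diagram of an oriented link in $A\times I$ with $N$ crossings, $n_+$ positive and $n_-$ negative. For each $\mathcal I\in\{0,1\}^N$ resolve the crossings by the usual Khovanov rule (the orientation-compatible resolution is the 0-resolution of a positive crossing and the 1-resolution of a negative crossing). To each circle of the resolution assign $V=\langle v_+,v_-\rangle$,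 and to the vertex $\mathcal I$ assign the tensor product of these spaces over the circles. The $q$-grading of a generator is the sum of $\pm1$ over its factors $v_\pm$, plus the number $i(\mathcal I)$ of 1's in $\mathcal I$, plus $n_+-2n_-$. The homological grading is $i(\mathcal I)-n_-$. The $k$-grading is additive over tensor factors: $v_\pm$ has $k$-grading $\pm1$ on a circle that does not bound a disk in $A$ (non-trivial circle), and $0$ on a circle that bounds a disk in $A$ (trivial circle). The standard Khovanov differential (merge: $v_+\otimes v_+\mapsto v_+$, $v_\pm\otimes v_\mp\mapsto v_-$, $v_-\otimes v_-\mapsto0$; split: $v_+\mapsto v_+\otimes v_-+v_-\otimes v_+$, $v_-\mapsto v_-\otimes v_-$) is non-increasing in the $k$-grading; $SKh$ is the homology of the associated graded complex (i.e. with only the $k$-preserving part of the differential). It is a triply graded (homological, $q$, $k$) invariant of the link in $A\times I$. *)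

theory Defs
  imports
    "HOL-Library.Poly_Mapping"
    "HOL-Library.FuncSet"
    "HOL-Library.Z2"
    "HOL-Algebra.Coset"
    "Jordan_Normal_Form.Matrix"
begin

section \<open>The braid group\<close>

text \<open>The letter \<open>(i, True)\<close> stands for the Artin generator \<open>\<sigma>\<^sub>i\<close> and \<open>(i, False)\<close> for its inverse;
  the strands are numbered from 1 to \<open>n\<close>.\<close>

type_synonym braid_word = "(nat \<times> bool) list"

definition braid_words :: "nat \<Rightarrow> braid_word set" where
  "braid_words n = lists ({i. 1 \<le> i \<and> i < n} \<times> UNIV)"

inductive braid_eq :: "nat \<Rightarrow> braid_word \<Rightarrow> braid_word \<Rightarrow> bool" for n where
  refl: "w \<in> braid_words n \<Longrightarrow> braid_eq n w w"
| sym: "braid_eq n v w \<Longrightarrow> braid_eq n w v"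
| trans: "braid_eq n u v \<Longrightarrow> braid_eq n v w \<Longrightarrow> braid_eq n u w"
| cancel: "\<lbrakk>u \<in> braid_words n; v \<in> braid_words n; 1 \<le> i; i < n\<rbrakk>
    \<Longrightarrow> braid_eq n (u @ [(i, b), (i, \<not> b)] @ v) (u @ v)"
| far: "\<lbrakk>u \<in> braid_words n; v \<in> braid_words n; 1 \<le> i; i + 2 \<le> j; j < n\<rbrakk>
    \<Longrightarrow> braid_eq n (u @ [(i, True), (j, True)] @ v) (u @ [(j, True), (i, True)] @ v)"
| braid: "\<lbrakk>u \<in> braid_words n; v \<in> braid_words n; 1 \<le> i; i + 1 < n\<rbrakk>
    \<Longrightarrow> braid_eq n (u @ [(i, True), (i + 1, True), (i, True)] @ v)
                   (u @ [(i + 1, True), (i, True), (i + 1, True)] @ v)"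

definition braid_rel :: "nat \<Rightarrow> (braid_word \<times> braid_word) set" where
  "braid_rel n = {(v, w). braid_eq n v w}"

definition braid_class :: "nat \<Rightarrow> braid_word \<Rightarrow> braid_word set" where
  "braid_class n w = braid_rel n `` {w}"

definition braid_group :: "nat \<Rightarrow> braid_word set monoid" where
  "braid_group n =
    \<lparr>carrier = braid_words n // braid_rel n,
     monoid.mult = (\<lambda>\<alpha> \<beta>. \<Union>v\<in>\<alpha>. \<Union>w\<in>\<beta>. braid_class n (v @ w)),
     one = braid_class n []\<rparr>"

definition word_exponent_sum :: "braid_word \<Rightarrow> int" where
  "word_exponent_sum w = (\<Sum>(i, b)\<leftarrow>w. if b then 1 else -1)"

definition exponent_sum :: "braid_word set \<Rightarrow> int" where
  "exponent_sum \<beta> = the_elem (word_exponent_sum ` \<beta>)"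

lemma braid_words_append [simp]:
  "u @ v \<in> braid_words n \<longleftrightarrow> u \<in> braid_words n \<and> v \<in> braid_words n"
  by (auto simp: braid_words_def)

lemma braid_words_Nil [simp]: "[] \<in> braid_words n"
  by (simp add: braid_words_def)

lemma braid_words_Cons [simp]:
  "(i, b) # w \<in> braid_words n \<longleftrightarrow> 1 \<le> i \<and> i < n \<and> w \<in> braid_words n"
  by (auto simp: braid_words_def)

lemma braid_eq_words: "braid_eq n v w \<Longrightarrow> v \<in> braid_words n \<and> w \<in> braid_words n"
  by (induction rule: braid_eq.induct) auto

lemma equiv_braid_rel: "equiv (braid_words n) (braid_rel n)"
  by (rule equivI)
     (auto simp: braid_rel_def refl_on_def sym_def trans_def dest: braid_eq_words
       intro: braid_eq.refl braid_eq.sym braid_eq.trans)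

lemma braid_eq_append_right:
  "braid_eq n v w \<Longrightarrow> x \<in> braid_words n \<Longrightarrow> braid_eq n (v @ x) (w @ x)"
proof (induction rule: braid_eq.induct)
  case (cancel u v i b)
  then show ?case using braid_eq.cancel[of u n "v @ x" i b] by simp
next
  case (far u v i j)
  then show ?case using braid_eq.far[of u n "v @ x" i j] by simp
next
  case (braid u v i)
  then show ?case using braid_eq.braid[of u n "v @ x" i] by simp
qed (auto intro: braid_eq.refl braid_eq.sym braid_eq.trans)

lemma braid_eq_append_left:
  "braid_eq n v w \<Longrightarrow> x \<in> braid_words n \<Longrightarrow> braid_eq n (x @ v) (x @ w)"
proof (induction rule: braid_eq.induct)
  case (cancel u v i b)
  then show ?case using braid_eq.cancel[of "x @ u" n v i b] by simp
next
  case (far u v i j)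
  then show ?case using braid_eq.far[of "x @ u" n v i j] by simp
next
  case (braid u v i)
  then show ?case using braid_eq.braid[of "x @ u" n v i] by simp
qed (auto intro: braid_eq.refl braid_eq.sym braid_eq.trans)

lemma braid_eq_append:
  assumes "braid_eq n u u'" "braid_eq n v v'"
  shows "braid_eq n (u @ v) (u' @ v')"
  using braid_eq_append_right[OF assms(1), of v] braid_eq_append_left[OF assms(2), of u']
    braid_eq_words[OF assms(1)] braid_eq_words[OF assms(2)]
  by (blast intro: braid_eq.trans)

lemma mem_braid_class [simp]: "v \<in> braid_class n w \<longleftrightarrow> braid_eq n w v"
  by (simp add: braid_class_def braid_rel_def)

lemma braid_class_eq: "braid_eq n v w \<Longrightarrow> braid_class n v = braid_class n w"
  unfolding braid_class_def
  by (rule equiv_class_eq[OF equiv_braid_rel]) (simp add: braid_rel_def)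

lemma carrier_braid_group: "carrier (braid_group n) = braid_class n ` braid_words n"
  by (auto simp: braid_group_def quotient_def braid_class_def)

lemma braid_class_in_carrier [intro]:
  "w \<in> braid_words n \<Longrightarrow> braid_class n w \<in> carrier (braid_group n)"
  by (simp add: carrier_braid_group)

lemma mult_braid_class:
  assumes "v \<in> braid_words n" "w \<in> braid_words n"
  shows "braid_class n v \<otimes>\<^bsub>braid_group n\<^esub> braid_class n w = braid_class n (v @ w)"
proof -
  have eq: "braid_class n (v' @ w') = braid_class n (v @ w)"
    if "v' \<in> braid_class n v" "w' \<in> braid_class n w" for v' w'
    using that by (intro braid_class_eq braid_eq.sym[OF braid_eq_append]) simp_all
  have "v \<in> braid_class n v" "w \<in> braid_class n w"
    using assms by (auto intro: braid_eq.refl)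
  then have "(\<Union>v'\<in>braid_class n v. \<Union>w'\<in>braid_class n w. braid_class n (v' @ w'))
      = braid_class n (v @ w)"
    using eq by blast
  then show ?thesis by (simp add: braid_group_def)
qed

lemma braid_eq_inverse:
  "w \<in> braid_words n \<Longrightarrow>
    map (\<lambda>(i, b). (i, \<not> b)) (rev w) \<in> braid_words n \<and>
    braid_eq n (map (\<lambda>(i, b). (i, \<not> b)) (rev w) @ w) []"
proof (induction w)
  case Nil
  then show ?case by (auto intro: braid_eq.refl)
next
  case (Cons a w)
  obtain i b where a: "a = (i, b)" by force
  let ?r = "map (\<lambda>(i, b). (i, \<not> b)) (rev w)"
  from Cons a have i: "1 \<le> i" "i < n" and w: "w \<in> braid_words n" by auto
  with Cons have r: "?r \<in> braid_words n" "braid_eq n (?r @ w) []" by auto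
  have "braid_eq n (?r @ [(i, \<not> b), (i, \<not> \<not> b)] @ w) (?r @ w)"
    by (rule braid_eq.cancel) (use i w r in auto)
  with r have "braid_eq n (?r @ [(i, \<not> b), (i, b)] @ w) []"
    by (auto intro: braid_eq.trans)
  then show ?case using a i r by simp
qed

lemma group_braid_group: "group (braid_group n)"
proof (rule groupI)
  show "\<one>\<^bsub>braid_group n\<^esub> \<in> carrier (braid_group n)"
    by (auto simp: carrier_braid_group) (simp add: braid_group_def)
next
  fix x y assume "x \<in> carrier (braid_group n)" "y \<in> carrier (braid_group n)"
  then show "x \<otimes>\<^bsub>braid_group n\<^esub> y \<in> carrier (braid_group n)"
    by (auto simp: carrier_braid_group mult_braid_class)
next
  fix x y z assume "x \<in> carrier (braid_group n)" "y \<in> carrier (braid_group n)"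
    "z \<in> carrier (braid_group n)"
  then show "x \<otimes>\<^bsub>braid_group n\<^esub> y \<otimes>\<^bsub>braid_group n\<^esub> z = x \<otimes>\<^bsub>braid_group n\<^esub> (y \<otimes>\<^bsub>braid_group n\<^esub> z)"
    by (auto simp: carrier_braid_group mult_braid_class)
next
  fix x assume "x \<in> carrier (braid_group n)"
  then obtain w where w: "w \<in> braid_words n" "x = braid_class n w"
    by (auto simp: carrier_braid_group)
  have one: "\<one>\<^bsub>braid_group n\<^esub> = braid_class n []" by (simp add: braid_group_def)
  show "\<one>\<^bsub>braid_group n\<^esub> \<otimes>\<^bsub>braid_group n\<^esub> x = x"
    using mult_braid_class[of "[]" n w] w one by simp
  show "\<exists>y\<in>carrier (braid_group n). y \<otimes>\<^bsub>braid_group n\<^esub> x = \<one>\<^bsub>braid_group n\<^esub>"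
    using mult_braid_class[of _ n w] braid_eq_inverse[OF w(1)] w one
    by (intro bexI[of _ "braid_class n (map (\<lambda>(i, b). (i, \<not> b)) (rev w))"])
       (auto simp: braid_class_eq)
qed

lemma the_elem_braid_class:
  assumes "w \<in> braid_words n" and "\<And>v. braid_eq n w v \<Longrightarrow> f v = f w"
  shows "the_elem (f ` braid_class n w) = f w"
proof -
  have "f ` braid_class n w = {f w}"
    using assms by (auto intro!: image_eqI[of _ _ w] braid_eq.refl)
  then show ?thesis by simp
qed

lemma exponent_sum_braid_class:
  assumes "w \<in> braid_words n"
  shows "exponent_sum (braid_class n w) = word_exponent_sum w"
proof -
  have "braid_eq n v v' \<Longrightarrow> word_exponent_sum v = word_exponent_sum v'" for v v'
    by (induction rule: braid_eq.induct) (auto simp: word_exponent_sum_def)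
  then show ?thesis
    unfolding exponent_sum_def using assms by (intro the_elem_braid_class) metis+
qed


section \<open>The unreduced Burau representation\<close>

text \<open>\<open>int \<Rightarrow>\<^sub>0 int\<close> with the convolution product is the group ring of the integers,
  that is, the ring of integral Laurent polynomials.\<close>

type_synonym laurent = "int \<Rightarrow>\<^sub>0 int"

definition s_var :: laurent where "s_var = Poly_Mapping.single 1 1"

definition s_inv :: laurent where "s_inv = Poly_Mapping.single (-1) 1"

definition burau_block :: "bool \<Rightarrow> laurent mat" where
  "burau_block b =
    (if b then mat_of_rows_list 2 [[1 - s_var, s_var], [1, 0]]
     else mat_of_rows_list 2 [[0, 1], [s_inv, 1 - s_inv]])"

definition burau_letter :: "nat \<Rightarrow> nat \<times> bool \<Rightarrow> laurent mat" where
  "burau_letter n = (\<lambda>(i, b). diag_block_mat [1\<^sub>m (i - 1), burau_block b, 1\<^sub>m (n - i - 1)])"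

definition burau_word :: "nat \<Rightarrow> braid_word \<Rightarrow> laurent mat" where
  "burau_word n w = foldr (\<lambda>x M. burau_letter n x * M) w (1\<^sub>m n)"

definition burau :: "nat \<Rightarrow> braid_word set \<Rightarrow> laurent mat" where
  "burau n \<beta> = the_elem (burau_word n ` \<beta>)"

definition mat_trace :: "'a::comm_monoid_add mat \<Rightarrow> 'a" where
  "mat_trace M = (\<Sum>i<dim_row M. M $$ (i, i))"

lemma s_var_s_inv [simp]: "s_var * s_inv = 1" "s_inv * s_var = 1"
  by (simp_all add: s_var_def s_inv_def mult_single)

lemma burau_block_dim [simp]: "burau_block b \<in> carrier_mat 2 2"
  "dim_row (burau_block b) = 2" "dim_col (burau_block b) = 2"
  by (auto simp: burau_block_def mat_of_rows_list_def)

lemma burau_letter_index: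
  assumes "1 \<le> i" "i < n" "r < n" "c < n"
  shows "burau_letter n (i, b) $$ (r, c) =
    (if r \<in> {i - 1, i} \<and> c \<in> {i - 1, i} then burau_block b $$ (r - (i - 1), c - (i - 1))
     else if r = c then 1 else 0)"
proof -
  obtain a where a: "i = Suc a" using assms by (cases i) auto
  obtain d where d: "n = a + 2 + d"
    using assms a by (metis Suc_leI add_2_eq_Suc' le_Suc_ex)
  have G: "burau_letter n (i, b) = four_block_mat (1\<^sub>m a) (0\<^sub>m a (2 + d)) (0\<^sub>m (2 + d) a)
      (four_block_mat (burau_block b) (0\<^sub>m 2 d) (0\<^sub>m d 2) (1\<^sub>m d))"
  proof -
    have "four_block_mat (1\<^sub>m d) (0\<^sub>m d 0) (0\<^sub>m 0 d) (0\<^sub>m 0 0) = (1\<^sub>m d :: laurent mat)"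
      by (rule eq_matI) auto
    then show ?thesis by (simp add: burau_letter_def Let_def a d)
  qed
  consider "r < a" | "r = a" | "r = Suc a" | "r > Suc a" by linarith
  then show ?thesis
  proof cases
    case 1
    then show ?thesis using assms unfolding G by (simp add: a d)
  next
    case 2
    then show ?thesis using assms unfolding G by (simp add: a d) linarith
  next
    case 3
    then show ?thesis using assms unfolding G by (simp add: a d) linarith
  next
    case 4
    then show ?thesis using assms unfolding G by (simp add: a d) linarith
  qed
qed

lemma burau_letter_carrier:
  "1 \<le> i \<Longrightarrow> i < n \<Longrightarrow> burau_letter n (i, b) \<in> carrier_mat n n"
  by (intro carrier_matI) (auto simp: burau_letter_def Let_def)

lemma burau_letter_mult_carrier:
  "1 \<le> i \<Longrightarrow> i < n \<Longrightarrow> A \<in> carrier_mat n n \<Longrightarrow> burau_letter n (i, b) * A \<in> carrier_mat n n"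
  by (rule mult_carrier_mat[OF burau_letter_carrier])

lemma burau_letter_mult_index:
  assumes i: "1 \<le> i" "i < n" and A: "A \<in> carrier_mat n n" and "r < n" "c < n"
  shows "(burau_letter n (i, b) * A) $$ (r, c) =
    (if r = i - 1 then
       (if b then (1 - s_var) * A $$ (i - 1, c) + s_var * A $$ (i, c) else A $$ (i, c))
     else if r = i then
       (if b then A $$ (i - 1, c) else s_inv * A $$ (i - 1, c) + (1 - s_inv) * A $$ (i, c))
     else A $$ (r, c))"
proof -
  let ?G = "burau_letter n (i, b)"
  have G: "?G \<in> carrier_mat n n" using i by (rule burau_letter_carrier)
  have "(?G * A) $$ (r, c) = (\<Sum>k<n. ?G $$ (r, k) * A $$ (k, c))"
    using G A assms by (auto simp: scalar_prod_def lessThan_atLeast0 intro!: sum.cong)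
  also have "\<dots> = (\<Sum>k\<in>(if r \<in> {i - 1, i} then {i - 1, i} else {r}). ?G $$ (r, k) * A $$ (k, c))"
    by (rule sum.mono_neutral_right) (use assms in \<open>auto simp: burau_letter_index split: if_splits\<close>)
  finally show ?thesis
    using assms by (auto simp: burau_letter_index burau_block_def mat_of_rows_list_def)
qed

lemma burau_word_Nil [simp]: "burau_word n [] = 1\<^sub>m n"
  by (simp add: burau_word_def)

lemma burau_word_Cons [simp]: "burau_word n (x # w) = burau_letter n x * burau_word n w"
  by (simp add: burau_word_def)

lemma burau_word_carrier: "w \<in> braid_words n \<Longrightarrow> burau_word n w \<in> carrier_mat n n"
proof (induction w)
  case (Cons x w)
  then show ?case using burau_letter_carrier[of "fst x" n "snd x"]
    by (cases x) (auto intro!: mult_carrier_mat)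
qed simp

lemma burau_word_append:
  assumes "v \<in> braid_words n" "w \<in> braid_words n"
  shows "burau_word n (v @ w) = burau_word n v * burau_word n w"
  using assms(1)
proof (induction v)
  case Nil
  then show ?case using burau_word_carrier[OF assms(2)] by simp
next
  case (Cons x v)
  then obtain i b where x: "x = (i, b)" "1 \<le> i" "i < n" "v \<in> braid_words n" by (cases x) auto
  then show ?case
    using Cons assoc_mult_mat[OF burau_letter_carrier[of i n b] burau_word_carrier[of v n]
        burau_word_carrier[OF assms(2)]] by simp
qed

lemma burau_word_cong: "braid_eq n v w \<Longrightarrow> burau_word n v = burau_word n w"
proof (induction rule: braid_eq.induct)
  case (cancel u v i b)
  let ?A = "burau_word n v"
  have A: "?A \<in> carrier_mat n n" using cancel by (simp add: burau_word_carrier)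
  have i: "i - 1 < n" "i - Suc 0 < n" "i \<noteq> i - 1" using cancel by auto
  note [simp] = carrier_matD[OF burau_letter_carrier[OF cancel(3,4)]]
    carrier_matD[OF A]
  note carr = A burau_letter_mult_carrier[OF cancel(3,4) A]
    burau_letter_mult_carrier[OF cancel(3,4) burau_letter_mult_carrier[OF cancel(3,4) A]]
  have s: "s_var * (s_inv * x) = x" "s_inv * (s_var * x) = x" for x
    by (simp_all flip: mult.assoc)
  have "burau_letter n (i, b) * (burau_letter n (i, \<not> b) * ?A) = ?A"
  proof (rule eq_matI)
    fix r c assume "r < dim_row ?A" "c < dim_col ?A"
    then have "r < n" "c < n" using A by auto
    then show "(burau_letter n (i, b) * (burau_letter n (i, \<not> b) * ?A)) $$ (r, c) = ?A $$ (r, c)"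
      using i cancel(3,4)
      by (simp add: burau_letter_mult_index[OF cancel(3,4)] carr algebra_simps s del: index_mult_mat(1))
  qed (use carr in auto)
  then show ?case using cancel by (simp add: burau_word_append)
next
  case (far u v i j)
  let ?A = "burau_word n v" and ?G = "burau_letter n (i, True)"
    and ?H = "burau_letter n (j, True)"
  have i: "1 \<le> i" "i < n" and j: "1 \<le> j" "j < n" using far by auto
  have A: "?A \<in> carrier_mat n n" using far by (simp add: burau_word_carrier)
  note [simp] = carrier_matD[OF burau_letter_carrier[OF i]]
    carrier_matD[OF burau_letter_carrier[OF j]] carrier_matD[OF A]
  note carr = A burau_letter_mult_carrier[OF i A] burau_letter_mult_carrier[OF j A]
    burau_letter_mult_carrier[OF i burau_letter_mult_carrier[OF j A]]
    burau_letter_mult_carrier[OF j burau_letter_mult_carrier[OF i A]]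
  have ij: "i - 1 < n" "i - Suc 0 < n" "j - 1 < n" "j - Suc 0 < n"
    "i \<noteq> j" "i \<noteq> j - 1" "i - 1 \<noteq> j" "i - 1 \<noteq> j - 1" "i \<noteq> i - 1" "j \<noteq> j - 1"
    using far by auto
  have "?G * (?H * ?A) = ?H * (?G * ?A)"
  proof (rule eq_matI)
    fix r c assume "r < dim_row (?H * (?G * ?A))" "c < dim_col (?H * (?G * ?A))"
    then have "r < n" "c < n" using carr by auto
    then show "(?G * (?H * ?A)) $$ (r, c) = (?H * (?G * ?A)) $$ (r, c)"
      using i j ij
      by (simp add: burau_letter_mult_index[OF i] burau_letter_mult_index[OF j] carr del: index_mult_mat(1))
  qed (use carr in auto)
  then show ?case using far by (simp add: burau_word_append)
next
  case (braid u v i)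
  define j where "j = i + 1"
  let ?A = "burau_word n v" and ?G = "burau_letter n (i, True)"
    and ?H = "burau_letter n (j, True)"
  have i: "1 \<le> i" "i < n" and j: "1 \<le> j" "j < n"
    using braid by (auto simp: j_def)
  have A: "?A \<in> carrier_mat n n" using braid by (simp add: burau_word_carrier)
  note GA = burau_letter_mult_carrier[OF i A, of True]
  note HA = burau_letter_mult_carrier[OF j A, of True]
  note HGA = burau_letter_mult_carrier[OF j GA, of True]
  note GHA = burau_letter_mult_carrier[OF i HA, of True]
  note [simp] = carrier_matD[OF burau_letter_carrier[OF i]]
    carrier_matD[OF burau_letter_carrier[OF j]] carrier_matD[OF A]
  note carr = A GA HA HGA GHA
    burau_letter_mult_carrier[OF i HGA, of True] burau_letter_mult_carrier[OF j GHA, of True]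
  have i': "i - 1 < n" "i - Suc 0 < n" "i \<noteq> i - 1" "j \<noteq> i - 1" "j \<noteq> i" "j - 1 = i"
    using i by (auto simp: j_def)
  have "?G * (?H * (?G * ?A)) = ?H * (?G * (?H * ?A))"
  proof (rule eq_matI)
    fix r c assume "r < dim_row (?H * (?G * (?H * ?A)))" "c < dim_col (?H * (?G * (?H * ?A)))"
    then have rc: "r < n" "c < n" using carr by auto
    show "(?G * (?H * (?G * ?A))) $$ (r, c) = (?H * (?G * (?H * ?A))) $$ (r, c)"
      using i j i' rc carr
      by (simp add: burau_letter_mult_index[OF i] burau_letter_mult_index[OF j]
          algebra_simps del: index_mult_mat(1))
  qed (use carr in auto)
  then show ?case using braid by (simp add: burau_word_append j_def)
qed auto

lemma burau_braid_class: "w \<in> braid_words n \<Longrightarrow> burau n (braid_class n w) = burau_word n w"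
  unfolding burau_def by (intro the_elem_braid_class) (auto dest: burau_word_cong)

lemma burau_generator:
  assumes "1 \<le> i" "i < n"
  shows "burau n (braid_class n [(i, True)]) =
    diag_block_mat
      [1\<^sub>m (i - 1), mat_of_rows_list 2 [[1 - s_var, s_var], [1, 0]], 1\<^sub>m (n - i - 1)]"
proof -
  have "burau n (braid_class n [(i, True)]) = burau_letter n (i, True)"
    using assms burau_letter_carrier[of i n True] by (simp add: burau_braid_class)
  then show ?thesis by (simp add: burau_letter_def burau_block_def)
qed

lemma burau_hom:
  "burau n \<in> hom (braid_group n) (units_of (ring_mat TYPE(laurent) n ()))"
proof (rule homI)
  fix x assume "x \<in> carrier (braid_group n)"
  then obtain w where w: "w \<in> braid_words n" "x = braid_class n w"
    by (auto simp: carrier_braid_group)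
  let ?r = "\<lambda>w. map (\<lambda>(i, b). (i, \<not> b)) (rev w)"
  have r: "?r w \<in> braid_words n" using braid_eq_inverse[OF w(1)] by simp
  have 1: "burau_word n (?r w) * burau_word n w = 1\<^sub>m n"
    using braid_eq_inverse[OF w(1)] burau_word_append[of "?r w" n w] w
      burau_word_cong[of n "?r w @ w" "[]"] by simp
  have "?r (?r w) = w" by (simp add: rev_map o_def case_prod_beta)
  then have 2: "burau_word n w * burau_word n (?r w) = 1\<^sub>m n"
    using braid_eq_inverse[OF r] burau_word_append[of w n "?r w"] w r
      burau_word_cong[of n "w @ ?r w" "[]"] by simp
  show "burau n x \<in> carrier (units_of (ring_mat TYPE(laurent) n ()))"
    using 1 2 w r burau_word_carrier[of w n] burau_word_carrier[of "?r w" n]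
    by (auto simp: units_of_def Units_def ring_mat_simps burau_braid_class)
next
  fix x y assume "x \<in> carrier (braid_group n)" "y \<in> carrier (braid_group n)"
  then show "burau n (x \<otimes>\<^bsub>braid_group n\<^esub> y) =
      burau n x \<otimes>\<^bsub>units_of (ring_mat TYPE(laurent) n ())\<^esub> burau n y"
    by (auto simp: carrier_braid_group mult_braid_class burau_braid_class burau_word_append
        units_of_def ring_mat_simps)
qed


section \<open>Annular link diagrams\<close>

text \<open>An annular diagram is cut along a radial arc of the annulus. It is recorded by vertices
  on the strands, the crossings, the arcs avoiding the radial arc, and the arcs that meet the
  radial arc exactly once. A crossing lists its four adjacent vertices; both strands are
  oriented from the incoming side to the outgoing side, and left and right are as seen by an
  observer facing the outgoing side. So the strands run from \<open>in_left\<close> to \<open>out_right\<close> and from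
  \<open>in_right\<close> to \<open>out_left\<close>, while the orientation-compatible resolution joins \<open>in_left\<close> to
  \<open>out_left\<close> and \<open>in_right\<close> to \<open>out_right\<close>. Every vertex is the end of exactly two arcs of each
  resolution (possibly the two ends of one arc).\<close>

record 'v crossing =
  positive :: bool
  in_left :: 'v
  in_right :: 'v
  out_left :: 'v
  out_right :: 'v

record 'v annular_diagram =
  vertices :: "'v set"
  crossings :: "'v crossing list"
  arcs :: "('v \<times> 'v) set"
  cut_arcs :: "('v \<times> 'v) set"

definition n_crossings :: "'v annular_diagram \<Rightarrow> nat" where
  "n_crossings D = length (crossings D)"

definition n_plus :: "'v annular_diagram \<Rightarrow> nat" where
  "n_plus D = card {c. c < n_crossings D \<and> positive (crossings D ! c)}"

definition n_minus :: "'v annular_diagram \<Rightarrow> nat" where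
  "n_minus D = card {c. c < n_crossings D \<and> \<not> positive (crossings D ! c)}"

text \<open>A vertex of the cube is given by the set \<open>I\<close> of crossings carrying a 1-resolution.\<close>

definition smoothing :: "'v crossing \<Rightarrow> bool \<Rightarrow> ('v \<times> 'v) set" where
  "smoothing x one_res =
    (if positive x \<noteq> one_res
     then {(in_left x, out_left x), (in_right x, out_right x)}
     else {(in_left x, in_right x), (out_left x, out_right x)})"

definition resolution_arcs :: "'v annular_diagram \<Rightarrow> nat set \<Rightarrow> ('v \<times> 'v) set" where
  "resolution_arcs D I =
    arcs D \<union> cut_arcs D \<union> (\<Union>c<n_crossings D. smoothing (crossings D ! c) (c \<in> I))"

text \<open>A circle of a resolution is represented by the set of vertices lying on it.\<close>

definition circles :: "'v annular_diagram \<Rightarrow> nat set \<Rightarrow> 'v set set" where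
  "circles D I = vertices D // (resolution_arcs D I \<union> (resolution_arcs D I)\<inverse>)\<^sup>*"

text \<open>A simple closed curve in the annulus that is transverse to the radial arc fails to bound
  a disk if and only if it meets the radial arc an odd number of times.\<close>

definition nontrivial_circle :: "'v annular_diagram \<Rightarrow> 'v set \<Rightarrow> bool" where
  "nontrivial_circle D C \<longleftrightarrow> odd (card {e \<in> cut_arcs D. fst e \<in> C})"


text \<open>The closure of an \<open>n\<close>-strand braid word \<open>w\<close>: the vertex \<open>(j, p)\<close> is the \<open>p\<close>-th point from
  the left on the level just before the \<open>j\<close>-th letter of \<open>w\<close> (counted from 0). All strands run from
  level 0 to level \<open>length w\<close>, and the closing arcs are those crossing the radial arc.\<close>

definition braid_closure :: "nat \<Rightarrow> braid_word \<Rightarrow> (nat \<times> nat) annular_diagram" where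
  "braid_closure n w =
    \<lparr>vertices = {0..length w} \<times> {1..n},
     crossings = map (\<lambda>j. case w ! j of (i, b) \<Rightarrow>
       \<lparr>positive = b, in_left = (j, i), in_right = (j, i + 1),
        out_left = (j + 1, i), out_right = (j + 1, i + 1)\<rparr>) [0..<length w],
     arcs = {((j, p), (j + 1, p)) | j p.
       j < length w \<and> p \<in> {1..n} \<and> p \<noteq> fst (w ! j) \<and> p \<noteq> fst (w ! j) + 1},
     cut_arcs = {((length w, p), (0, p)) | p. p \<in> {1..n}}\<rparr>"


section \<open>Sutured annular Khovanov homology with coefficients in \<open>\<int>/2\<close>\<close>

datatype label = v_plus | v_minus

fun label_sign :: "label \<Rightarrow> int" where
  "label_sign v_plus = 1"
| "label_sign v_minus = -1"

text \<open>A generator is a vertex \<open>I\<close> of the cube together with a labelling of its circles,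
  that is, an element of the standard basis of the tensor product of the spaces \<open>V\<close>.\<close>

type_synonym 'v generator = "nat set \<times> ('v set \<Rightarrow> label)"

definition generators :: "'v annular_diagram \<Rightarrow> 'v generator set" where
  "generators D =
    (SIGMA I : Pow {..<n_crossings D}. circles D I \<rightarrow>\<^sub>E UNIV)"

definition h_degree :: "'v annular_diagram \<Rightarrow> 'v generator \<Rightarrow> int" where
  "h_degree D = (\<lambda>(I, l). int (card I) - int (n_minus D))"

definition q_degree :: "'v annular_diagram \<Rightarrow> 'v generator \<Rightarrow> int" where
  "q_degree D = (\<lambda>(I, l). (\<Sum>C\<in>circles D I. label_sign (l C))
     + int (card I) + int (n_plus D) - 2 * int (n_minus D))"

definition k_degree :: "'v annular_diagram \<Rightarrow> 'v generator \<Rightarrow> int" where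
  "k_degree D = (\<lambda>(I, l).
     \<Sum>C\<in>circles D I. if nontrivial_circle D C then label_sign (l C) else 0)"

text \<open>\<open>merge_term a b c\<close> holds if \<open>c\<close> occurs in the product of \<open>a\<close> and \<open>b\<close>, and
  \<open>split_term a b c\<close> holds if \<open>b \<otimes> c\<close> occurs in the coproduct of \<open>a\<close>.\<close>

inductive merge_term :: "label \<Rightarrow> label \<Rightarrow> label \<Rightarrow> bool" where
  "merge_term v_plus v_plus v_plus"
| "merge_term v_plus v_minus v_minus"
| "merge_term v_minus v_plus v_minus"

inductive split_term :: "label \<Rightarrow> label \<Rightarrow> label \<Rightarrow> bool" where
  "split_term v_plus v_plus v_minus"
| "split_term v_plus v_minus v_plus"
| "split_term v_minus v_minus v_minus"

text \<open>\<open>khovanov_term D g g'\<close> holds if the generator \<open>g'\<close> occurs in the full Khovanov differential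
  of the generator \<open>g\<close>. The circles affected by an edge of the cube are those
  belonging to only one of its two ends.\<close>

definition khovanov_term :: "'v annular_diagram \<Rightarrow> 'v generator \<Rightarrow> 'v generator \<Rightarrow> bool" where
  "khovanov_term D = (\<lambda>(I, l) (I', l').
    (\<exists>c<n_crossings D. c \<notin> I \<and> I' = insert c I) \<and>
    (\<forall>C\<in>circles D I \<inter> circles D I'. l' C = l C) \<and>
    ((\<exists>A B C. A \<noteq> B \<and> circles D I - circles D I' = {A, B} \<and>
        circles D I' - circles D I = {C} \<and> merge_term (l A) (l B) (l' C)) \<or>
     (\<exists>A B C. B \<noteq> C \<and> circles D I - circles D I' = {A} \<and>
        circles D I' - circles D I = {B, C} \<and> split_term (l A) (l' B) (l' C))))"

type_synonym 'v chain = "'v generator \<Rightarrow> bit"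

definition annular_differential :: "'v annular_diagram \<Rightarrow> 'v chain \<Rightarrow> 'v chain" where
  "annular_differential D x = (\<lambda>g'. if g' \<in> generators D
     then \<Sum>g | g \<in> generators D \<and> khovanov_term D g g' \<and> k_degree D g' = k_degree D g. x g
     else 0)"

definition chains :: "'v annular_diagram \<Rightarrow> int \<Rightarrow> int \<Rightarrow> int \<Rightarrow> 'v chain set" where
  "chains D i q k = {x. \<forall>g. x g \<noteq> 0 \<longrightarrow>
     g \<in> generators D \<and> h_degree D g = i \<and> q_degree D g = q \<and> k_degree D g = k}"

definition cycle_group :: "'v annular_diagram \<Rightarrow> int \<Rightarrow> int \<Rightarrow> int \<Rightarrow> 'v chain monoid" where
  "cycle_group D i q k =
    \<lparr>carrier = {x \<in> chains D i q k. annular_differential D x = (\<lambda>_. 0)},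
     monoid.mult = (\<lambda>x y g. x g + y g), one = (\<lambda>_. 0)\<rparr>"

definition boundaries :: "'v annular_diagram \<Rightarrow> int \<Rightarrow> int \<Rightarrow> int \<Rightarrow> 'v chain set" where
  "boundaries D i q k = annular_differential D ` chains D (i - 1) q k"

definition SKh :: "'v annular_diagram \<Rightarrow> int \<Rightarrow> int \<Rightarrow> int \<Rightarrow> 'v chain set monoid" where
  "SKh D i q k = cycle_group D i q k Mod boundaries D i q k"

text \<open>Each summand is a vector space over the field with two elements; the scalars 0 and 1 act
  in the only possible way, so the linear isomorphisms are exactly the isomorphisms of the
  underlying abelian groups. An isomorphism of triply graded spaces is a family of isomorphisms
  between the summands of the same tridegree.\<close>

definition SKh_isomorphic :: "'v annular_diagram \<Rightarrow> 'w annular_diagram \<Rightarrow> bool" where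
  "SKh_isomorphic D E \<longleftrightarrow> (\<forall>i q k. SKh D i q k \<cong> SKh E i q k)"

end

theory Submission
  imports Defs
begin

text \<open>Why the theorem holds: the part of \<open>k\<close>-degree \<open>n - 2\<close> of the annular Khovanov complex of the closure
  of an \<open>n\<close>-braid categorifies the trace of the Burau matrix, after the substitution \<open>s = q\<^sup>2\<close> and a
  shift that depends on \<open>n\<close> and on the exponent sum only. The graded Euler characteristic of the complex
  is that of its homology, so isomorphic homologies and equal exponent sums force equal traces.

  The Euler characteristic of the complex is compared with the trace state by state. In a resolution
  let \<open>J\<close> be the set of letters that are smoothed into a pair of turnbacks (a cap and a cup). A Burau
  letter is the identity plus a matrix \<open>c u v\<^sup>T\<close> of rank one, so the trace expands into a sum over the
  same sets \<open>J\<close>: the empty set contributes \<open>n\<close>, and a nonempty one contributes a product of weights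
  \<open>c\<close> and of numbers \<open>v\<^sup>T u\<close> over cyclically consecutive elements of \<open>J\<close> (\<open>trace_burau_word\<close>). These
  numbers are \<open>- (1 + s)\<close> for equal letters, \<open>s\<close> and \<open>1\<close> for neighbouring letters, and 0
  otherwise. On the Khovanov side, a resolution without turnbacks consists of \<open>n\<close> nontrivial circles,
  exactly one of which is labelled \<open>v_minus\<close>. If two cyclically consecutive letters of \<open>J\<close> are at
  distance at least 2, at most \<open>n - 4\<close> nontrivial circles remain, too few for \<open>k\<close>-degree \<open>n - 2\<close>
  (\<open>card_nontrivial_distant\<close>). In the other cases there are exactly \<open>n - 2\<close> nontrivial circles, all
  labelled \<open>v_plus\<close>, and one freely labelled trivial circle for every pair of equal consecutive letters
  (\<open>card_circles_connected\<close>), which accounts for the powers of \<open>1 + s\<close> (\<open>state_sum_connected\<close>).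

  Passing from the complex to its homology requires that the annular differential squares to zero.
  This is proved for every diagram with a parity property at its crossings (\<open>even_diagram\<close>), by
  deforming the Frobenius algebra \<open>\<F>\<^sub>2[x]/(x\<^sup>2)\<close> to \<open>\<F>\<^sub>2[x]/(x\<^sup>2 + x)\<close>. The deformed algebra consists
  of the functions on a two-point set, so a chain becomes a function on two-colourings of the vertices,
  every edge map is a restriction to the colourings compatible with both of its ends, and commutativity
  of the faces is evident (\<open>odd_card_deformed_paths\<close>). The Khovanov differential is the part of the
  deformed one that preserves the \<open>q\<close>-degree, the annular differential is the part of this that
  preserves the \<open>k\<close>-degree, and both degrees change monotonically, so the squares of these parts
  vanish as well (\<open>annular_differential_squared\<close>).\<close>

section \<open>The graded Euler characteristic of annular Khovanov homology\<close>

lemma bit_neq_0: "(a::bit) \<noteq> 0 \<longleftrightarrow> a = 1"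
  by (cases a) auto

lemma UNIV_label: "UNIV = {v_plus, v_minus}"
proof -
  have "x \<in> {v_plus, v_minus}" for x by (cases x) auto
  then show ?thesis by blast
qed

lemma finite_UNIV_label [simp]: "finite (UNIV :: label set)"
  by (simp add: UNIV_label)

lemma finite_circles [simp]: "finite (vertices D) \<Longrightarrow> finite (circles D I)"
  by (auto simp: circles_def quotient_def)

lemma finite_generators: "finite (vertices D) \<Longrightarrow> finite (generators D)"
  unfolding generators_def by (intro finite_SigmaI finite_PiE) auto

text \<open>A merge and a split both lower the sum of the signs of the labels by one, and the new 1-resolution
  makes up for it in the \<open>q\<close>-degree.\<close>

lemma khovanov_term_degrees:
  assumes fin: "finite (vertices D)" and g: "g \<in> generators D" and "khovanov_term D g g'"
  shows "h_degree D g' = h_degree D g + 1" "q_degree D g' = q_degree D g"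
proof -
  obtain I l I' l' where gs: "g = (I, l)" "g' = (I', l')" by (cases g, cases g') auto
  let ?P = "circles D I" and ?Q = "circles D I'"
  from assms(3) gs obtain c where c: "c \<notin> I" "I' = insert c I" and
    same: "\<And>C. C \<in> ?P \<inter> ?Q \<Longrightarrow> l' C = l C" and
    alt: "(\<exists>A B C. A \<noteq> B \<and> ?P - ?Q = {A, B} \<and> ?Q - ?P = {C} \<and> merge_term (l A) (l B) (l' C)) \<or>
     (\<exists>A B C. B \<noteq> C \<and> ?P - ?Q = {A} \<and> ?Q - ?P = {B, C} \<and> split_term (l A) (l' B) (l' C))"
    by (simp add: khovanov_term_def) metis
  have "finite I" using g gs by (auto simp: generators_def intro: finite_subset)
  with c have card: "card I' = card I + 1" by simp
  then show "h_degree D g' = h_degree D g + 1" by (simp add: gs h_degree_def)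
  let ?s = "\<lambda>C. label_sign (l C)" and ?s' = "\<lambda>C. label_sign (l' C)"
  have finP: "finite ?P" "finite ?Q" using fin by auto
  have "sum ?s ?P = sum ?s (?P \<inter> ?Q) + sum ?s (?P - ?Q)"
    using finP by (metis sum.Int_Diff)
  moreover have "sum ?s' ?Q = sum ?s' (?P \<inter> ?Q) + sum ?s' (?Q - ?P)"
    using finP by (metis sum.Int_Diff Int_commute)
  moreover have "sum ?s' (?P \<inter> ?Q) = sum ?s (?P \<inter> ?Q)" using same by (intro sum.cong) auto
  moreover have "sum ?s' (?Q - ?P) + 1 = sum ?s (?P - ?Q)"
    using alt
  proof (elim disjE exE conjE)
    fix A B C assume m: "A \<noteq> B" "?P - ?Q = {A, B}" "?Q - ?P = {C}" "merge_term (l A) (l B) (l' C)"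
    from m(4) have "?s' C + 1 = ?s A + ?s B" by (cases rule: merge_term.cases) simp_all
    with m(1) show ?thesis unfolding m(2,3) by simp
  next
    fix A B C assume m: "B \<noteq> C" "?P - ?Q = {A}" "?Q - ?P = {B, C}" "split_term (l A) (l' B) (l' C)"
    from m(4) have "?s' B + ?s' C + 1 = ?s A" by (cases rule: split_term.cases) simp_all
    with m(1) show ?thesis unfolding m(2,3) by simp
  qed
  ultimately show "q_degree D g' = q_degree D g" using card by (simp add: gs q_degree_def)
qed

definition generators_in :: "'v annular_diagram \<Rightarrow> int \<Rightarrow> int \<Rightarrow> int \<Rightarrow> 'v generator set" where
  "generators_in D i q k =
    {g \<in> generators D. h_degree D g = i \<and> q_degree D g = q \<and> k_degree D g = k}"

lemma chains_support: "x \<in> chains D i q k \<Longrightarrow> x g \<noteq> 0 \<Longrightarrow> g \<in> generators_in D i q k"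
  by (simp only: chains_def generators_in_def mem_Collect_eq) blast

lemma card_chains:
  assumes "finite (vertices D)"
  shows "card (chains D i q k) = 2 ^ card (generators_in D i q k)" "finite (chains D i q k)"
proof -
  let ?S = "generators_in D i q k"
  have fin: "finite ?S" using finite_generators[OF assms] by (auto simp: generators_in_def)
  have bij: "bij_betw (\<lambda>x. {g. x g \<noteq> 0}) (chains D i q k) (Pow ?S)"
    by (rule bij_betwI[of _ _ _ "\<lambda>X g. if g \<in> X then 1 else 0"])
      (auto simp: chains_def generators_in_def fun_eq_iff bit_neq_0 split: if_splits)
  show "card (chains D i q k) = 2 ^ card ?S"
    using bij_betw_same_card[OF bij] card_Pow[OF fin] by simp
  show "finite (chains D i q k)" using bij_betw_finite[OF bij] fin by simp
qed

definition chain_group :: "'v annular_diagram \<Rightarrow> int \<Rightarrow> int \<Rightarrow> int \<Rightarrow> 'v chain monoid" where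
  "chain_group D i q k =
    \<lparr>carrier = chains D i q k, monoid.mult = (\<lambda>x y g. x g + y g), one = (\<lambda>_. 0)\<rparr>"

lemma comm_group_chain_group: "comm_group (chain_group D i q k)"
proof (rule comm_groupI)
  fix x assume "x \<in> carrier (chain_group D i q k)"
  then show "\<exists>y\<in>carrier (chain_group D i q k). y \<otimes>\<^bsub>chain_group D i q k\<^esub> x = \<one>\<^bsub>chain_group D i q k\<^esub>"
    by (intro bexI[of _ x]) (auto simp: chain_group_def fun_eq_iff)
qed (auto simp: chain_group_def chains_def fun_eq_iff algebra_simps)

lemma annular_differential_chains:
  assumes "finite (vertices D)" "x \<in> chains D i q k"
  shows "annular_differential D x \<in> chains D (i + 1) q k"
  unfolding chains_def
proof (intro CollectI allI impI)
  fix g' assume nz: "annular_differential D x g' \<noteq> 0"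
  let ?S = "{g \<in> generators D. khovanov_term D g g' \<and> k_degree D g' = k_degree D g}"
  from nz have g': "g' \<in> generators D" by (auto simp: annular_differential_def split: if_splits)
  with nz have "sum x ?S \<noteq> 0" by (simp add: annular_differential_def)
  then obtain g where g: "g \<in> ?S" and "x g \<noteq> 0" by (rule sum.not_neutral_contains_not_neutral)
  from chains_support[OF assms(2) \<open>x g \<noteq> 0\<close>]
  have "h_degree D g = i \<and> q_degree D g = q \<and> k_degree D g = k" by (simp add: generators_in_def)
  then show "g' \<in> generators D \<and> h_degree D g' = i + 1 \<and> q_degree D g' = q \<and> k_degree D g' = k"
    using g g' khovanov_term_degrees[OF assms(1), of g g'] by simp
qed

lemma group_hom_annular_differential:
  assumes "finite (vertices D)"
  shows "group_hom (chain_group D i q k) (chain_group D (i + 1) q k) (annular_differential D)"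
proof (intro group_hom.intro group_hom_axioms.intro homI)
  fix x y
  show "annular_differential D (x \<otimes>\<^bsub>chain_group D i q k\<^esub> y) =
    annular_differential D x \<otimes>\<^bsub>chain_group D (i + 1) q k\<^esub> annular_differential D y"
    by (auto simp add: annular_differential_def chain_group_def sum.distrib fun_eq_iff simp del: add_bit_eq_xor)
qed (use annular_differential_chains[OF assms] comm_group.axioms(2)[OF comm_group_chain_group] in
      \<open>auto simp: chain_group_def\<close>)

text \<open>Exactness of \<open>0 \<rightarrow> B\<^sub>i \<rightarrow> Z\<^sub>i \<rightarrow> SKh\<^sub>i \<rightarrow> 0\<close> and \<open>0 \<rightarrow> Z\<^sub>i \<rightarrow> C\<^sub>i \<rightarrow> B\<^sub>i\<^sub>+\<^sub>1 \<rightarrow> 0\<close>, read off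
  from the number of elements of these finite groups.\<close>

lemma card_chains_eq_SKh_boundaries:
  assumes fin: "finite (vertices D)"
    and dd: "\<And>x. annular_differential D (annular_differential D x) = (\<lambda>_. 0)"
  shows "card (chains D i q k) =
    card (carrier (SKh D i q k)) * card (boundaries D i q k) * card (boundaries D (i + 1) q k)"
proof -
  let ?d = "annular_differential D"
  let ?C = "\<lambda>i. chain_group D i q k"
  have carr: "carrier (?C i) = chains D i q k" for i by (simp add: chain_group_def)
  interpret h: group_hom "?C i" "?C (i + 1)" ?d by (rule group_hom_annular_differential[OF fin])
  interpret h': group_hom "?C (i - 1)" "?C i" ?d
    using group_hom_annular_differential[OF fin, of "i - 1"] by simp
  let ?K = "kernel (?C i) (?C (i + 1)) ?d"
  have K: "cycle_group D i q k = (?C i)\<lparr>carrier := ?K\<rparr>"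
    by (auto simp: cycle_group_def chain_group_def kernel_def)
  have subK: "subgroup ?K (?C i)" by (rule h.subgroup_kernel)
  have B: "boundaries D i q k = ?d ` carrier (?C (i - 1))"
    and B': "boundaries D (i + 1) q k = ?d ` carrier (?C i)"
    by (simp_all add: boundaries_def carr)
  have "subgroup (boundaries D i q k) (?C i)" unfolding B by (rule h'.img_is_subgroup)
  moreover have "boundaries D i q k \<subseteq> ?K"
    using h'.hom_closed dd by (auto simp: B kernel_def) (simp add: chain_group_def)
  ultimately have subB: "subgroup (boundaries D i q k) (cycle_group D i q k)"
    unfolding K using subK by (intro h.G.subgroup_incl)
  have "group (cycle_group D i q k)"
    unfolding K by (rule subgroup.subgroup_is_group[OF subK h.G.is_group])
  from group.lagrange[OF this subB]
  have 1: "card (carrier (SKh D i q k)) * card (boundaries D i q k) = card ?K"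
    by (simp add: SKh_def FactGroup_def order_def K)
  let ?E = "(?C (i + 1))\<lparr>carrier := boundaries D (i + 1) q k\<rparr>"
  have subE: "subgroup (boundaries D (i + 1) q k) (?C (i + 1))"
    unfolding B' by (rule h.img_is_subgroup)
  interpret e: group_hom "?C i" ?E ?d
    by (intro group_hom.intro group_hom_axioms.intro homI h.G.is_group
        subgroup.subgroup_is_group[OF subE h.H.is_group]) (auto simp: B')
  have iso: "(?C i Mod kernel (?C i) ?E ?d) \<cong> ?E"
    by (rule e.FactGroup_iso) (simp add: B')
  have "kernel (?C i) ?E ?d = ?K" by (simp add: kernel_def)
  with iso_same_card[OF iso] have "card (rcosets\<^bsub>?C i\<^esub> ?K) = card (boundaries D (i + 1) q k)"
    by (simp add: FactGroup_def)
  with h.G.lagrange[OF subK] have 2: "card (boundaries D (i + 1) q k) * card ?K = card (chains D i q k)"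
    by (simp add: order_def carr)
  show ?thesis using 1 2 by (simp add: ac_simps)
qed

definition parity_sign :: "int \<Rightarrow> 'a::ring_1" where
  "parity_sign i = (if even i then 1 else -1)"

lemma alternating_sum_telescopes:
  fixes b :: "int \<Rightarrow> 'a::comm_ring_1"
  shows "(\<Sum>i\<in>{- int N..int N}. parity_sign i * (b i + b (i + 1))) =
    parity_sign (int N) * (b (- int N) + b (int N + 1))"
proof (induction N)
  case (Suc N)
  have "{- int (Suc N)..int (Suc N)} = insert (- int (Suc N)) (insert (int (Suc N)) {- int N..int N})"
    by auto
  with Suc show ?case by (simp add: parity_sign_def algebra_simps)
qed (simp add: parity_sign_def)

text \<open>Dimensions over the field with two elements are binary logarithms of cardinalities. The boundaries
  telescope, and the complex vanishes outside the range of summation.\<close>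

lemma alternating_sum_SKh:
  fixes D :: "'v annular_diagram"
  assumes fin: "finite (vertices D)"
    and dd: "\<And>x. annular_differential D (annular_differential D x) = (\<lambda>_. 0)"
    and N: "n_crossings D < N"
  shows "(\<Sum>i\<in>{-int N..int N}. parity_sign i * log 2 (card (carrier (SKh D i q k)))) =
    (\<Sum>g\<in>{g \<in> generators D. q_degree D g = q \<and> k_degree D g = k}. parity_sign (h_degree D g))"
    (is "_ = sum _ ?G")
proof -
  let ?h = "\<lambda>i. log 2 (card (carrier (SKh D i q k)))" and ?b = "\<lambda>i. log 2 (card (boundaries D i q k))"
    and ?c = "\<lambda>i. real (card (generators_in D i q k))"
  let ?R = "{-int N..int N}"
  have c: "?c i = ?h i + ?b i + ?b (i + 1)" for i
  proof -
    let ?x = "card (carrier (SKh D i q k))" and ?y = "card (boundaries D i q k)"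
      and ?z = "card (boundaries D (i + 1) q k)"
    have eq: "2 ^ card (generators_in D i q k) = ?x * ?y * ?z"
      using card_chains_eq_SKh_boundaries[OF fin dd, of i q k] card_chains(1)[OF fin, of i q k]
      by (simp only:)
    have "?x * ?y * ?z \<noteq> 0" unfolding eq[symmetric] by simp
    then have pos: "0 < ?x" "0 < ?y" "0 < ?z" by simp_all
    have "?c i = log 2 (2 ^ card (generators_in D i q k))" by (simp add: log_nat_power)
    also have "\<dots> = log 2 (real (?x * ?y * ?z))" unfolding eq[symmetric] by simp
    also have "\<dots> = ?h i + ?b i + ?b (i + 1)" using pos by (simp only: of_nat_mult) (simp add: log_mult_pos)
    finally show ?thesis .
  qed
  \<comment> \<open>so the complex vanishes at both ends of the range of summation\<close>
  have h_bound: "\<bar>h_degree D g\<bar> \<le> int (n_crossings D)" if "g \<in> generators D" for g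
  proof -
    obtain I l where gI: "g = (I, l)" by (cases g)
    with that have g: "g = (I, l)" "I \<subseteq> {..<n_crossings D}" by (auto simp: generators_def)
    then have "card I \<le> n_crossings D" using card_mono[of "{..<n_crossings D}" I] by simp
    moreover have "n_minus D \<le> n_crossings D"
      using card_mono[of "{..<n_crossings D}" "{c. c < n_crossings D \<and> \<not> positive (crossings D ! c)}"]
      by (simp add: n_minus_def subset_iff)
    ultimately show ?thesis by (auto simp: g h_degree_def)
  qed
  have "card (boundaries D i q k) = 1" if i: "\<bar>i - 1\<bar> > int (n_crossings D)" for i
  proof -
    have zero: "x = (\<lambda>_. 0)" if x: "x \<in> chains D (i - 1) q k" for x
    proof
      fix g
      show "x g = 0"
      proof (rule ccontr)
        assume "x g \<noteq> 0"
        then have "g \<in> generators D" "h_degree D g = i - 1"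
          using chains_support[OF x] by (simp_all add: generators_in_def)
        with h_bound[of g] i show False by simp
      qed
    qed
    have "chains D (i - 1) q k = {\<lambda>_. 0}"
    proof (intro equalityI subsetI)
      fix x assume "x \<in> chains D (i - 1) q k"
      then show "x \<in> {\<lambda>_. 0}" unfolding singleton_iff by (rule zero)
    qed (simp add: chains_def)
    then show ?thesis by (simp add: boundaries_def)
  qed
  then have "card (boundaries D (- int N) q k) = 1" "card (boundaries D (int N + 1) q k) = 1"
    using N by simp_all
  then have telescoped: "(\<Sum>i\<in>?R. parity_sign i * (?b i + ?b (i + 1))) = 0"
    using alternating_sum_telescopes[of ?b N] by simp
  have "parity_sign i * ?c i = parity_sign i * ?h i + parity_sign i * (?b i + ?b (i + 1))" for i
    unfolding c[of i] by (simp only: add.assoc distrib_left)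
  then have "(\<Sum>i\<in>?R. parity_sign i * ?h i) = (\<Sum>i\<in>?R. parity_sign i * ?c i)"
    by (simp only: sum.distrib telescoped add_0_right)
  also have "\<dots> = (\<Sum>i\<in>?R. \<Sum>g\<in>{g \<in> ?G. h_degree D g = i}. parity_sign (h_degree D g))"
  proof (intro sum.cong HOL.refl)
    fix i
    have G: "{g \<in> ?G. h_degree D g = i} = generators_in D i q k"
      by (simp only: generators_in_def mem_Collect_eq conj_ac)
    have "parity_sign i * ?c i = (\<Sum>g\<in>generators_in D i q k. parity_sign i)"
      by (simp only: sum_constant mult.commute)
    also have "\<dots> = (\<Sum>g\<in>generators_in D i q k. parity_sign (h_degree D g))"
      by (rule sum.cong) (simp_all only: generators_in_def mem_Collect_eq)
    finally show "parity_sign i * ?c i = (\<Sum>g\<in>{g \<in> ?G. h_degree D g = i}. parity_sign (h_degree D g))"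
      unfolding G .
  qed
  also have "\<dots> = (\<Sum>g\<in>?G. parity_sign (h_degree D g))"
  proof (rule sum.group)
    show "h_degree D ` ?G \<subseteq> ?R"
    proof
      fix i assume "i \<in> h_degree D ` ?G"
      then obtain g where "g \<in> generators D" "i = h_degree D g" by blast
      with h_bound[of g] N show "i \<in> ?R" by (auto simp: abs_le_iff)
    qed
    show "finite ?G" using finite_generators[OF fin] by simp
  qed simp
  finally show ?thesis .
qed

text \<open>For fixed \<open>q\<close> and \<open>k\<close>, both sides are alternating sums of the dimensions of the homology.\<close>

theorem SKh_isomorphic_imp_euler_characteristic_eq:
  fixes D :: "'v annular_diagram" and E :: "'w annular_diagram"
  assumes "SKh_isomorphic D E" and "finite (vertices D)" "finite (vertices E)"
    and "\<And>x. annular_differential D (annular_differential D x) = (\<lambda>_. 0)"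
    and "\<And>x. annular_differential E (annular_differential E x) = (\<lambda>_. 0)"
  shows "(\<Sum>g\<in>{g \<in> generators D. q_degree D g = q \<and> k_degree D g = k}. parity_sign (h_degree D g)) =
    (\<Sum>g\<in>{g \<in> generators E. q_degree E g = q \<and> k_degree E g = k}. parity_sign (h_degree E g) :: real)"
proof -
  define N where "N = Suc (max (n_crossings D) (n_crossings E))"
  have N: "n_crossings D < N" "n_crossings E < N" by (simp_all add: N_def)
  have card: "card (carrier (SKh D i q k)) = card (carrier (SKh E i q k))" for i
    by (rule iso_same_card) (use assms(1) in \<open>simp add: SKh_isomorphic_def\<close>)
  note D = alternating_sum_SKh[OF assms(2,4) N(1), of q k, unfolded card]
    and E = alternating_sum_SKh[OF assms(3,5) N(2), of q k]
  show ?thesis by (rule HOL.trans[OF HOL.sym[OF D] E])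
qed

section \<open>Changing one smoothing\<close>

definition conn :: "('v \<times> 'v) set \<Rightarrow> ('v \<times> 'v) set" where
  "conn R = (R \<union> R\<inverse>)\<^sup>*"

definition closed_under :: "('v \<times> 'v) set \<Rightarrow> 'v set \<Rightarrow> bool" where
  "closed_under R K \<longleftrightarrow> (\<forall>(u, v)\<in>R. u \<in> K \<longleftrightarrow> v \<in> K)"

lemma conn_refl [simp, intro]: "(u, u) \<in> conn R"
  by (simp add: conn_def)

lemma conn_sym: "(u, v) \<in> conn R \<Longrightarrow> (v, u) \<in> conn R"
  unfolding conn_def by (rule symD[OF sym_rtrancl]) (auto simp: sym_def)

lemma conn_trans: "(u, v) \<in> conn R \<Longrightarrow> (v, w) \<in> conn R \<Longrightarrow> (u, w) \<in> conn R"
  unfolding conn_def by (rule rtrancl_trans)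

lemma conn_arc: "(u, v) \<in> R \<Longrightarrow> (u, v) \<in> conn R"
  unfolding conn_def by blast

lemma conn_mono: "R \<subseteq> S \<Longrightarrow> conn R \<subseteq> conn S"
  unfolding conn_def by (intro rtrancl_mono) auto

lemma equiv_conn: "equiv UNIV (conn R)"
  by (auto intro!: equivI simp: refl_on_def sym_def trans_def intro: conn_sym conn_trans)

lemma closed_under_conn:
  assumes "closed_under R K" "(u, v) \<in> conn R"
  shows "u \<in> K \<longleftrightarrow> v \<in> K"
  using assms(2) unfolding conn_def
  by (induction rule: rtrancl_induct) (use assms(1) in \<open>auto simp: closed_under_def\<close>)

lemma closed_under_class: "closed_under R (conn R `` {u})"
  by (auto simp: closed_under_def) (meson conn_trans conn_arc conn_sym)+

lemma conn_insert_absorb: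
  assumes "(x, y) \<in> conn R"
  shows "conn (insert (x, y) R) = conn R"
proof
  have "(u, v) \<in> conn R" if "(u, v) \<in> conn (insert (x, y) R)" for u v
    using that unfolding conn_def[of "insert _ _"]
    by (induction rule: rtrancl_induct)
      (use assms in \<open>auto, (meson conn_trans conn_arc conn_sym)+\<close>)
  then show "conn (insert (x, y) R) \<subseteq> conn R" by auto
qed (simp add: conn_mono subset_insertI)

lemma conn_insert:
  "(u, v) \<in> conn (insert (x, y) R) \<longleftrightarrow> (u, v) \<in> conn R \<or>
     (u, x) \<in> conn R \<and> (y, v) \<in> conn R \<or> (u, y) \<in> conn R \<and> (x, v) \<in> conn R"
    (is "?l \<longleftrightarrow> ?r v")
proof
  assume ?l
  then show "?r v"
    unfolding conn_def[of "insert _ _"]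
  proof (induction rule: rtrancl_induct)
    case (step v w)
    then have "(v, w) \<in> conn R \<or> (v = x \<and> w = y) \<or> (v = y \<and> w = x)"
      by (auto intro: conn_arc conn_sym)
    with step.IH show ?case by (meson conn_refl conn_sym conn_trans)
  qed simp
next
  let ?S = "insert (x, y) R"
  have sub: "(a, b) \<in> conn R \<Longrightarrow> (a, b) \<in> conn ?S" for a b
    using conn_mono[of R ?S] by auto
  have xy: "(x, y) \<in> conn ?S" by (rule conn_arc) simp
  assume "?r v"
  then show ?l by (meson sub xy conn_sym conn_trans)
qed

definition merges :: "'v set set \<Rightarrow> 'v set set \<Rightarrow> bool" where
  "merges P Q \<longleftrightarrow> (\<exists>A B R. P = insert A (insert B R) \<and> Q = insert (A \<union> B) R \<and>
     A \<noteq> B \<and> A \<inter> B = {} \<and> A \<notin> R \<and> B \<notin> R \<and> A \<union> B \<notin> R)"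

lemma merges_quotient_insert:
  assumes "x \<in> V" "y \<in> V" and xy: "(x, y) \<notin> conn R"
  shows "merges (V // conn R) (V // conn (insert (x, y) R))"
proof -
  let ?c = "\<lambda>v. conn R `` {v}" and ?d = "\<lambda>v. conn (insert (x, y) R) `` {v}"
  have d: "?d v = (if (x, v) \<in> conn R \<or> (y, v) \<in> conn R then ?c x \<union> ?c y else ?c v)" for v
    by (auto simp: conn_insert) (meson conn_sym conn_trans)+
  have c: "?c v = ?c x \<longleftrightarrow> (x, v) \<in> conn R" "?c v = ?c y \<longleftrightarrow> (y, v) \<in> conn R" for v
    by (metis (no_types) Image_singleton_iff conn_refl conn_sym equiv_class_eq equiv_conn)+
  have ne: "?c v \<noteq> ?c x \<union> ?c y" for v
    using xy by (auto simp: set_eq_iff) (meson conn_refl conn_sym conn_trans)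
  define Rest where "Rest = ?c ` {v \<in> V. (x, v) \<notin> conn R \<and> (y, v) \<notin> conn R}"
  have "V // conn R = ?c ` V" by (auto simp: quotient_def)
  also have "\<dots> = insert (?c x) (insert (?c y) Rest)"
  proof
    show "?c ` V \<subseteq> insert (?c x) (insert (?c y) Rest)"
    proof
      fix K assume "K \<in> ?c ` V"
      then obtain v where "v \<in> V" "K = ?c v" by blast
      then show "K \<in> insert (?c x) (insert (?c y) Rest)" using c[of v] unfolding Rest_def by blast
    qed
    show "insert (?c x) (insert (?c y) Rest) \<subseteq> ?c ` V"
      using assms(1,2) unfolding Rest_def by blast
  qed
  finally have P: "V // conn R = insert (?c x) (insert (?c y) Rest)" .
  have "V // conn (insert (x, y) R) = ?d ` V" by (auto simp: quotient_def)
  also have "\<dots> = insert (?c x \<union> ?c y) Rest"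
  proof
    show "?d ` V \<subseteq> insert (?c x \<union> ?c y) Rest" by (auto simp: d Rest_def)
    have "?c x \<union> ?c y = ?d x" by (simp add: d)
    then have "?c x \<union> ?c y \<in> ?d ` V" using assms(1) by blast
    moreover have "Rest \<subseteq> ?d ` V"
    proof
      fix K assume "K \<in> Rest"
      then obtain v where v: "v \<in> V" "(x, v) \<notin> conn R" "(y, v) \<notin> conn R" "K = ?c v"
        unfolding Rest_def by blast
      then have "K = ?d v" by (simp add: d)
      with v(1) show "K \<in> ?d ` V" by blast
    qed
    ultimately show "insert (?c x \<union> ?c y) Rest \<subseteq> ?d ` V" by blast
  qed
  finally have Q: "V // conn (insert (x, y) R) = insert (?c x \<union> ?c y) Rest" .
  have "K \<noteq> ?c x \<and> K \<noteq> ?c y \<and> K \<noteq> ?c x \<union> ?c y" if "K \<in> Rest" for K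
  proof -
    from that obtain v where v: "(x, v) \<notin> conn R" "(y, v) \<notin> conn R" "K = ?c v"
      unfolding Rest_def by blast
    show ?thesis unfolding v(3) using c[of v] ne[of v] v(1,2) by blast
  qed
  then have notin: "?c x \<notin> Rest" "?c y \<notin> Rest" "?c x \<union> ?c y \<notin> Rest" by blast+
  have "?c x \<noteq> ?c y" using xy c(2)[of x] conn_sym[of y x R] by blast
  moreover have "?c x \<inter> ?c y = {}" using xy conn_trans[of x _ R y] conn_sym[of y _ R] by blast
  ultimately show ?thesis unfolding merges_def using P Q notin by (intro exI conjI)
qed

text \<open>By evenness, the arcs in \<open>R\<close> join the four ends in pairs or all together. If they join \<open>a\<close> to \<open>b\<close> and
  \<open>c\<close> to \<open>d\<close> only, the second smoothing merges two parts of the first; if they join \<open>a\<close> to \<open>c\<close> and \<open>b\<close> to \<open>d\<close>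
  only, it splits one. In the remaining cases each smoothing connects all four ends.\<close>

lemma resmoothing:
  assumes V: "a \<in> V" "b \<in> V" "c \<in> V" "d \<in> V" and dist: "distinct [a, b, c, d]"
    and even: "\<And>K. closed_under R K \<Longrightarrow> even (card (K \<inter> {a, b, c, d}))"
  defines "P \<equiv> V // conn ({(a, b), (c, d)} \<union> R)" and "Q \<equiv> V // conn ({(a, c), (b, d)} \<union> R)"
  shows "P = Q \<or> merges P Q \<or> merges Q P"
proof -
  let ?e = "\<lambda>u v. (u, v) \<in> conn R"
  have ev: "even (card ({a, b, c, d} \<inter> conn R `` {u}))" for u
    using even[OF closed_under_class[of R u]] by (simp add: Int_commute)
  have s: "?e u v \<longleftrightarrow> ?e v u" for u v using conn_sym by metis
  from ev[of a] dist have a: "?e a b \<or> ?e a c \<or> ?e a d"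
    by (auto simp: Int_insert_left split: if_splits)
  have p: "?e u v \<Longrightarrow> ?e w z" if "{u, v, w, z} = {a, b, c, d}" "distinct [u, v, w, z]" for u v w z
  proof (rule ccontr)
    assume uv: "?e u v" and wz: "\<not> ?e w z"
    have "even (card ({u, v, w, z} \<inter> conn R `` {w}))" using ev that(1) by simp
    then have "?e w u \<noteq> ?e w v" using that(2) wz by (auto simp: Int_insert_left split: if_splits)
    with uv show False by (meson conn_trans conn_sym)
  qed
  have two: "V // conn ({(x, y), (z, w)} \<union> R) = V // conn (insert (x, y) R)"
    if e: "?e x z \<and> ?e y w \<or> ?e x w \<and> ?e y z \<or> ?e z w" for x y z w
  proof -
    from e have "(z, w) \<in> conn (insert (x, y) R)" unfolding conn_insert using s by metis
    then have "conn (insert (z, w) (insert (x, y) R)) = conn (insert (x, y) R)"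
      by (rule conn_insert_absorb)
    moreover have "{(x, y), (z, w)} \<union> R = insert (z, w) (insert (x, y) R)" by blast
    ultimately show ?thesis by simp
  qed
  from a have "(?e a b \<and> ?e c d) \<or> (?e a c \<and> ?e b d) \<or> (?e a d \<and> ?e b c)"
  proof -
    have "?e a b \<Longrightarrow> ?e c d" by (rule p[of a b]) (use dist in auto)
    moreover have "?e a c \<Longrightarrow> ?e b d" by (rule p[of a c]) (use dist in auto)
    moreover have "?e a d \<Longrightarrow> ?e b c" by (rule p[of a d]) (use dist in auto)
    ultimately show ?thesis using a by blast
  qed
  then show ?thesis
  proof (elim disjE conjE)
    assume e: "?e a b" "?e c d"
    have "P = V // conn (insert (a, b) R)" unfolding P_def by (rule two) (simp add: e)
    then have P: "P = V // conn R" by (simp only: conn_insert_absorb[OF e(1)])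
    have Q: "Q = V // conn (insert (a, c) R)" unfolding Q_def by (rule two) (simp add: e)
    show ?thesis
    proof (cases "?e a c")
      case True
      then have "P = Q" unfolding P Q by (simp only: conn_insert_absorb)
      then show ?thesis ..
    qed (use merges_quotient_insert[OF V(1,3)] P Q in simp)
  next
    assume e: "?e a c" "?e b d"
    have "Q = V // conn (insert (a, c) R)" unfolding Q_def by (rule two) (simp add: e)
    then have Q: "Q = V // conn R" by (simp only: conn_insert_absorb[OF e(1)])
    have P: "P = V // conn (insert (a, b) R)" unfolding P_def by (rule two) (simp add: e)
    show ?thesis
    proof (cases "?e a b")
      case True
      then have "P = Q" unfolding P Q by (simp only: conn_insert_absorb)
      then show ?thesis ..
    qed (use merges_quotient_insert[OF V(1,2)] P Q in simp)
  next
    assume e: "?e a d" "?e b c"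
    have P: "P = V // conn (insert (a, b) R)" unfolding P_def by (rule two) (simp add: e)
    have Q: "Q = V // conn (insert (a, c) R)" unfolding Q_def
      by (rule two) (use e s in blast)
    have ab: "(a, c) \<in> conn (insert (a, b) R)" and ac: "(a, b) \<in> conn (insert (a, c) R)"
      unfolding conn_insert using e s by blast+
    have "conn (insert (a, b) R) = conn (insert (a, c) (insert (a, b) R))"
      by (rule conn_insert_absorb[OF ab, symmetric])
    also have "\<dots> = conn (insert (a, c) R)"
      by (subst insert_commute) (rule conn_insert_absorb[OF ac])
    finally show ?thesis by (simp add: P Q)
  qed
qed

section \<open>The annular differential squares to zero\<close>

lemma closed_under_Un [simp]:
  "closed_under (R \<union> S) K \<longleftrightarrow> closed_under R K \<and> closed_under S K"
  unfolding closed_under_def by blast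

lemma closed_under_toggle:
  "closed_under R X \<Longrightarrow> closed_under R K \<Longrightarrow> closed_under R ((X - K) \<union> (K - X))"
  unfolding closed_under_def by blast

text \<open>If there are two such sets, toggling the elements of their symmetric difference is an involution
  without fixed points.\<close>

lemma odd_card_closed_sets_between:
  fixes V L U :: "'v set" and R :: "('v \<times> 'v) set"
  assumes "finite V"
  defines "S \<equiv> {X. X \<subseteq> V \<and> closed_under R X \<and> L \<subseteq> X \<and> X \<subseteq> U}"
  shows "odd (card S) \<longleftrightarrow> (\<exists>!X. X \<in> S)"
proof (cases "\<exists>X Y. X \<in> S \<and> Y \<in> S \<and> X \<noteq> Y")
  case False
  then have "S = {} \<or> (\<exists>X. S = {X})" by blast
  then show ?thesis by auto
next
  case True
  then obtain X0 X1 where X: "X0 \<in> S" "X1 \<in> S" "X0 \<noteq> X1" by blast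
  define K where "K = (X0 - X1) \<union> (X1 - X0)"
  from X(3) obtain v where v: "v \<in> K" unfolding K_def by blast
  define f where "f X = (X - K) \<union> (K - X)" for X
  have K: "K \<subseteq> V" "closed_under R K" "K \<inter> L = {}" "K \<subseteq> U"
    using X closed_under_toggle[of R X0 X1] unfolding S_def K_def by blast+
  have f: "f X \<in> S" if "X \<in> S" for X
    using that K closed_under_toggle[of R X K] unfolding S_def f_def by blast
  have ff: "f (f X) = X" for X unfolding f_def by blast
  have fv: "v \<in> f X \<longleftrightarrow> v \<notin> X" for X using v unfolding f_def by blast
  have bij: "bij_betw f {X \<in> S. v \<in> X} {X \<in> S. v \<notin> X}"
    by (rule bij_betwI[of _ _ _ f]) (use f ff fv in \<open>auto simp: Pi_iff\<close>)
  have fin: "finite S" unfolding S_def using assms(1) by simp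
  have "S = {X \<in> S. v \<in> X} \<union> {X \<in> S. v \<notin> X}" by blast
  then have "card S = card {X \<in> S. v \<in> X} + card {X \<in> S. v \<notin> X}"
    using fin card_Un_disjoint[of "{X \<in> S. v \<in> X}" "{X \<in> S. v \<notin> X}"] by fastforce
  then have "card S = 2 * card {X \<in> S. v \<in> X}" using bij_betw_same_card[OF bij] by simp
  then show ?thesis using X by auto
qed

lemma bij_betw_Collect_image:
  "bij_betw f A B \<Longrightarrow> bij_betw f {x \<in> A. P (f x)} {y \<in> B. P y}"
  unfolding bij_betw_def inj_on_def by blast

definition other_arcs :: "'v annular_diagram \<Rightarrow> nat set \<Rightarrow> nat \<Rightarrow> ('v \<times> 'v) set" where
  "other_arcs D I c = arcs D \<union> cut_arcs D \<union>
     (\<Union>c'\<in>{..<n_crossings D} - {c}. smoothing (crossings D ! c') (c' \<in> I))"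

definition crossing_ends :: "'v crossing \<Rightarrow> 'v set" where
  "crossing_ends x = {in_left x, in_right x, out_left x, out_right x}"

lemma circles_eq: "circles D I = vertices D // conn (resolution_arcs D I)"
  by (simp add: circles_def conn_def)

text \<open>The last condition follows from the handshake lemma for diagrams: every vertex is the end of two arcs of a
  resolution, and the ends of a crossing lose one of them when its smoothing is removed.\<close>

locale even_diagram =
  fixes D :: "'v annular_diagram"
  assumes finite_vertices: "finite (vertices D)"
    and arc_vertices: "arcs D \<union> cut_arcs D \<subseteq> vertices D \<times> vertices D"
    and crossing_vertices: "c < n_crossings D \<Longrightarrow> crossing_ends (crossings D ! c) \<subseteq> vertices D"
    and card_ends: "c < n_crossings D \<Longrightarrow> card (crossing_ends (crossings D ! c)) = 4"
    and even_ends: "c < n_crossings D \<Longrightarrow> closed_under (other_arcs D I c) K \<Longrightarrow>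
      even (card (K \<inter> crossing_ends (crossings D ! c)))"
begin

abbreviation V where "V \<equiv> vertices D"
abbreviation ra where "ra \<equiv> resolution_arcs D"

lemma circles_change:
  assumes c: "c < n_crossings D" "c \<notin> I"
  shows "circles D I = circles D (insert c I) \<or> merges (circles D I) (circles D (insert c I)) \<or>
    merges (circles D (insert c I)) (circles D I)"
proof -
  define x where "x = crossings D ! c"
  have split: "ra J = smoothing x (c \<in> J) \<union> other_arcs D J c" for J
    using c(1) unfolding resolution_arcs_def other_arcs_def x_def by blast
  have other: "other_arcs D (insert c I) c = other_arcs D I c"
    unfolding other_arcs_def by (intro arg_cong2[where f = union] HOL.refl SUP_cong) auto
  have V: "in_left x \<in> V" "in_right x \<in> V" "out_left x \<in> V" "out_right x \<in> V"
    using crossing_vertices[OF c(1)] by (simp_all add: x_def crossing_ends_def)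
  have dist: "distinct [in_left x, in_right x, out_left x, out_right x]"
    using card_ends[OF c(1)] card_distinct[of "[in_left x, in_right x, out_left x, out_right x]"]
    by (simp add: x_def crossing_ends_def)
  have ev: "even (card (K \<inter> {in_left x, in_right x, out_left x, out_right x}))"
    if "closed_under (other_arcs D I c) K" for K
    using even_ends[OF c(1) that] by (simp add: x_def crossing_ends_def)
  have swap: "{in_left x, out_left x, in_right x, out_right x} =
      {in_left x, in_right x, out_left x, out_right x}" by blast
  show ?thesis
  proof (cases "positive x")
    case True
    show ?thesis
      using resmoothing[OF V(1,3,2,4), of "other_arcs D I c"] dist ev c(2) True
      unfolding circles_eq split other swap by (auto simp: smoothing_def)
  next
    case False
    show ?thesis
      using resmoothing[OF V(1,2,3,4), of "other_arcs D I c"] dist ev c(2) False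
      unfolding circles_eq split other by (auto simp: smoothing_def)
  qed
qed

lemma resolution_arcs_vertices: "ra I \<subseteq> V \<times> V"
proof -
  have "smoothing (crossings D ! c) b \<subseteq> V \<times> V" if "c < n_crossings D" for c b
    using crossing_vertices[OF that] by (auto simp: smoothing_def crossing_ends_def)
  then show ?thesis using arc_vertices unfolding resolution_arcs_def by blast
qed

lemma circle_closed: "C \<in> circles D I \<Longrightarrow> closed_under (ra I) C"
  unfolding circles_eq by (auto elim!: quotientE intro: closed_under_class)

lemma circle_subset: "C \<in> circles D I \<Longrightarrow> C \<subseteq> V"
proof -
  assume "C \<in> circles D I"
  then obtain u where u: "u \<in> V" "C = conn (ra I) `` {u}"
    unfolding circles_eq by (auto elim!: quotientE)
  have "closed_under (ra I) V"
    using resolution_arcs_vertices[of I] unfolding closed_under_def by blast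
  from closed_under_conn[OF this] u show ?thesis by blast
qed

lemma circle_nonempty: "C \<in> circles D I \<Longrightarrow> C \<noteq> {}"
  unfolding circles_eq by (auto elim!: quotientE)

lemma circle_subset_or_disjoint:
  assumes "C \<in> circles D I" "closed_under (ra I) K"
  shows "C \<subseteq> K \<or> C \<inter> K = {}"
proof -
  obtain u where u: "C = conn (ra I) `` {u}"
    using assms(1) unfolding circles_eq by (auto elim!: quotientE)
  then have "v \<in> C \<Longrightarrow> v \<in> K \<longleftrightarrow> u \<in> K" for v using closed_under_conn[OF assms(2)] by blast
  then show ?thesis by blast
qed

lemma circles_disjoint: "C \<in> circles D I \<Longrightarrow> C' \<in> circles D I \<Longrightarrow> C \<noteq> C' \<Longrightarrow> C \<inter> C' = {}"
  using circle_subset_or_disjoint[of C I C'] circle_subset_or_disjoint[of C' I C] circle_closed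
  by blast

lemma circles_cover: "v \<in> V \<Longrightarrow> \<exists>C\<in>circles D I. v \<in> C"
  unfolding circles_eq by (blast intro: quotientI)

text \<open>A generator at \<open>I\<close> is determined by the closed set of the vertices on its circles labelled
  \<open>v_minus\<close>. All computations below take place in this encoding.\<close>

definition minus_set :: "nat set \<Rightarrow> ('v set \<Rightarrow> label) \<Rightarrow> 'v set" where
  "minus_set I l = \<Union>{C \<in> circles D I. l C = v_minus}"

lemma minus_set_minus: "C \<in> circles D I \<Longrightarrow> l C = v_minus \<Longrightarrow> C \<subseteq> minus_set I l"
  unfolding minus_set_def by blast

lemma minus_set_plus: "C \<in> circles D I \<Longrightarrow> l C = v_plus \<Longrightarrow> C \<inter> minus_set I l = {}"
proof -
  assume C: "C \<in> circles D I" "l C = v_plus"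
  have "C \<inter> C' = {}" if "C' \<in> circles D I" "l C' = v_minus" for C'
    using circles_disjoint[OF C(1) that(1)] C(2) that(2) by force
  then show ?thesis unfolding minus_set_def by blast
qed

lemma closed_under_minus_set: "closed_under (ra I) (minus_set I l)"
  using circle_closed[of _ I] unfolding minus_set_def closed_under_def by blast

lemma minus_set_subset: "minus_set I l \<subseteq> V"
  using circle_subset unfolding minus_set_def by blast

lemma bij_betw_minus_set:
  "bij_betw (minus_set I) (circles D I \<rightarrow>\<^sub>E UNIV) {K. K \<subseteq> V \<and> closed_under (ra I) K}"
proof (rule bij_betwI)
  let ?f = "\<lambda>K. restrict (\<lambda>C. if C \<subseteq> K then v_minus else v_plus) (circles D I)"
  show "minus_set I \<in> (circles D I \<rightarrow>\<^sub>E UNIV) \<rightarrow> {K. K \<subseteq> V \<and> closed_under (ra I) K}"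
    using minus_set_subset closed_under_minus_set by blast
  show "?f \<in> {K. K \<subseteq> V \<and> closed_under (ra I) K} \<rightarrow> (circles D I \<rightarrow>\<^sub>E UNIV)" by auto
  show "?f (minus_set I l) = l" if l: "l \<in> circles D I \<rightarrow>\<^sub>E UNIV" for l
  proof
    fix C show "?f (minus_set I l) C = l C"
    proof (cases "C \<in> circles D I")
      case True
      then show ?thesis
        using minus_set_minus[OF True, of l] minus_set_plus[OF True, of l] circle_nonempty[OF True]
        by (cases "l C") auto
    next
      case False
      then show ?thesis using l by (simp add: PiE_def extensional_def)
    qed
  qed
  show "minus_set I (?f K) = K" if "K \<in> {K. K \<subseteq> V \<and> closed_under (ra I) K}" for K
  proof -
    from that have K: "K \<subseteq> V" "closed_under (ra I) K" by simp_all
    have "minus_set I (?f K) = \<Union>{C \<in> circles D I. C \<subseteq> K}"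
      unfolding minus_set_def by (intro arg_cong[where f = Union] Collect_cong) auto
    also have "\<dots> = K"
    proof
      show "K \<subseteq> \<Union>{C \<in> circles D I. C \<subseteq> K}"
      proof
        fix v assume "v \<in> K"
        then obtain C where "C \<in> circles D I" "v \<in> C" using circles_cover K(1) by blast
        with circle_subset_or_disjoint[OF this(1) K(2)] \<open>v \<in> K\<close>
        show "v \<in> \<Union>{C \<in> circles D I. C \<subseteq> K}" by blast
      qed
    qed blast
    finally show ?thesis .
  qed
qed

text \<open>In the Frobenius algebra \<open>\<F>\<^sub>2[x]/(x\<^sup>2 + x)\<close> with \<open>v_plus = 1\<close> and \<open>v_minus = x\<close>, a generator at \<open>I\<close>
  is the indicator function of the colourings \<open>X\<close> (closed sets of vertices) that contain its minus set.
  An edge map restricts a function to the colourings that are closed at both ends of the edge and extends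
  it by zero. By Moebius inversion, the coefficient of a generator in the result is the number modulo 2
  of the following sets; it is odd if and only if there is just one of them.\<close>

definition closed_between :: "nat set \<Rightarrow> ('v set \<Rightarrow> label) \<Rightarrow> nat set \<Rightarrow> ('v set \<Rightarrow> label) \<Rightarrow> 'v set set"
  where "closed_between I l I' l' =
    {X. X \<subseteq> V \<and> closed_under (ra I \<union> ra I') X \<and> minus_set I l \<subseteq> X \<and> X \<subseteq> minus_set I' l'}"

definition deformed_term :: "nat set \<Rightarrow> ('v set \<Rightarrow> label) \<Rightarrow> nat set \<Rightarrow> ('v set \<Rightarrow> label) \<Rightarrow> bool"
  where "deformed_term I l I' l' \<longleftrightarrow> (\<exists>!X. X \<in> closed_between I l I' l')"

lemma odd_card_closed_between: "odd (card (closed_between I l I' l')) \<longleftrightarrow> deformed_term I l I' l'"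
  unfolding deformed_term_def closed_between_def
  by (rule odd_card_closed_sets_between[OF finite_vertices])

text \<open>A path through \<open>I\<close>, \<open>I'\<close>, \<open>I''\<close> together with the sets counted by its two coefficients is a triple
  \<open>X \<subseteq> K \<subseteq> Y\<close>, where \<open>K\<close> is the minus set of the middle generator. For given \<open>X\<close> and \<open>Y\<close> the number of
  choices of \<open>K\<close> is odd only if \<open>X = Y\<close>. The result does not mention \<open>I'\<close>, so the two ways around a face
  of the cube cancel modulo 2.\<close>

lemma odd_card_deformed_paths:
  assumes mid: "\<And>X. closed_under (ra I \<union> ra I'') X \<Longrightarrow> closed_under (ra I') X"
  shows "odd (card {l' \<in> circles D I' \<rightarrow>\<^sub>E UNIV. deformed_term I l I' l' \<and> deformed_term I' l' I'' l''})
    \<longleftrightarrow> odd (card (closed_between I l I'' l''))"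
proof -
  define M where "M = {K. K \<subseteq> V \<and> closed_under (ra I') K}"
  define X1 where "X1 = {X \<in> M. closed_under (ra I) X \<and> minus_set I l \<subseteq> X}"
  define X2 where "X2 = {X \<in> M. closed_under (ra I'') X \<and> X \<subseteq> minus_set I'' l''}"
  have fin: "finite M" unfolding M_def using finite_vertices by simp
  then have fin12: "finite X1" "finite X2" unfolding X1_def X2_def by simp_all
  let ?a = "\<lambda>K. card {X \<in> X1. X \<subseteq> K}" and ?b = "\<lambda>K. card {X \<in> X2. K \<subseteq> X}"
  have "closed_between I l I' l' = {X \<in> X1. X \<subseteq> minus_set I' l'}" for l'
    unfolding closed_between_def X1_def M_def by auto
  then have a: "deformed_term I l I' l' \<longleftrightarrow> odd (?a (minus_set I' l'))" for l'
    using odd_card_closed_between[of I l I' l'] by simp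
  have "closed_between I' l' I'' l'' = {X \<in> X2. minus_set I' l' \<subseteq> X}" for l'
    unfolding closed_between_def X2_def M_def by auto
  then have b: "deformed_term I' l' I'' l'' \<longleftrightarrow> odd (?b (minus_set I' l'))" for l'
    using odd_card_closed_between[of I' l' I'' l''] by simp
  have "bij_betw (minus_set I') {l' \<in> circles D I' \<rightarrow>\<^sub>E UNIV.
      odd (?a (minus_set I' l')) \<and> odd (?b (minus_set I' l'))} {K \<in> M. odd (?a K) \<and> odd (?b K)}"
    using bij_betw_Collect_image[OF bij_betw_minus_set[of I'], of "\<lambda>K. odd (?a K) \<and> odd (?b K)"]
    unfolding M_def .
  then have "card {l' \<in> circles D I' \<rightarrow>\<^sub>E UNIV. deformed_term I l I' l' \<and> deformed_term I' l' I'' l''}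
      = card {K \<in> M. odd (?a K * ?b K)}"
    unfolding a b even_mult_iff de_Morgan_disj by (rule bij_betw_same_card)
  then have "odd (card {l' \<in> circles D I' \<rightarrow>\<^sub>E UNIV.
      deformed_term I l I' l' \<and> deformed_term I' l' I'' l''}) \<longleftrightarrow> odd (\<Sum>K\<in>M. ?a K * ?b K)"
    using even_sum_iff[OF fin, of "\<lambda>K. ?a K * ?b K"] by simp
  also have "(\<Sum>K\<in>M. ?a K * ?b K) =
      (\<Sum>K\<in>M. \<Sum>X\<in>X1. \<Sum>Y\<in>X2. of_bool (X \<subseteq> K \<and> K \<subseteq> Y))"
  proof (rule sum.cong[OF HOL.refl])
    fix K
    have "?a K = (\<Sum>X\<in>X1. of_bool (X \<subseteq> K))" "?b K = (\<Sum>Y\<in>X2. of_bool (K \<subseteq> Y))"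
      using fin12 by (simp_all add: Int_def)
    then show "?a K * ?b K = (\<Sum>X\<in>X1. \<Sum>Y\<in>X2. of_bool (X \<subseteq> K \<and> K \<subseteq> Y))"
      by (simp add: sum_product of_bool_conj)
  qed
  also have "\<dots> = (\<Sum>X\<in>X1. \<Sum>K\<in>M. \<Sum>Y\<in>X2. of_bool (X \<subseteq> K \<and> K \<subseteq> Y))"
    by (rule sum.swap)
  also have "\<dots> = (\<Sum>X\<in>X1. \<Sum>Y\<in>X2. \<Sum>K\<in>M. of_bool (X \<subseteq> K \<and> K \<subseteq> Y))"
    by (intro sum.cong HOL.refl sum.swap)
  also have "\<dots> = (\<Sum>(X, Y)\<in>X1 \<times> X2. card {K \<in> M. X \<subseteq> K \<and> K \<subseteq> Y})"
    using fin by (simp add: sum.cartesian_product Int_def)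
  also have "odd \<dots> \<longleftrightarrow> odd (card {p \<in> X1 \<times> X2. odd (card {K \<in> M. fst p \<subseteq> K \<and> K \<subseteq> snd p})})"
    using even_sum_iff[of "X1 \<times> X2" "\<lambda>p. card {K \<in> M. fst p \<subseteq> K \<and> K \<subseteq> snd p}"] fin12
    by (simp add: case_prod_beta)
  also have "{p \<in> X1 \<times> X2. odd (card {K \<in> M. fst p \<subseteq> K \<and> K \<subseteq> snd p})} =
      (\<lambda>X. (X, X)) ` (X1 \<inter> X2)"
  proof -
    have eq: "odd (card {K \<in> M. X \<subseteq> K \<and> K \<subseteq> Y}) \<longleftrightarrow> X = Y" if "X \<in> M" "Y \<in> M" for X Y
    proof -
      have "odd (card {K \<in> M. X \<subseteq> K \<and> K \<subseteq> Y}) \<longleftrightarrow> (\<exists>!K. K \<in> {K \<in> M. X \<subseteq> K \<and> K \<subseteq> Y})"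
        using odd_card_closed_sets_between[OF finite_vertices, of "ra I'" X Y]
        unfolding M_def by (simp add: conj_assoc)
      also have "\<dots> \<longleftrightarrow> X = Y"
      proof
        assume "\<exists>!K. K \<in> {K \<in> M. X \<subseteq> K \<and> K \<subseteq> Y}"
        moreover from this have "X \<subseteq> Y" by blast
        ultimately show "X = Y" using that by blast
      qed (use that in blast)
      finally show ?thesis .
    qed
    have sub: "X1 \<subseteq> M" "X2 \<subseteq> M" unfolding X1_def X2_def by simp_all
    have diag: "odd (card {K \<in> M. fst p \<subseteq> K \<and> K \<subseteq> snd p}) \<longleftrightarrow> fst p = snd p" if "p \<in> X1 \<times> X2" for p
    proof (rule eq)
      show "fst p \<in> M" "snd p \<in> M" using that sub by (auto simp: mem_Times_iff)
    qed
    have "{p \<in> X1 \<times> X2. odd (card {K \<in> M. fst p \<subseteq> K \<and> K \<subseteq> snd p})} =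
        {p \<in> X1 \<times> X2. fst p = snd p}" by (intro Collect_cong conj_cong HOL.refl diag)
    also have "\<dots> = (\<lambda>X. (X, X)) ` (X1 \<inter> X2)" by auto
    finally show ?thesis .
  qed
  also have "card ((\<lambda>X. (X, X)) ` (X1 \<inter> X2)) = card (X1 \<inter> X2)"
    by (rule card_image) (simp add: inj_on_def)
  also have "X1 \<inter> X2 = closed_between I l I'' l''"
    using mid unfolding X1_def X2_def M_def closed_between_def closed_under_Un by blast
  finally show ?thesis .
qed

lemma deformed_term_subset:
  "deformed_term I l I' l' \<Longrightarrow> \<exists>X. closed_under (ra I) X \<and> closed_under (ra I') X \<and>
     minus_set I l \<subseteq> X \<and> X \<subseteq> minus_set I' l'"
  unfolding deformed_term_def closed_between_def closed_under_Un by blast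

text \<open>Otherwise toggling \<open>K\<close> would yield a second set between the two minus sets.\<close>

lemma deformed_term_rigid:
  assumes "deformed_term I l I' l'" and "K \<subseteq> V" "closed_under (ra I) K" "closed_under (ra I') K"
    and "K \<inter> minus_set I l = {}" "K \<subseteq> minus_set I' l'"
  shows "K = {}"
proof -
  obtain X where X: "X \<in> closed_between I l I' l'"
    and uniq: "\<And>Y. Y \<in> closed_between I l I' l' \<Longrightarrow> Y = X"
    using assms(1) unfolding deformed_term_def by blast
  have "closed_under (ra I \<union> ra I') ((X - K) \<union> (K - X))"
    using X assms(3,4) unfolding closed_between_def by (intro closed_under_toggle) simp_all
  then have "(X - K) \<union> (K - X) \<in> closed_between I l I' l'"
    using X assms(2,5,6) unfolding closed_between_def by blast
  from uniq[OF this] show ?thesis by blast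
qed

lemma deformed_termI:
  assumes "Z \<in> closed_between I l I' l'" and "\<And>X. X \<in> closed_between I l I' l' \<Longrightarrow> X = Z"
  shows "deformed_term I l I' l'"
  using assms unfolding deformed_term_def by blast

lemma deformed_term_agree:
  assumes def: "deformed_term I l I' l'" and C: "C \<in> circles D I" "C \<in> circles D I'"
  shows "l' C = l C"
proof -
  have "C \<subseteq> V" "C \<noteq> {}" "closed_under (ra I) C" "closed_under (ra I') C"
    using C circle_subset circle_nonempty circle_closed by blast+
  note rigid = deformed_term_rigid[OF def this(1,3,4)] and ne = this(2)
  have sub: "minus_set I l \<subseteq> minus_set I' l'" using deformed_term_subset[OF def] by blast
  show ?thesis
  proof (cases "l C")
    case v_plus
    then have "C \<inter> minus_set I l = {}" by (rule minus_set_plus[OF C(1)])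
    with rigid ne have "l' C \<noteq> v_minus" using minus_set_minus[OF C(2)] by blast
    then show ?thesis using v_plus by (cases "l' C") simp_all
  next
    case v_minus
    then have "C \<subseteq> minus_set I' l'" using minus_set_minus[OF C(1)] sub by blast
    then have "l' C \<noteq> v_plus" using minus_set_plus[OF C(2)] ne by blast
    then show ?thesis using v_minus by (cases "l' C") simp_all
  qed
qed

lemma minus_set_cases:
  "v \<in> minus_set I l \<longleftrightarrow> (\<exists>C\<in>circles D I. v \<in> C \<and> l C = v_minus)"
  unfolding minus_set_def by blast

lemma mergesE:
  assumes "merges (circles D I) (circles D I')"
  obtains A B R where "circles D I = insert A (insert B R)" "circles D I' = insert (A \<union> B) R"
    "A \<noteq> B" "A \<inter> B = {}" "A \<notin> R" "B \<notin> R" "A \<union> B \<notin> R" "finite R"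
    "circles D I - circles D I' = {A, B}" "circles D I' - circles D I = {A \<union> B}"
    "circles D I \<inter> circles D I' = R" "A \<noteq> {}" "B \<noteq> {}"
proof -
  obtain A B R where R: "circles D I = insert A (insert B R)" "circles D I' = insert (A \<union> B) R"
    "A \<noteq> B" "A \<inter> B = {}" "A \<notin> R" "B \<notin> R" "A \<union> B \<notin> R"
    using assms unfolding merges_def by (elim exE conjE) (rule that)
  have ne: "A \<noteq> {}" "B \<noteq> {}" using circle_nonempty[of _ I] R(1) by auto
  then have "A \<noteq> A \<union> B" "B \<noteq> A \<union> B" using R(4) by blast+
  then have "circles D I - circles D I' = {A, B}" "circles D I' - circles D I = {A \<union> B}"
    "circles D I \<inter> circles D I' = R"
    unfolding R(1,2) using R(5-7) by auto
  moreover have "finite R" using finite_circles[OF finite_vertices, of I] R(1) by simp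
  ultimately show thesis by (intro that[OF R] ne)
qed

lemma khovanov_term_merge_iff:
  assumes c: "c < n_crossings D" "c \<notin> I" and "A \<noteq> B"
    and "circles D I - circles D (insert c I) = {A, B}"
    "circles D (insert c I) - circles D I = {C}"
  shows "khovanov_term D (I, l) (insert c I, l') \<longleftrightarrow>
    (\<forall>C\<in>circles D I \<inter> circles D (insert c I). l' C = l C) \<and> merge_term (l A) (l B) (l' C)"
proof -
  have sym: "merge_term a b c \<Longrightarrow> merge_term b a c" for a b c
    by (auto elim!: merge_term.cases intro: merge_term.intros)
  have "(\<exists>X Y Z. X \<noteq> Y \<and> {A, B} = {X, Y} \<and> {C} = {Z} \<and> merge_term (l X) (l Y) (l' Z)) \<longleftrightarrow>
      merge_term (l A) (l B) (l' C)"
    using assms(3) sym by (auto simp: doubleton_eq_iff)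
  moreover have "\<not> (\<exists>X Y Z. Y \<noteq> Z \<and> {A, B} = {X} \<and> {C} = {Y, Z} \<and> split_term (l X) (l' Y) (l' Z))"
    using assms(3) by (auto simp: doubleton_eq_iff)
  moreover have "\<exists>a<n_crossings D. a \<notin> I \<and> insert c I = insert a I" using c by blast
  ultimately show ?thesis unfolding khovanov_term_def assms(4,5) case_prod_conv by simp
qed

lemma khovanov_term_split_iff:
  assumes c: "c < n_crossings D" "c \<notin> I" and "A \<noteq> B"
    and "circles D I - circles D (insert c I) = {C}"
    "circles D (insert c I) - circles D I = {A, B}"
  shows "khovanov_term D (I, l) (insert c I, l') \<longleftrightarrow>
    (\<forall>C\<in>circles D I \<inter> circles D (insert c I). l' C = l C) \<and> split_term (l C) (l' A) (l' B)"
proof -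
  have sym: "split_term a b c \<Longrightarrow> split_term a c b" for a b c
    by (auto elim!: split_term.cases intro: split_term.intros)
  have "(\<exists>X Y Z. Y \<noteq> Z \<and> {C} = {X} \<and> {A, B} = {Y, Z} \<and> split_term (l X) (l' Y) (l' Z)) \<longleftrightarrow>
      split_term (l C) (l' A) (l' B)"
    using assms(3) sym by (auto simp: doubleton_eq_iff)
  moreover have "\<not> (\<exists>X Y Z. X \<noteq> Y \<and> {C} = {X, Y} \<and> {A, B} = {Z} \<and> merge_term (l X) (l Y) (l' Z))"
    using assms(3) by (auto simp: doubleton_eq_iff)
  moreover have "\<exists>a<n_crossings D. a \<notin> I \<and> insert c I = insert a I" using c by blast
  ultimately show ?thesis unfolding khovanov_term_def assms(4,5) case_prod_conv by simp
qed

lemma khovanov_term_edge: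
  "khovanov_term D (I, l) (I', l') \<Longrightarrow> \<exists>c<n_crossings D. c \<notin> I \<and> I' = insert c I"
  unfolding khovanov_term_def case_prod_conv by blast

lemma not_khovanov_term_same: "circles D I = circles D I' \<Longrightarrow> \<not> khovanov_term D (I, l) (I', l')"
  unfolding khovanov_term_def case_prod_conv by simp

text \<open>This is the multiplication table of the deformed algebra; compared with the Khovanov product, it has the
  additional term \<open>v_minus \<otimes> v_minus \<mapsto> v_minus\<close>.\<close>

lemma deformed_term_merge:
  assumes circ: "circles D I = insert A (insert B R)" "circles D I' = insert (A \<union> B) R"
    and def: "deformed_term I l I' l'"
  shows "l A = v_plus \<and> l B = v_plus \<and> l' (A \<union> B) = v_plus \<or>
    (l A = v_minus \<or> l B = v_minus) \<and> l' (A \<union> B) = v_minus"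
proof -
  have mem: "A \<in> circles D I" "B \<in> circles D I" "A \<union> B \<in> circles D I'" using circ by simp_all
  have closed: "closed_under (ra I) (A \<union> B)"
    using circle_closed[OF mem(1)] circle_closed[OF mem(2)] unfolding closed_under_def by blast
  have ne: "A \<noteq> {}" "B \<noteq> {}" using circle_nonempty[OF mem(1)] circle_nonempty[OF mem(2)] .
  have sub: "minus_set I l \<subseteq> minus_set I' l'" using deformed_term_subset[OF def] by blast
  note rigid = deformed_term_rigid[OF def circle_subset[OF mem(3)] closed circle_closed[OF mem(3)]]
  show ?thesis
  proof (cases "l A = v_plus \<and> l B = v_plus")
    case True
    then have "(A \<union> B) \<inter> minus_set I l = {}"
      using minus_set_plus[OF mem(1)] minus_set_plus[OF mem(2)] by blast
    with rigid ne have "\<not> A \<union> B \<subseteq> minus_set I' l'" by blast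
    with minus_set_minus[OF mem(3)] True show ?thesis by (cases "l' (A \<union> B)") auto
  next
    case False
    then have min: "l A = v_minus \<or> l B = v_minus" by (cases "l A"; cases "l B") auto
    then have "(A \<union> B) \<inter> minus_set I l \<noteq> {}"
      using minus_set_minus[OF mem(1)] minus_set_minus[OF mem(2)] ne by blast
    with sub have "(A \<union> B) \<inter> minus_set I' l' \<noteq> {}" by blast
    with minus_set_plus[OF mem(3)] min show ?thesis by (cases "l' (A \<union> B)") auto
  qed
qed

text \<open>The deformed coproduct has the additional term \<open>v_plus \<mapsto> v_plus \<otimes> v_plus\<close>.\<close>

lemma deformed_term_split:
  assumes circ: "circles D I = insert (A \<union> B) R" "circles D I' = insert A (insert B R)"
    and def: "deformed_term I l I' l'"
  shows "l (A \<union> B) = v_plus \<and> (l' A = v_plus \<or> l' B = v_plus) \<or>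
    l (A \<union> B) = v_minus \<and> l' A = v_minus \<and> l' B = v_minus"
proof -
  have mem: "A \<in> circles D I'" "B \<in> circles D I'" "A \<union> B \<in> circles D I" using circ by simp_all
  have closed: "closed_under (ra I') (A \<union> B)"
    using circle_closed[OF mem(1)] circle_closed[OF mem(2)] unfolding closed_under_def by blast
  have ne: "A \<noteq> {}" "B \<noteq> {}" using circle_nonempty[OF mem(1)] circle_nonempty[OF mem(2)] .
  have sub: "minus_set I l \<subseteq> minus_set I' l'" using deformed_term_subset[OF def] by blast
  note rigid = deformed_term_rigid[OF def circle_subset[OF mem(3)] circle_closed[OF mem(3)] closed]
  show ?thesis
  proof (cases "l (A \<union> B)")
    case v_plus
    have "\<not> A \<union> B \<subseteq> minus_set I' l'" using rigid[OF minus_set_plus[of "A \<union> B" I l, OF mem(3) v_plus]] ne by blast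
    with minus_set_minus[OF mem(1)] minus_set_minus[OF mem(2)] v_plus show ?thesis
      by (cases "l' A"; cases "l' B") auto
  next
    case v_minus
    have "A \<subseteq> minus_set I' l'" "B \<subseteq> minus_set I' l'"
      using minus_set_minus[of "A \<union> B" I l, OF mem(3) v_minus] sub by blast+
    then have "l' A \<noteq> v_plus" "l' B \<noteq> v_plus"
      using minus_set_plus[of A I' l', OF mem(1)] minus_set_plus[of B I' l', OF mem(2)] ne by blast+
    with v_minus show ?thesis by (cases "l' A"; cases "l' B") auto
  qed
qed

lemma q_degree_insert:
  assumes "finite I" "c \<notin> I"
  shows "q_degree D (insert c I, l') - q_degree D (I, l) =
    (\<Sum>C\<in>circles D (insert c I). label_sign (l' C)) - (\<Sum>C\<in>circles D I. label_sign (l C)) + 1"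
  using assms by (simp add: q_degree_def)

text \<open>The two additional terms of the deformed product and coproduct raise the \<open>q\<close>-degree by 2, and an edge along
  which the circles do not change raises it by 1. All other terms are Khovanov terms.\<close>

lemma deformed_term_q_degree:
  assumes c: "c < n_crossings D" "c \<notin> I" and "finite I"
    and def: "deformed_term I l (insert c I) l'"
  shows "q_degree D (I, l) \<le> q_degree D (insert c I, l') \<and>
    (q_degree D (I, l) = q_degree D (insert c I, l') \<longrightarrow> khovanov_term D (I, l) (insert c I, l'))"
proof -
  let ?I = "insert c I"
  let ?s = "\<lambda>C. label_sign (l C)" and ?s' = "\<lambda>C. label_sign (l' C)"
  note q = q_degree_insert[OF assms(3) c(2), of l' l]
  have agree: "l' C = l C" if "C \<in> circles D I \<inter> circles D ?I" for C
    using deformed_term_agree[OF def] that by blast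
  consider "circles D I = circles D ?I" | "merges (circles D I) (circles D ?I)"
    | "merges (circles D ?I) (circles D I)" using circles_change[OF c] by blast
  then show ?thesis
  proof cases
    case 1
    have "sum ?s' (circles D ?I) = sum ?s (circles D I)"
      by (rule sum.cong) (use 1 agree in auto)
    with q show ?thesis by simp
  next
    case 2
    then obtain A B R where R: "circles D I = insert A (insert B R)"
      "circles D ?I = insert (A \<union> B) R" "A \<noteq> B" "A \<inter> B = {}" "A \<notin> R" "B \<notin> R" "A \<union> B \<notin> R" "finite R"
      "circles D I - circles D ?I = {A, B}" "circles D ?I - circles D I = {A \<union> B}"
      "circles D I \<inter> circles D ?I = R" by (rule mergesE)
    have "sum ?s' R = sum ?s R" using agree R(11) by (intro sum.cong) auto
    then have q': "q_degree D (?I, l') - q_degree D (I, l) = ?s' (A \<union> B) - ?s A - ?s B + 1"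
      using q R(3,5-8) unfolding R(1,2) by simp
    note kh = khovanov_term_merge_iff[OF c R(3,9,10), of l l']
    from deformed_term_merge[OF R(1,2) def] show ?thesis
      using q' kh agree by (cases "l A"; cases "l B") (auto simp: merge_term.simps)
  next
    case 3
    then obtain A B R where R: "circles D ?I = insert A (insert B R)"
      "circles D I = insert (A \<union> B) R" "A \<noteq> B" "A \<inter> B = {}" "A \<notin> R" "B \<notin> R" "A \<union> B \<notin> R" "finite R"
      "circles D ?I - circles D I = {A, B}" "circles D I - circles D ?I = {A \<union> B}"
      "circles D ?I \<inter> circles D I = R" by (rule mergesE)
    have "sum ?s' R = sum ?s R" using agree R(11) by (intro sum.cong) auto
    then have q': "q_degree D (?I, l') - q_degree D (I, l) = ?s' A + ?s' B - ?s (A \<union> B) + 1"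
      using q R(3,5-8) unfolding R(1,2) by simp
    note kh = khovanov_term_split_iff[OF c R(3,10,9), of l l']
    from deformed_term_split[OF R(2,1) def] show ?thesis
      using q' kh agree by (cases "l' A"; cases "l' B") (auto simp: split_term.simps)
  qed
qed

text \<open>For a merge the only set between the two minus sets is the second minus set, for a split it is the
  first.\<close>

lemma khovanov_term_imp_deformed_term:
  assumes kh: "khovanov_term D (I, l) (I', l')"
  shows "deformed_term I l I' l'"
proof -
  obtain c where c: "c < n_crossings D" "c \<notin> I" and I': "I' = insert c I"
    using khovanov_term_edge[OF kh] by blast
  have "circles D I \<noteq> circles D I'" using kh not_khovanov_term_same by blast
  then consider "merges (circles D I) (circles D I')" | "merges (circles D I') (circles D I)"
    using circles_change[OF c] I' by blast
  then show ?thesis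
  proof cases
    case 1
    then obtain A B R where R: "circles D I = insert A (insert B R)"
      "circles D I' = insert (A \<union> B) R" "A \<noteq> B" "A \<inter> B = {}" "A \<notin> R" "B \<notin> R" "A \<union> B \<notin> R" "finite R"
      "circles D I - circles D I' = {A, B}" "circles D I' - circles D I = {A \<union> B}"
      "circles D I \<inter> circles D I' = R" "A \<noteq> {}" "B \<noteq> {}" by (rule mergesE)
    from kh have agree: "\<And>C. C \<in> R \<Longrightarrow> l' C = l C" and coeff: "merge_term (l A) (l B) (l' (A \<union> B))"
      using khovanov_term_merge_iff[OF c R(3), of "A \<union> B" l l'] R(9-11) unfolding I' by blast+
    have mem: "A \<in> circles D I" "B \<in> circles D I" "A \<union> B \<in> circles D I'"
      "\<And>C. C \<in> R \<Longrightarrow> C \<in> circles D I" "\<And>C. C \<in> R \<Longrightarrow> C \<in> circles D I'" using R(1,2) by simp_all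
    show ?thesis
    proof (rule deformed_termI)
      have "closed_under (ra I) C" if "C \<in> circles D I'" for C
      proof (cases "C = A \<union> B")
        case True
        show ?thesis using circle_closed[OF mem(1)] circle_closed[OF mem(2)]
          unfolding True closed_under_def by blast
      next
        case False
        then show ?thesis using that R(2) circle_closed[OF mem(4)] by blast
      qed
      then have "closed_under (ra I) (minus_set I' l')"
        unfolding minus_set_def closed_under_def by blast
      moreover have "minus_set I l \<subseteq> minus_set I' l'"
      proof
        fix v assume "v \<in> minus_set I l"
        then obtain C where C: "C \<in> circles D I" "v \<in> C" "l C = v_minus"
          unfolding minus_set_cases by blast
        show "v \<in> minus_set I' l'"
        proof (cases "C \<in> R")
          case True
          with C agree[OF True] mem(5)[OF True] show ?thesis unfolding minus_set_cases by metis
        next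
          case False
          then have "C = A \<or> C = B" using C(1) R(1) by blast
          then have "l' (A \<union> B) = v_minus" "v \<in> A \<union> B"
            using C(2,3) coeff by (auto elim: merge_term.cases)
          with mem(3) show ?thesis unfolding minus_set_cases by blast
        qed
      qed
      ultimately show "minus_set I' l' \<in> closed_between I l I' l'"
        unfolding closed_between_def using closed_under_minus_set minus_set_subset by simp
    next
      fix X assume "X \<in> closed_between I l I' l'"
      then have X: "closed_under (ra I') X" "minus_set I l \<subseteq> X" "X \<subseteq> minus_set I' l'"
        unfolding closed_between_def by simp_all
      have "v \<in> X" if v: "v \<in> minus_set I' l'" for v
      proof -
        obtain C where C: "C \<in> circles D I'" "v \<in> C" "l' C = v_minus"
          using v unfolding minus_set_cases by blast
        show ?thesis
        proof (cases "C \<in> R")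
          case True
          with C agree[OF True] mem(4)[OF True] X(2) show ?thesis
            using minus_set_minus[of C I l] by auto
        next
          case False
          then have CAB: "C = A \<union> B" using C(1) R(2) by blast
          then have "l A = v_minus \<or> l B = v_minus" using C(3) coeff by (auto elim: merge_term.cases)
          then have "C \<inter> X \<noteq> {}"
            using minus_set_minus[OF mem(1)] minus_set_minus[OF mem(2)] X(2) R(12,13) CAB by blast
          with circle_subset_or_disjoint[OF C(1) X(1)] C(2) show ?thesis by blast
        qed
      qed
      with X(3) show "X = minus_set I' l'" by blast
    qed
  next
    case 2
    then obtain A B R where R: "circles D I' = insert A (insert B R)"
      "circles D I = insert (A \<union> B) R" "A \<noteq> B" "A \<inter> B = {}" "A \<notin> R" "B \<notin> R" "A \<union> B \<notin> R" "finite R"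
      "circles D I' - circles D I = {A, B}" "circles D I - circles D I' = {A \<union> B}"
      "circles D I' \<inter> circles D I = R" "A \<noteq> {}" "B \<noteq> {}" by (rule mergesE)
    from kh have agree: "\<And>C. C \<in> R \<Longrightarrow> l' C = l C" and coeff: "split_term (l (A \<union> B)) (l' A) (l' B)"
      using khovanov_term_split_iff[OF c R(3), of "A \<union> B" l l'] R(9-11) unfolding I' by blast+
    have mem: "A \<in> circles D I'" "B \<in> circles D I'" "A \<union> B \<in> circles D I"
      "\<And>C. C \<in> R \<Longrightarrow> C \<in> circles D I" "\<And>C. C \<in> R \<Longrightarrow> C \<in> circles D I'" using R(1,2) by simp_all
    show ?thesis
    proof (rule deformed_termI)
      have "closed_under (ra I') C" if "C \<in> circles D I" for C
      proof (cases "C = A \<union> B")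
        case True
        show ?thesis using circle_closed[OF mem(1)] circle_closed[OF mem(2)]
          unfolding True closed_under_def by blast
      next
        case False
        then show ?thesis using that R(2) circle_closed[OF mem(5)] by blast
      qed
      then have "closed_under (ra I') (minus_set I l)"
        unfolding minus_set_def closed_under_def by blast
      moreover have "minus_set I l \<subseteq> minus_set I' l'"
      proof
        fix v assume "v \<in> minus_set I l"
        then obtain C where C: "C \<in> circles D I" "v \<in> C" "l C = v_minus"
          unfolding minus_set_cases by blast
        show "v \<in> minus_set I' l'"
        proof (cases "C \<in> R")
          case True
          with C agree[OF True] mem(5)[OF True] show ?thesis unfolding minus_set_cases by metis
        next
          case False
          then have "C = A \<union> B" using C(1) R(2) by blast
          then have "l' A = v_minus" "l' B = v_minus" "v \<in> A \<union> B"
            using C(2,3) coeff by (auto elim: split_term.cases)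
          with mem(1,2) show ?thesis unfolding minus_set_cases by blast
        qed
      qed
      ultimately show "minus_set I l \<in> closed_between I l I' l'"
        unfolding closed_between_def using closed_under_minus_set minus_set_subset by simp
    next
      fix X assume "X \<in> closed_between I l I' l'"
      then have X: "X \<subseteq> V" "closed_under (ra I) X" "minus_set I l \<subseteq> X" "X \<subseteq> minus_set I' l'"
        unfolding closed_between_def by simp_all
      have "v \<in> minus_set I l" if v: "v \<in> X" for v
      proof (rule ccontr)
        assume nv: "v \<notin> minus_set I l"
        obtain C where C: "C \<in> circles D I" "v \<in> C" using circles_cover X(1) v by blast
        then have plus: "l C = v_plus" using nv minus_set_minus[OF C(1)] by (cases "l C") auto
        have CX: "C \<subseteq> X" using circle_subset_or_disjoint[OF C(1) X(2)] v C(2) by blast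
        show False
        proof (cases "C \<in> R")
          case True
          with agree plus have "l' C = v_plus" by simp
          from minus_set_plus[of C I' l', OF mem(5)[OF True] this] C(2) CX X(4) show False by blast
        next
          case False
          then have CAB: "C = A \<union> B" using C(1) R(2) by blast
          then have "l' A = v_plus \<or> l' B = v_plus" using plus coeff by (auto elim: split_term.cases)
          then show False
            using minus_set_plus[OF mem(1)] minus_set_plus[OF mem(2)] CX X(4) R(12,13) CAB by blast
        qed
      qed
      with X(3) show "X = minus_set I l" by blast
    qed
  qed
qed

lemma nontrivial_circle_Un:
  assumes "A \<inter> B = {}"
  shows "nontrivial_circle D (A \<union> B) \<longleftrightarrow> nontrivial_circle D A \<noteq> nontrivial_circle D B"
proof -
  have "finite (cut_arcs D)"
    using arc_vertices finite_vertices by (meson finite_SigmaI finite_subset le_sup_iff)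
  moreover have "{e \<in> cut_arcs D. fst e \<in> A \<union> B} =
      {e \<in> cut_arcs D. fst e \<in> A} \<union> {e \<in> cut_arcs D. fst e \<in> B}" by blast
  moreover have "{e \<in> cut_arcs D. fst e \<in> A} \<inter> {e \<in> cut_arcs D. fst e \<in> B} = {}" using assms by blast
  ultimately have "card {e \<in> cut_arcs D. fst e \<in> A \<union> B} =
      card {e \<in> cut_arcs D. fst e \<in> A} + card {e \<in> cut_arcs D. fst e \<in> B}"
    by (simp add: card_Un_disjoint)
  then show ?thesis unfolding nontrivial_circle_def by simp
qed

text \<open>Nontriviality is additive modulo 2. So if two circles merge or one splits, either all three circles are
  trivial or exactly two of them are nontrivial, and the claim can be read off from the tables of the product
  and the coproduct.\<close>

lemma khovanov_term_k_degree:
  assumes kh: "khovanov_term D (I, l) (I', l')"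
  shows "k_degree D (I', l') \<le> k_degree D (I, l)"
proof -
  obtain c where c: "c < n_crossings D" "c \<notin> I" and I': "I' = insert c I"
    using khovanov_term_edge[OF kh] by blast
  let ?w = "\<lambda>C. if nontrivial_circle D C then label_sign (l C) else 0"
    and ?w' = "\<lambda>C. if nontrivial_circle D C then label_sign (l' C) else 0"
  have k: "k_degree D (I, l) = sum ?w (circles D I)" "k_degree D (I', l') = sum ?w' (circles D I')"
    by (simp_all add: k_degree_def)
  have "circles D I \<noteq> circles D I'" using kh not_khovanov_term_same by blast
  then consider "merges (circles D I) (circles D I')" | "merges (circles D I') (circles D I)"
    using circles_change[OF c] I' by blast
  then show ?thesis
  proof cases
    case 1
    then obtain A B R where R: "circles D I = insert A (insert B R)"
      "circles D I' = insert (A \<union> B) R" "A \<noteq> B" "A \<inter> B = {}" "A \<notin> R" "B \<notin> R" "A \<union> B \<notin> R" "finite R"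
      "circles D I - circles D I' = {A, B}" "circles D I' - circles D I = {A \<union> B}"
      "circles D I \<inter> circles D I' = R" by (rule mergesE)
    from kh have agree: "\<And>C. C \<in> R \<Longrightarrow> l' C = l C" and coeff: "merge_term (l A) (l B) (l' (A \<union> B))"
      using khovanov_term_merge_iff[OF c R(3), of "A \<union> B" l l'] R(9-11) unfolding I' by blast+
    have "sum ?w' R = sum ?w R" using agree by (intro sum.cong) simp_all
    moreover have "?w' (A \<union> B) \<le> ?w A + ?w B"
      using coeff nontrivial_circle_Un[OF R(4)] by (cases rule: merge_term.cases) simp_all
    ultimately show ?thesis unfolding k R(1,2) using R(3,5-8) by simp
  next
    case 2
    then obtain A B R where R: "circles D I' = insert A (insert B R)"
      "circles D I = insert (A \<union> B) R" "A \<noteq> B" "A \<inter> B = {}" "A \<notin> R" "B \<notin> R" "A \<union> B \<notin> R" "finite R"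
      "circles D I' - circles D I = {A, B}" "circles D I - circles D I' = {A \<union> B}"
      "circles D I' \<inter> circles D I = R" by (rule mergesE)
    from kh have agree: "\<And>C. C \<in> R \<Longrightarrow> l' C = l C" and coeff: "split_term (l (A \<union> B)) (l' A) (l' B)"
      using khovanov_term_split_iff[OF c R(3), of "A \<union> B" l l'] R(9-11) unfolding I' by blast+
    have "sum ?w' R = sum ?w R" using agree by (intro sum.cong) simp_all
    moreover have "?w' A + ?w' B \<le> ?w (A \<union> B)"
      using coeff nontrivial_circle_Un[OF R(4)] by (cases rule: split_term.cases) simp_all
    ultimately show ?thesis unfolding k R(1,2) using R(3,5-8) by simp
  qed
qed

definition annular_term :: "'v generator \<Rightarrow> 'v generator \<Rightarrow> bool" where
  "annular_term g g' \<longleftrightarrow> khovanov_term D g g' \<and> k_degree D g' = k_degree D g"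

text \<open>Along a deformed path the \<open>q\<close>-degree does not decrease, so equality at the two ends makes both steps
  Khovanov terms; along these the \<open>k\<close>-degree does not increase.\<close>

lemma annular_paths_iff:
  assumes I: "finite I" and c: "c < n_crossings D" "c \<notin> I" and c': "c' < n_crossings D" "c' \<notin> insert c I"
    and degs: "q_degree D (insert c' (insert c I), l'') = q_degree D (I, l)"
      "k_degree D (insert c' (insert c I), l'') = k_degree D (I, l)"
  shows "annular_term (I, l) (insert c I, l') \<and> annular_term (insert c I, l') (insert c' (insert c I), l'')
    \<longleftrightarrow> deformed_term I l (insert c I) l' \<and> deformed_term (insert c I) l' (insert c' (insert c I)) l''"
    (is "?L \<longleftrightarrow> ?R")
proof
  assume ?L
  then show ?R unfolding annular_term_def using khovanov_term_imp_deformed_term by blast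
next
  assume ?R
  with deformed_term_q_degree[OF c I, of l l'] deformed_term_q_degree[OF c', of l' l''] I degs(1)
  have kh: "khovanov_term D (I, l) (insert c I, l')"
    "khovanov_term D (insert c I, l') (insert c' (insert c I), l'')" by simp_all
  with khovanov_term_k_degree[OF kh(1)] khovanov_term_k_degree[OF kh(2)] degs(2)
  show ?L unfolding annular_term_def by simp
qed

text \<open>The two intermediate vertices of a face contribute numbers of the same parity.\<close>

lemma even_card_annular_paths:
  assumes g: "g \<in> generators D" and g'': "g'' \<in> generators D"
  shows "even (card {g' \<in> generators D. annular_term g g' \<and> annular_term g' g''})" (is "even (card ?X)")
proof (cases "?X = {}")
  case False
  obtain I l I'' l'' where gs: "g = (I, l)" "g'' = (I'', l'')" by (cases g, cases g'')
  have I: "I \<subseteq> {..<n_crossings D}" "finite I" using g gs by (auto simp: generators_def intro: finite_subset)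
  from False obtain I1 l1 where p1: "(I1, l1) \<in> generators D"
    "annular_term (I, l) (I1, l1)" "annular_term (I1, l1) (I'', l'')" using gs by auto
  then obtain a b where a: "a < n_crossings D" "a \<notin> I" "I1 = insert a I"
    and b: "b < n_crossings D" "b \<notin> insert a I" and I'': "I'' = insert b (insert a I)"
    unfolding annular_term_def using khovanov_term_edge by metis
  have degs: "q_degree D (I'', l'') = q_degree D (I, l)" "k_degree D (I'', l'') = k_degree D (I, l)"
    using p1 g gs khovanov_term_degrees(2)[OF finite_vertices] unfolding annular_term_def by metis+
  have ab: "b \<notin> I" "a \<notin> insert b I" "a \<noteq> b" "I'' = insert a (insert b I)" using a b I'' by auto
  define Y where "Y c = {l' \<in> circles D (insert c I) \<rightarrow>\<^sub>E UNIV.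
    deformed_term I l (insert c I) l' \<and> deformed_term (insert c I) l' I'' l''}" for c
  have in_Y: "l' \<in> Y c \<longleftrightarrow> (insert c I, l') \<in> ?X" if "c = a \<or> c = b" for c l'
  proof -
    have "annular_term (I, l) (insert c I, l') \<and> annular_term (insert c I, l') (I'', l'') \<longleftrightarrow>
        deformed_term I l (insert c I) l' \<and> deformed_term (insert c I) l' I'' l''"
      using that annular_paths_iff[OF I(2) a(1,2) b, of l'' l l']
        annular_paths_iff[OF I(2) b(1) ab(1) a(1) ab(2), of l'' l l'] degs ab(4) I'' by auto
    moreover have "(insert c I, l') \<in> generators D \<longleftrightarrow> l' \<in> circles D (insert c I) \<rightarrow>\<^sub>E UNIV"
      using that a(1) b(1) I(1) by (auto simp: generators_def)
    ultimately show ?thesis unfolding Y_def gs by blast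
  qed
  have X: "?X = Pair (insert a I) ` Y a \<union> Pair (insert b I) ` Y b"
  proof
    show "?X \<subseteq> Pair (insert a I) ` Y a \<union> Pair (insert b I) ` Y b"
    proof
      fix g' assume g': "g' \<in> ?X"
      obtain I' l' where p: "g' = (I', l')" by (cases g')
      from g' obtain c d where c: "c \<notin> I" "I' = insert c I" and d: "d \<notin> I'" "I'' = insert d I'"
        unfolding annular_term_def gs p using khovanov_term_edge by blast
      then have "c = a \<or> c = b" using I'' by blast
      with g' in_Y[of c l'] show "g' \<in> Pair (insert a I) ` Y a \<union> Pair (insert b I) ` Y b"
        unfolding p c(2) by blast
    qed
    show "Pair (insert a I) ` Y a \<union> Pair (insert b I) ` Y b \<subseteq> ?X" using in_Y by blast
  qed
  have "finite ?X" using finite_generators[OF finite_vertices] by simp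
  then have fin: "finite (Pair (insert a I) ` Y a)" "finite (Pair (insert b I) ` Y b)"
    unfolding X by simp_all
  have "insert a I \<noteq> insert b I" using ab(1,3) a(2) by blast
  then have "Pair (insert a I) ` Y a \<inter> Pair (insert b I) ` Y b = {}" by blast
  then have "card ?X = card (Y a) + card (Y b)"
    unfolding X using fin by (simp add: card_Un_disjoint card_image inj_on_def)
  moreover have "odd (card (Y c)) \<longleftrightarrow> odd (card (closed_between I l I'' l''))" if "c = a \<or> c = b" for c
    unfolding Y_def
  proof (rule odd_card_deformed_paths)
    \<comment> \<open>at the middle vertex, every crossing is smoothed as at one of the two outer vertices\<close>
    have "ra (insert c I) \<subseteq> ra I \<union> ra I''"
    proof -
      have "smoothing (crossings D ! e) (e \<in> insert c I) \<subseteq> ra I \<union> ra I''" if "e < n_crossings D" for e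
      proof (cases "e = c")
        case True
        with \<open>c = a \<or> c = b\<close> have "e \<in> I''" using I'' by blast
        then show ?thesis using that True unfolding resolution_arcs_def by auto
      next
        case False
        then show ?thesis using that unfolding resolution_arcs_def by auto
      qed
      then show ?thesis unfolding resolution_arcs_def[of D "insert c I"]
        unfolding resolution_arcs_def[of D I] by blast
    qed
    then show "closed_under (ra (insert c I)) X" if "closed_under (ra I \<union> ra I'') X" for X
      using that unfolding closed_under_def by blast
  qed
  ultimately show ?thesis by simp
next
  case True
  show ?thesis unfolding True by simp
qed

theorem annular_differential_squared:
  "annular_differential D (annular_differential D x) = (\<lambda>_. 0)"
proof
  fix g''
  let ?G = "generators D"
  show "annular_differential D (annular_differential D x) g'' = 0"
  proof (cases "g'' \<in> ?G")
    case True
    have d: "annular_differential D y g' = (\<Sum>g\<in>{g \<in> ?G. annular_term g g'}. y g)" if "g' \<in> ?G" for y g'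
      using that unfolding annular_differential_def annular_term_def by simp
    have fin: "finite ?G" by (rule finite_generators[OF finite_vertices])
    have "annular_differential D (annular_differential D x) g'' =
        (\<Sum>g'\<in>{g' \<in> ?G. annular_term g' g''}. annular_differential D x g')"
      by (rule d[OF True])
    also have "\<dots> = (\<Sum>g'\<in>{g' \<in> ?G. annular_term g' g''}. \<Sum>g\<in>{g \<in> ?G. annular_term g g'}. x g)"
      by (intro sum.cong HOL.refl d) simp
    also have "\<dots> = (\<Sum>g\<in>?G. \<Sum>g'\<in>{g' \<in> {g' \<in> ?G. annular_term g' g''}. annular_term g g'}. x g)"
      by (rule sum.swap_restrict) (use fin in simp_all)
    also have "\<dots> = (\<Sum>g\<in>?G. 0)"
    proof (intro sum.cong HOL.refl)
      fix g assume "g \<in> ?G"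
      have "{g' \<in> {g' \<in> ?G. annular_term g' g''}. annular_term g g'} =
          {g' \<in> ?G. annular_term g g' \<and> annular_term g' g''}" by blast
      with even_card_annular_paths[OF \<open>g \<in> ?G\<close> True]
      obtain m where "card {g' \<in> {g' \<in> ?G. annular_term g' g''}. annular_term g g'} = 2 * m"
        by (auto elim: evenE)
      then show "(\<Sum>g'\<in>{g' \<in> {g' \<in> ?G. annular_term g' g''}. annular_term g g'}. x g) = 0"
        by (simp only: sum_constant of_nat_mult of_nat_numeral bit_2_eq_0 mult_zero_left)
    qed
    finally show ?thesis by simp
  qed (simp add: annular_differential_def)
qed

end

section \<open>The trace of the Burau matrix as a sum over states\<close>

definition burau_column :: "nat \<Rightarrow> nat \<Rightarrow> laurent" where
  "burau_column i r = (if r = i - 1 then - s_var else if r = i then 1 else 0)"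

definition burau_row :: "nat \<Rightarrow> nat \<Rightarrow> laurent" where
  "burau_row i c = (if c = i - 1 then 1 else if c = i then -1 else 0)"

text \<open>The scalar in front of the rank-one part of a Burau letter.\<close>

definition letter_weight :: "bool \<Rightarrow> laurent" where
  "letter_weight b = (if b then 1 else s_inv)"

definition pairing :: "nat \<Rightarrow> nat \<Rightarrow> laurent" where
  "pairing a b = (if b = a then - (1 + s_var) else if b = a + 1 then s_var
     else if a = b + 1 then 1 else 0)"

lemma burau_letter_rank_one:
  assumes "1 \<le> i" "i < n" "r < n" "c < n"
  shows "burau_letter n (i, b) $$ (r, c) =
    of_bool (r = c) + letter_weight b * burau_column i r * burau_row i c"
proof -
  have "burau_block b $$ (r - (i - 1), c - (i - 1)) =
      of_bool (r = c) + letter_weight b * burau_column i r * burau_row i c"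
    if "r = i - 1 \<or> r = i" "c = i - 1 \<or> c = i"
    using that assms(1)
    by (auto simp: burau_block_def mat_of_rows_list_def burau_column_def burau_row_def
        letter_weight_def algebra_simps)
  then show ?thesis
    using assms by (auto simp: burau_letter_index burau_column_def burau_row_def)
qed

lemma burau_row_column:
  assumes "1 \<le> a" "a < n" "1 \<le> i" "i < n"
  shows "(\<Sum>r<n. burau_row a r * burau_column i r) = pairing a i"
proof -
  obtain a' i' where Suc: "a = Suc a'" "i = Suc i'" using assms(1,3) by (metis Suc_le_D One_nat_def)
  have "(\<Sum>r<n. burau_row a r * burau_column i r) =
      (\<Sum>r\<in>{a', a}. burau_row a r * burau_column i r)"
    using assms by (intro sum.mono_neutral_right) (simp_all add: burau_row_def Suc)
  also have "\<dots> = burau_column i a' - burau_column i a"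
    by (simp add: burau_row_def Suc)
  also have "\<dots> = pairing a i"
  proof -
    consider "i' = a'" | "i' = Suc a'" | "a' = Suc i'" | "i' \<noteq> a'" "i' \<noteq> Suc a'" "a' \<noteq> Suc i'" by blast
    then show ?thesis by cases (simp_all add: burau_column_def pairing_def Suc)
  qed
  finally show ?thesis .
qed

text \<open>If \<open>a\<close> is the letter at the last position in \<open>J\<close>, this is the letter at the predecessor of \<open>j\<close> in the
  cyclic order of \<open>J\<close>.\<close>

primrec preceding_letter :: "braid_word \<Rightarrow> nat set \<Rightarrow> nat \<Rightarrow> nat \<Rightarrow> nat" where
  "preceding_letter w J a 0 = a"
| "preceding_letter w J a (Suc j) = (if j \<in> J then fst (w ! j) else preceding_letter w J a j)"

definition state_weight :: "braid_word \<Rightarrow> nat \<Rightarrow> nat set \<Rightarrow> laurent" where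
  "state_weight w a J =
    (\<Prod>j\<in>J. letter_weight (snd (w ! j)) * pairing (preceding_letter w J a j) (fst (w ! j)))"

lemma preceding_letter_append [simp]:
  "j \<le> length w \<Longrightarrow> preceding_letter (w @ v) J a j = preceding_letter w J a j"
  by (induction j) (simp_all add: nth_append)

lemma preceding_letter_insert [simp]:
  "j \<le> m \<Longrightarrow> preceding_letter w (insert m J) a j = preceding_letter w J a j"
  by (induction j) auto

lemma preceding_letter_range:
  assumes "w \<in> braid_words n" "j \<le> length w"
    and "J \<inter> {..<j} \<noteq> {} \<or> 1 \<le> a \<and> a < n"
  shows "1 \<le> preceding_letter w J a j \<and> preceding_letter w J a j < n"
  using assms(2,3)
proof (induction j)
  case (Suc j)
  have "w ! j \<in> {i. 1 \<le> i \<and> i < n} \<times> UNIV"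
    using assms(1) Suc.prems(1) by (auto simp: braid_words_def in_lists_conv_set)
  then show ?case using Suc by (auto simp: lessThan_Suc)
qed simp

lemma state_weight_append:
  assumes "J \<subseteq> {..<length w}"
  shows "state_weight (w @ [x]) a J = state_weight w a J"
  unfolding state_weight_def
  by (rule prod.cong) (use assms in \<open>auto simp: nth_append subset_iff\<close>)

lemma state_weight_insert:
  assumes "J \<subseteq> {..<length w}"
  shows "state_weight (w @ [(i, b)]) a (insert (length w) J) =
    state_weight w a J * (letter_weight b * pairing (preceding_letter w J a (length w)) i)"
proof -
  have "finite J" "length w \<notin> J" using assms finite_subset by auto
  moreover have "(\<Prod>j\<in>J. letter_weight (snd ((w @ [(i, b)]) ! j)) *
      pairing (preceding_letter (w @ [(i, b)]) (insert (length w) J) a j) (fst ((w @ [(i, b)]) ! j))) =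
    state_weight w a J"
    unfolding state_weight_def
    by (rule prod.cong) (use assms in \<open>auto simp: nth_append subset_iff less_imp_le\<close>)
  ultimately show ?thesis
    unfolding state_weight_def[of "w @ _"] by (simp add: mult.commute)
qed

lemma sum_Pow_lessThan_Suc:
  fixes f :: "nat set \<Rightarrow> 'a::comm_monoid_add"
  shows "(\<Sum>J\<in>Pow {..<Suc m}. f J) = (\<Sum>J\<in>Pow {..<m}. f J + f (insert m J))"
proof -
  have "inj_on (insert m) (Pow {..<m})"
    by (rule inj_onI) (metis Diff_insert_absorb PowD lessThan_iff less_irrefl subsetD)
  then have "sum f (insert m ` Pow {..<m}) = (\<Sum>J\<in>Pow {..<m}. f (insert m J))"
    by (simp add: sum.reindex)
  moreover have "Pow {..<m} \<inter> insert m ` Pow {..<m} = {}" by auto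
  ultimately show ?thesis
    unfolding lessThan_Suc Pow_insert by (subst sum.union_disjoint) (simp_all add: sum.distrib)
qed

lemma burau_word_snoc_index:
  assumes w: "w \<in> braid_words n" and i: "1 \<le> i" "i < n" and rc: "r < n" "c < n"
  shows "burau_word n (w @ [(i, b)]) $$ (r, c) = burau_word n w $$ (r, c) +
    letter_weight b * (\<Sum>k<n. burau_word n w $$ (r, k) * burau_column i k) * burau_row i c"
proof -
  have W: "burau_word n w \<in> carrier_mat n n" by (rule burau_word_carrier[OF w])
  have G: "burau_letter n (i, b) \<in> carrier_mat n n" by (rule burau_letter_carrier[OF i])
  have "burau_word n (w @ [(i, b)]) = burau_word n w * burau_letter n (i, b)"
    using burau_word_append[of w n "[(i, b)]"] w i G by simp
  then have "burau_word n (w @ [(i, b)]) $$ (r, c) =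
      (\<Sum>k<n. burau_word n w $$ (r, k) * burau_letter n (i, b) $$ (k, c))"
    using W G rc by (simp add: scalar_prod_def lessThan_atLeast0)
  also have "\<dots> = (\<Sum>k<n. burau_word n w $$ (r, k) * of_bool (k = c) +
      letter_weight b * (burau_word n w $$ (r, k) * burau_column i k) * burau_row i c)"
    by (rule sum.cong) (use i rc in \<open>simp_all add: burau_letter_rank_one algebra_simps\<close>)
  also have "\<dots> = burau_word n w $$ (r, c) +
      letter_weight b * (\<Sum>k<n. burau_word n w $$ (r, k) * burau_column i k) * burau_row i c"
    using rc by (simp add: sum.distrib sum_distrib_left sum_distrib_right)
  finally show ?thesis .
qed

text \<open>Multiplication by a row on the left makes the rank-one matrices collapse to scalars from left to right.
  In the trace, the row is provided by the last letter of the word.\<close>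

lemma burau_row_times_burau_word:
  assumes "w \<in> braid_words n" "1 \<le> a" "a < n" "c < n"
  shows "(\<Sum>r<n. burau_row a r * burau_word n w $$ (r, c)) =
    (\<Sum>J\<in>Pow {..<length w}. state_weight w a J * burau_row (preceding_letter w J a (length w)) c)"
  using assms(1,4)
proof (induction w arbitrary: c rule: rev_induct)
  case Nil
  then show ?case by (simp add: state_weight_def if_distrib sum.delta cong: if_cong)
next
  case (snoc x w)
  obtain i b where x: "x = (i, b)" by force
  then have w: "w \<in> braid_words n" and i: "1 \<le> i" "i < n" using snoc.prems by auto
  note IH = snoc.IH[OF w]
  let ?W = "burau_word n w" and ?m = "length w"
  let ?p = "\<lambda>J. preceding_letter w J a ?m"
  have "(\<Sum>r<n. burau_row a r * burau_word n (w @ [x]) $$ (r, c)) =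
      (\<Sum>r<n. burau_row a r * ?W $$ (r, c)) + letter_weight b *
        (\<Sum>r<n. \<Sum>k<n. burau_row a r * ?W $$ (r, k) * burau_column i k) * burau_row i c"
    unfolding x using w i snoc.prems(2)
    by (simp add: burau_word_snoc_index sum.distrib sum_distrib_left sum_distrib_right algebra_simps)
  also have "(\<Sum>r<n. \<Sum>k<n. burau_row a r * ?W $$ (r, k) * burau_column i k) =
      (\<Sum>k<n. (\<Sum>r<n. burau_row a r * ?W $$ (r, k)) * burau_column i k)"
    by (subst sum.swap) (simp add: sum_distrib_right)
  also have "\<dots> = (\<Sum>k<n. (\<Sum>J\<in>Pow {..<?m}. state_weight w a J * burau_row (?p J) k) * burau_column i k)"
    by (rule sum.cong) (simp_all add: IH)
  also have "\<dots> = (\<Sum>J\<in>Pow {..<?m}. \<Sum>k<n. state_weight w a J * (burau_row (?p J) k * burau_column i k))"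
    by (subst sum.swap) (simp add: sum_distrib_right mult.assoc)
  also have "\<dots> = (\<Sum>J\<in>Pow {..<?m}. state_weight w a J * pairing (?p J) i)"
  proof (rule sum.cong[OF HOL.refl])
    fix J
    have "1 \<le> ?p J \<and> ?p J < n" using preceding_letter_range[OF w, of ?m J a] assms(2,3) by simp
    then show "(\<Sum>k<n. state_weight w a J * (burau_row (?p J) k * burau_column i k)) =
        state_weight w a J * pairing (?p J) i"
      using burau_row_column[of "?p J" n i] i by (simp add: sum_distrib_left[symmetric])
  qed
  also have "(\<Sum>r<n. burau_row a r * ?W $$ (r, c)) +
      letter_weight b * (\<Sum>J\<in>Pow {..<?m}. state_weight w a J * pairing (?p J) i) * burau_row i c =
    (\<Sum>J\<in>Pow {..<?m}. state_weight w a J * burau_row (?p J) c +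
      state_weight w a J * (letter_weight b * pairing (?p J) i) * burau_row i c)"
    unfolding IH[OF snoc.prems(2)]
    by (simp add: sum.distrib sum_distrib_left sum_distrib_right algebra_simps)
  also have "\<dots> = (\<Sum>J\<in>Pow {..<length (w @ [x])}. state_weight (w @ [x]) a J *
      burau_row (preceding_letter (w @ [x]) J a (length (w @ [x]))) c)"
    unfolding length_append_singleton sum_Pow_lessThan_Suc
    by (intro sum.cong HOL.refl, simp only: Pow_iff)
      (auto simp: x state_weight_append state_weight_insert nth_append)
  finally show ?case .
qed

text \<open>Expanding the product of the matrices \<open>1 + c u v\<^sup>T\<close>, a nonempty set \<open>J\<close> of letters contributes the
  product of the weights \<open>c\<close> and of the numbers \<open>v\<^sup>T u\<close> along the cyclic order of \<open>J\<close>.\<close>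

lemma trace_burau_word:
  assumes "w \<in> braid_words n"
  shows "mat_trace (burau_word n w) = of_nat n +
    (\<Sum>J\<in>Pow {..<length w} - {{}}. state_weight w (preceding_letter w J 0 (length w)) J)"
  using assms
proof (induction w rule: rev_induct)
  case Nil
  then show ?case by (simp add: mat_trace_def)
next
  case (snoc x w)
  obtain i b where x: "x = (i, b)" by force
  then have w: "w \<in> braid_words n" and i: "1 \<le> i" "i < n" using snoc.prems by auto
  let ?W = "burau_word n w" and ?m = "length w"
  let ?f = "\<lambda>w J. state_weight w (preceding_letter w J 0 (length w)) J"
  have dims: "dim_row ?W = n" "dim_row (burau_word n (w @ [x])) = n"
    using burau_word_carrier[OF w] burau_word_carrier[OF snoc.prems] by auto
  have "mat_trace (burau_word n (w @ [x])) =
      mat_trace ?W + letter_weight b *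
        (\<Sum>r<n. \<Sum>k<n. ?W $$ (r, k) * burau_column i k * burau_row i r)"
    unfolding mat_trace_def dims unfolding x using w i
    by (simp add: burau_word_snoc_index sum.distrib sum_distrib_left sum_distrib_right algebra_simps)
  also have "(\<Sum>r<n. \<Sum>k<n. ?W $$ (r, k) * burau_column i k * burau_row i r) =
      (\<Sum>k<n. (\<Sum>r<n. burau_row i r * ?W $$ (r, k)) * burau_column i k)"
    by (subst sum.swap) (simp add: sum_distrib_left sum_distrib_right ac_simps)
  also have "\<dots> = (\<Sum>k<n. (\<Sum>J\<in>Pow {..<?m}. state_weight w i J *
      burau_row (preceding_letter w J i ?m) k) * burau_column i k)"
    by (intro sum.cong HOL.refl arg_cong2[where f = "(*)"] burau_row_times_burau_word w i) simp
  also have "\<dots> = (\<Sum>J\<in>Pow {..<?m}. \<Sum>k<n. state_weight w i J *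
      (burau_row (preceding_letter w J i ?m) k * burau_column i k))"
    by (subst sum.swap) (simp add: sum_distrib_right mult.assoc)
  also have "\<dots> = (\<Sum>J\<in>Pow {..<?m}. state_weight w i J * pairing (preceding_letter w J i ?m) i)"
  proof (rule sum.cong[OF HOL.refl])
    fix J
    let ?p = "preceding_letter w J i ?m"
    have "1 \<le> ?p \<and> ?p < n" using preceding_letter_range[OF w, of ?m J i] i by simp
    then show "(\<Sum>k<n. state_weight w i J * (burau_row ?p k * burau_column i k)) =
        state_weight w i J * pairing ?p i"
      using burau_row_column[of ?p n i] i by (simp add: sum_distrib_left[symmetric])
  qed
  also have "letter_weight b * (\<Sum>J\<in>Pow {..<?m}. state_weight w i J * pairing (preceding_letter w J i ?m) i) =
      (\<Sum>J\<in>Pow {..<?m}. ?f (w @ [x]) (insert ?m J))"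
    unfolding sum_distrib_left
    by (intro sum.cong HOL.refl, simp only: Pow_iff)
      (simp add: x state_weight_insert nth_append algebra_simps)
  also have "mat_trace ?W = of_nat n + (\<Sum>J\<in>Pow {..<?m} - {{}}. ?f (w @ [x]) J)"
  proof -
    have "(\<Sum>J\<in>Pow {..<?m} - {{}}. ?f w J) = (\<Sum>J\<in>Pow {..<?m} - {{}}. ?f (w @ [x]) J)"
    proof (rule sum.cong[OF HOL.refl])
      fix J assume "J \<in> Pow {..<?m} - {{}}"
      then have "J \<subseteq> {..<?m}" "?m \<notin> J" by auto
      then show "?f w J = ?f (w @ [x]) J" by (simp add: state_weight_append)
    qed
    then show ?thesis using snoc.IH[OF w] by simp
  qed
  also have "(of_nat n + (\<Sum>J\<in>Pow {..<?m} - {{}}. ?f (w @ [x]) J)) +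
      (\<Sum>J\<in>Pow {..<?m}. ?f (w @ [x]) (insert ?m J)) =
    of_nat n + (\<Sum>J\<in>Pow {..<length (w @ [x])} - {{}}. ?f (w @ [x]) J)"
  proof -
    have split: "(\<Sum>J\<in>A - {{}}. g J) = (\<Sum>J\<in>A. g J) - g {}" if "finite A" "{} \<in> A"
      for A :: "nat set set" and g :: "nat set \<Rightarrow> laurent"
      using that by (simp add: sum_diff1)
    show ?thesis
      unfolding length_append_singleton
      by (simp add: split sum_Pow_lessThan_Suc sum.distrib finite_Pow_iff)
  qed
  finally show ?case .
qed

section \<open>Resolutions of a braid closure\<close>

lemma parity_outside_pair:
  fixes P Q :: "nat \<Rightarrow> bool"
  assumes "1 \<le> i" "i < n" and "\<And>p. p \<in> {1..n} \<Longrightarrow> p \<noteq> i \<Longrightarrow> p \<noteq> i + 1 \<Longrightarrow> P p = Q p"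
  shows "(even (card {p \<in> {1..n}. P p}) \<longleftrightarrow> even (card {p \<in> {1..n}. Q p})) \<longleftrightarrow>
    (even (card {p \<in> {i, i + 1}. P p}) \<longleftrightarrow> even (card {p \<in> {i, i + 1}. Q p}))"
proof -
  have split: "card {p \<in> {1..n}. R p} = card {p \<in> {1..n} - {i, i + 1}. R p} + card {p \<in> {i, i + 1}. R p}"
    for R
  proof -
    have "{p \<in> {1..n}. R p} = {p \<in> {1..n} - {i, i + 1}. R p} \<union> {p \<in> {i, i + 1}. R p}"
      using assms(1,2) by auto
    moreover have "{p \<in> {1..n} - {i, i + 1}. R p} \<inter> {p \<in> {i, i + 1}. R p} = {}" by blast
    ultimately show ?thesis by (simp add: card_Un_disjoint)
  qed
  have "{p \<in> {1..n} - {i, i + 1}. P p} = {p \<in> {1..n} - {i, i + 1}. Q p}" using assms(3) by blast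
  then show ?thesis unfolding split[of P] split[of Q] by auto
qed

locale braid_diagram =
  fixes n :: nat and w :: braid_word
  assumes word: "w \<in> braid_words n"
begin

abbreviation D where "D \<equiv> braid_closure n w"
abbreviation m where "m \<equiv> length w"
abbreviation letter where "letter j \<equiv> fst (w ! j)"

text \<open>The crossings whose smoothing consists of a cap and a cup. Their set determines the resolution and is the
  index set of the expansion of the Burau trace.\<close>

definition cups :: "nat set \<Rightarrow> nat set" where
  "cups I = {j. j < m \<and> (snd (w ! j) \<longleftrightarrow> j \<in> I)}"

lemma letter_range: "j < m \<Longrightarrow> 1 \<le> letter j \<and> letter j < n"
  using word by (auto simp: braid_words_def in_lists_conv_set dest!: nth_mem)

lemma n_crossings [simp]: "n_crossings D = m"
  by (simp add: n_crossings_def braid_closure_def)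

lemma crossing [simp]:
  assumes "j < m"
  shows "positive (crossings D ! j) = snd (w ! j)" "in_left (crossings D ! j) = (j, letter j)"
    "in_right (crossings D ! j) = (j, letter j + 1)" "out_left (crossings D ! j) = (j + 1, letter j)"
    "out_right (crossings D ! j) = (j + 1, letter j + 1)"
  using assms by (simp_all add: braid_closure_def split: prod.split)

lemma vertices [simp]: "vertices D = {0..m} \<times> {1..n}"
  by (simp add: braid_closure_def)

lemma cut_arcs: "cut_arcs D = (\<lambda>p. ((m, p), (0, p))) ` {1..n}"
  by (auto simp: braid_closure_def)

lemma arcs: "arcs D = {((j, p), (j + 1, p)) | j p.
    j < m \<and> p \<in> {1..n} \<and> p \<noteq> letter j \<and> p \<noteq> letter j + 1}"
  by (simp add: braid_closure_def)

lemma smoothing_crossing: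
  assumes "j < m"
  shows "smoothing (crossings D ! j) (j \<in> I) =
    (if j \<in> cups I then {((j, letter j), (j, letter j + 1)), ((j + 1, letter j), (j + 1, letter j + 1))}
     else {((j, letter j), (j + 1, letter j)), ((j, letter j + 1), (j + 1, letter j + 1))})"
  using assms by (auto simp: smoothing_def cups_def)

lemma smoothing_subset: "j < m \<Longrightarrow> smoothing (crossings D ! j) (j \<in> I) \<subseteq> resolution_arcs D I"
  unfolding resolution_arcs_def n_crossings by blast

lemma cup_arc:
  assumes "j < m" "j \<in> cups I"
  shows "((j, letter j), (j, letter j + 1)) \<in> resolution_arcs D I"
    "((j + 1, letter j), (j + 1, letter j + 1)) \<in> resolution_arcs D I"
  using smoothing_subset[OF assms(1), of I] assms(2) unfolding smoothing_crossing[OF assms(1)] by auto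

lemma vertical_arc:
  assumes "j < m" "p \<in> {1..n}" "j \<in> cups I \<Longrightarrow> p \<noteq> letter j \<and> p \<noteq> letter j + 1"
  shows "((j, p), (j + 1, p)) \<in> resolution_arcs D I"
proof (cases "p = letter j \<or> p = letter j + 1")
  case True
  then have "j \<notin> cups I" using assms(3) by blast
  with True show ?thesis
    using smoothing_subset[OF assms(1), of I] unfolding smoothing_crossing[OF assms(1)] by auto
next
  case False
  then show ?thesis using assms unfolding resolution_arcs_def arcs by auto
qed

lemma closing_arc: "p \<in> {1..n} \<Longrightarrow> ((m, p), (0, p)) \<in> resolution_arcs D I"
  unfolding resolution_arcs_def cut_arcs by auto

lemma resolution_arc_cases:
  assumes "(u, v) \<in> resolution_arcs D I"
  obtains (cup) j where "j < m" "j \<in> cups I" "u = (j, letter j)" "v = (j, letter j + 1)"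
  | (cap) j where "j < m" "j \<in> cups I" "u = (j + 1, letter j)" "v = (j + 1, letter j + 1)"
  | (vertical) j p where "j < m" "p \<in> {1..n}" "j \<in> cups I \<Longrightarrow> p \<noteq> letter j \<and> p \<noteq> letter j + 1"
      "u = (j, p)" "v = (j + 1, p)"
  | (closing) p where "p \<in> {1..n}" "u = (m, p)" "v = (0, p)"
proof -
  consider "(u, v) \<in> arcs D" | "(u, v) \<in> cut_arcs D"
    | j where "j < m" "(u, v) \<in> smoothing (crossings D ! j) (j \<in> I)"
    using assms unfolding resolution_arcs_def n_crossings by blast
  then show thesis
  proof cases
    case 1
    then show thesis using vertical unfolding arcs by blast
  next
    case 2
    then show thesis using closing unfolding cut_arcs by blast
  next
    case (3 j)
    have "letter j \<in> {1..n}" "letter j + 1 \<in> {1..n}" using letter_range[OF 3(1)] by auto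
    then show thesis
      using 3 cup[of j] cap[of j] vertical[of j "letter j"] vertical[of j "letter j + 1"]
      unfolding smoothing_crossing[OF 3(1)] by (auto split: if_splits)
  qed
qed

definition level_count :: "(nat \<times> nat) set \<Rightarrow> nat \<Rightarrow> nat" where
  "level_count K j = card {p \<in> {1..n}. (j, p) \<in> K}"

text \<open>Vertical arcs match up the points of the two levels, and a cap or a cup joins two points of the same level.\<close>

lemma level_count_step:
  assumes j: "j < m" and K: "closed_under (arcs D \<union> smoothing (crossings D ! j) (j \<in> I)) K"
  shows "even (level_count K (j + 1)) \<longleftrightarrow> even (level_count K j)"
proof -
  let ?i = "letter j"
  have out: "(j, p) \<in> K \<longleftrightarrow> (j + 1, p) \<in> K" if "p \<in> {1..n}" "p \<noteq> ?i" "p \<noteq> ?i + 1" for p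
  proof -
    have "((j, p), (j + 1, p)) \<in> arcs D" unfolding arcs using j that by blast
    then show ?thesis using K unfolding closed_under_def by blast
  qed
  have "even (card {p \<in> {?i, ?i + 1}. (j, p) \<in> K}) \<longleftrightarrow> even (card {p \<in> {?i, ?i + 1}. (j + 1, p) \<in> K})"
  proof (cases "j \<in> cups I")
    case True
    then have "(j, ?i) \<in> K \<longleftrightarrow> (j, ?i + 1) \<in> K" "(j + 1, ?i) \<in> K \<longleftrightarrow> (j + 1, ?i + 1) \<in> K"
      using K unfolding smoothing_crossing[OF j] closed_under_def by auto
    then have "{p \<in> {?i, ?i + 1}. (j, p) \<in> K} = (if (j, ?i) \<in> K then {?i, ?i + 1} else {})"
      "{p \<in> {?i, ?i + 1}. (j + 1, p) \<in> K} = (if (j + 1, ?i) \<in> K then {?i, ?i + 1} else {})" by auto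
    then show ?thesis by simp
  next
    case False
    then have "(j, p) \<in> K \<longleftrightarrow> (j + 1, p) \<in> K" if "p \<in> {?i, ?i + 1}" for p
      using K that unfolding smoothing_crossing[OF j] closed_under_def by auto
    then have "{p \<in> {?i, ?i + 1}. (j, p) \<in> K} = {p \<in> {?i, ?i + 1}. (j + 1, p) \<in> K}" by blast
    then show ?thesis by simp
  qed
  then show ?thesis
    using parity_outside_pair[of ?i n "\<lambda>p. (j, p) \<in> K" "\<lambda>p. (j + 1, p) \<in> K"] out letter_range[OF j]
    unfolding level_count_def by blast
qed

text \<open>Walk around the annulus from one side of the crossing \<open>c\<close> to the other: the number of points of \<open>K\<close> on a
  level changes by an even number at every other crossing, so it has the same parity on both sides of \<open>c\<close>.\<close>

lemma even_diagram: "even_diagram D"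
proof
  show "finite (vertices D)" by simp
  show "arcs D \<union> cut_arcs D \<subseteq> vertices D \<times> vertices D"
    unfolding arcs cut_arcs vertices by auto
next
  fix c assume "c < n_crossings D"
  then have c: "c < m" by simp
  have ends: "crossing_ends (crossings D ! c) =
      {(c, letter c), (c, letter c + 1), (c + 1, letter c), (c + 1, letter c + 1)}"
    using c by (simp add: crossing_ends_def)
  show "crossing_ends (crossings D ! c) \<subseteq> vertices D"
    unfolding ends using letter_range[OF c] c by auto
  show "card (crossing_ends (crossings D ! c)) = 4" unfolding ends by simp
next
  fix c I K
  assume "c < n_crossings D" and K: "closed_under (other_arcs D I c) K"
  then have c: "c < m" by simp
  let ?i = "letter c"
  have step: "even (level_count K (j + 1)) \<longleftrightarrow> even (level_count K j)" if "j < m" "j \<noteq> c" for j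
  proof (rule level_count_step[OF that(1)])
    show "closed_under (arcs D \<union> smoothing (crossings D ! j) (j \<in> I)) K"
      using K that unfolding other_arcs_def n_crossings closed_under_def by blast
  qed
  \<comment> \<open>the walk up to \<open>c\<close>, and the one from \<open>c + 1\<close> through the closing arcs back to level 0\<close>
  have low: "j \<le> c \<Longrightarrow> even (level_count K j) \<longleftrightarrow> even (level_count K 0)" for j
    using step c by (induction j) auto
  have high: "j < m - c \<Longrightarrow> even (level_count K (c + 1 + j)) \<longleftrightarrow> even (level_count K (c + 1))" for j
    using step[of "c + 1 + _"] by (induction j) auto
  have "(m, p) \<in> K \<longleftrightarrow> (0, p) \<in> K" if "p \<in> {1..n}" for p
    using K that unfolding other_arcs_def cut_arcs closed_under_def by blast
  then have "level_count K m = level_count K 0"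
    unfolding level_count_def by (intro arg_cong[where f = card]) blast
  then have parity: "even (level_count K c) \<longleftrightarrow> even (level_count K (c + 1))"
  proof -
    have "c + 1 + (m - c - 1) = m" using c by simp
    then show ?thesis using \<open>level_count K m = level_count K 0\<close> low[of c] high[of "m - c - 1"] c by simp
  qed
  have "(c, p) \<in> K \<longleftrightarrow> (c + 1, p) \<in> K" if "p \<in> {1..n}" "p \<noteq> ?i" "p \<noteq> ?i + 1" for p
  proof -
    have "((c, p), (c + 1, p)) \<in> arcs D" unfolding arcs using c that by blast
    then show ?thesis using K unfolding other_arcs_def closed_under_def by blast
  qed
  then have "even (card {p \<in> {?i, ?i + 1}. (c, p) \<in> K}) \<longleftrightarrow> even (card {p \<in> {?i, ?i + 1}. (c + 1, p) \<in> K})"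
    using parity_outside_pair[of ?i n "\<lambda>p. (c, p) \<in> K" "\<lambda>p. (c + 1, p) \<in> K"] letter_range[OF c] parity
    unfolding level_count_def by blast
  moreover have "K \<inter> crossing_ends (crossings D ! c) =
      Pair c ` {p \<in> {?i, ?i + 1}. (c, p) \<in> K} \<union> Pair (c + 1) ` {p \<in> {?i, ?i + 1}. (c + 1, p) \<in> K}"
    using c by (auto simp: crossing_ends_def)
  moreover have "card (Pair c ` {p \<in> {?i, ?i + 1}. (c, p) \<in> K} \<union>
        Pair (c + 1) ` {p \<in> {?i, ?i + 1}. (c + 1, p) \<in> K}) =
      card {p \<in> {?i, ?i + 1}. (c, p) \<in> K} + card {p \<in> {?i, ?i + 1}. (c + 1, p) \<in> K}"
    by (subst card_Un_disjoint) (auto simp: card_image inj_on_def)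
  ultimately show "even (card (K \<inter> crossing_ends (crossings D ! c)))" by simp
qed

sublocale even_diagram D by (rule even_diagram)

lemma level_count_parity:
  assumes "closed_under (resolution_arcs D I) K" "j \<le> m"
  shows "even (level_count K j) \<longleftrightarrow> even (level_count K m)"
proof -
  have step: "even (level_count K (j + 1)) \<longleftrightarrow> even (level_count K j)" if "j < m" for j
  proof (rule level_count_step[OF that])
    show "closed_under (arcs D \<union> smoothing (crossings D ! j) (j \<in> I)) K"
      using assms(1) that unfolding resolution_arcs_def n_crossings closed_under_def by blast
  qed
  have all: "j \<le> m \<Longrightarrow> even (level_count K j) \<longleftrightarrow> even (level_count K 0)" for j
    using step by (induction j) auto
  show ?thesis using all[OF assms(2)] all[of m] by simp
qed

text \<open>By invariance of the parity, every level can play the role of the radial arc.\<close>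

lemma nontrivial_iff_odd_level_count:
  assumes "C \<in> circles D I" "j \<le> m"
  shows "nontrivial_circle D C \<longleftrightarrow> odd (level_count C j)"
proof -
  have "{e \<in> cut_arcs D. fst e \<in> C} = (\<lambda>p. ((m, p), (0, p))) ` {p \<in> {1..n}. (m, p) \<in> C}"
    unfolding cut_arcs by auto
  then have "card {e \<in> cut_arcs D. fst e \<in> C} = level_count C m"
    unfolding level_count_def by (simp add: card_image inj_on_def)
  then show ?thesis
    unfolding nontrivial_circle_def
    using level_count_parity[OF circle_closed[OF assms(1)] assms(2)] by simp
qed

lemma sum_level_count:
  assumes "j \<le> m"
  shows "(\<Sum>C\<in>circles D I. level_count C j) = n"
proof -
  have "(\<Sum>C\<in>circles D I. level_count C j) = card (\<Union>C\<in>circles D I. {p \<in> {1..n}. (j, p) \<in> C})"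
    unfolding level_count_def
    by (subst card_UN_disjoint) (use circles_disjoint in \<open>fastforce+\<close>)
  also have "(\<Union>C\<in>circles D I. {p \<in> {1..n}. (j, p) \<in> C}) = {1..n}"
  proof
    show "{1..n} \<subseteq> (\<Union>C\<in>circles D I. {p \<in> {1..n}. (j, p) \<in> C})"
    proof
      fix p assume p: "p \<in> {1..n}"
      then have "(j, p) \<in> vertices D" using assms by simp
      then obtain C where "C \<in> circles D I" "(j, p) \<in> C" using circles_cover by blast
      with p show "p \<in> (\<Union>C\<in>circles D I. {p \<in> {1..n}. (j, p) \<in> C})" by blast
    qed
  qed blast
  finally show ?thesis by simp
qed

end

section \<open>The circles of a state with at least \<open>n - 2\<close> nontrivial circles\<close>

definition fibre :: "('a \<Rightarrow> 'b) \<Rightarrow> 'a set \<Rightarrow> 'b \<Rightarrow> 'a set" where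
  "fibre f A y = {x \<in> A. f x = y}"

text \<open>To determine the circles, it suffices to find a labelling of the vertices that is constant along arcs and
  takes equal values only on vertices that are connected.\<close>

lemma (in even_diagram) circles_eq_fibres:
  assumes resp: "\<And>u v. (u, v) \<in> ra I \<Longrightarrow> f u = f v"
    and con: "\<And>u v. u \<in> V \<Longrightarrow> v \<in> V \<Longrightarrow> f u = f v \<Longrightarrow> (u, v) \<in> conn (ra I)"
  shows "circles D I = fibre f V ` f ` V"
proof -
  have "conn (ra I) `` {u} = fibre f V (f u)" if u: "u \<in> V" for u
  proof
    have "closed_under (ra I) (fibre f V (f u))"
      using resp resolution_arcs_vertices[of I] unfolding closed_under_def fibre_def by fastforce
    from closed_under_conn[OF this] u show "conn (ra I) `` {u} \<subseteq> fibre f V (f u)"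
      unfolding fibre_def by blast
    show "fibre f V (f u) \<subseteq> conn (ra I) `` {u}" using con[OF u] unfolding fibre_def by auto
  qed
  then show ?thesis unfolding circles_eq quotient_def by (auto simp: image_iff)
qed

lemma inj_on_fibre: "inj_on (fibre f A) (f ` A)"
  by (rule inj_onI) (auto simp: fibre_def)

context braid_diagram
begin

lemma level_count_fibre:
  "j \<le> m \<Longrightarrow> level_count (fibre f V y) j = card {p \<in> {1..n}. f (j, p) = y}"
  unfolding level_count_def fibre_def by (rule arg_cong[where f = card]) auto

lemma circles_without_cups:
  assumes "cups I = {}"
  shows "card (circles D I) = n" "\<And>C. C \<in> circles D I \<Longrightarrow> nontrivial_circle D C"
proof -
  have up: "((0, p), (j, p)) \<in> conn (ra I)" if "p \<in> {1..n}" "j \<le> m" for j p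
    using that(2)
  proof (induction j)
    case (Suc j)
    then have "((j, p), (Suc j, p)) \<in> conn (ra I)"
      using vertical_arc[of j p I] that(1) assms by (intro conn_arc) simp
    with Suc show ?case by (auto intro: conn_trans)
  qed simp
  have circ: "circles D I = fibre snd V ` snd ` V"
  proof (rule circles_eq_fibres)
    show "snd u = snd v" if "(u, v) \<in> ra I" for u v
      using that by (cases rule: resolution_arc_cases) (use assms in auto)
    show "(u, v) \<in> conn (ra I)" if "u \<in> V" "v \<in> V" "snd u = snd v" for u v
      using that up[of "snd u" "fst u"] up[of "snd u" "fst v"]
      by (cases u; cases v) (auto intro: conn_trans conn_sym)
  qed
  have im: "snd ` V = {1..n}" by (auto simp: image_iff)
  show "card (circles D I) = n"
    unfolding circ using card_image[OF inj_on_fibre[of snd V]] im by simp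
  fix C assume C: "C \<in> circles D I"
  then obtain p where p: "p \<in> {1..n}" "C = fibre snd V p" unfolding circ im by blast
  have "{q \<in> {1..n}. snd (0 :: nat, q) = p} = {p}" using p(1) by auto
  then have "level_count C 0 = 1" unfolding p(2) by (subst level_count_fibre) simp_all
  then show "nontrivial_circle D C" using nontrivial_iff_odd_level_count[OF C, of 0] by simp
qed

end

text \<open>In a state with turnbacks, every level lies between a cup below it and a cap above it, in cyclic order. The
  letters of these two are called \<open>before j\<close> and \<open>after j\<close>.\<close>

locale cupped_state = braid_diagram +
  fixes I :: "nat set"
  assumes cups_nonempty: "cups I \<noteq> {}"
begin

abbreviation J where "J \<equiv> cups I"

definition before :: "nat \<Rightarrow> nat" where
  "before j = preceding_letter w J (preceding_letter w J 0 m) j"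

text \<open>The second alternative is the passage through the radial arc.\<close>

definition next_cup :: "nat \<Rightarrow> nat" where
  "next_cup j = (if \<exists>i\<ge>j. i \<in> J then Min {i \<in> J. j \<le> i} else Min J)"

definition after :: "nat \<Rightarrow> nat" where
  "after j = letter (next_cup j)"

lemma J_bound: "j \<in> J \<Longrightarrow> j < m"
  by (simp add: cups_def)

lemma finite_J: "finite J"
  by (rule finite_subset[of _ "{..<m}"]) (use J_bound in auto)

lemma preceding_letter_independent:
  "J \<inter> {..<j} \<noteq> {} \<Longrightarrow> preceding_letter w J a j = preceding_letter w J b j"
  by (induction j) (auto simp: lessThan_Suc)

lemma before_step: "before (Suc j) = (if j \<in> J then letter j else before j)"
  by (simp add: before_def)

lemma before_cyclic: "before m = before 0"
proof -
  have "J \<inter> {..<m} \<noteq> {}" using cups_nonempty J_bound by auto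
  then show ?thesis
    unfolding before_def using preceding_letter_independent[of m] by simp
qed

lemma next_cup_cup: "j \<in> J \<Longrightarrow> next_cup j = j"
proof -
  assume "j \<in> J"
  then have "Min {i \<in> J. j \<le> i} = j" using finite_J by (intro Min_eqI) auto
  then show ?thesis using \<open>j \<in> J\<close> unfolding next_cup_def by auto
qed

lemma next_cup_step: "j \<notin> J \<Longrightarrow> next_cup j = next_cup (Suc j)"
proof -
  assume "j \<notin> J"
  then have "i \<in> J \<and> j \<le> i \<longleftrightarrow> i \<in> J \<and> Suc j \<le> i" for i by (metis Suc_le_eq le_less)
  then have "{i \<in> J. j \<le> i} = {i \<in> J. Suc j \<le> i}" "(\<exists>i\<ge>j. i \<in> J) \<longleftrightarrow> (\<exists>i\<ge>Suc j. i \<in> J)"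
    by blast+
  then show ?thesis unfolding next_cup_def by (simp only:)
qed

lemma next_cup_cyclic: "next_cup m = next_cup 0"
proof -
  have "\<not> (\<exists>i\<ge>m. i \<in> J)" using J_bound by fastforce
  moreover have "\<exists>i\<ge>0. i \<in> J" using cups_nonempty by blast
  ultimately show ?thesis unfolding next_cup_def by auto
qed

lemma after_cup: "j \<in> J \<Longrightarrow> after j = letter j"
  by (simp add: after_def next_cup_cup)

lemma after_step: "j \<notin> J \<Longrightarrow> after (Suc j) = after j"
  by (simp add: after_def next_cup_step)

lemma after_cyclic: "after m = after 0"
  by (simp add: after_def next_cup_cyclic)

text \<open>Both induction principles walk around the annulus, starting from some cup.\<close>

lemma induct_to_next_cup:
  assumes cup: "\<And>j. j \<in> J \<Longrightarrow> P j"
    and step: "\<And>j. j < m \<Longrightarrow> j \<notin> J \<Longrightarrow> P (Suc j) \<Longrightarrow> P j" and cyc: "P 0 \<Longrightarrow> P m" and "j \<le> m"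
  shows "P j"
proof -
  have down: "P i" if "i \<le> k" "k \<le> m" "P k" for i k
    using that(1)
  proof (induction rule: inc_induct)
    case (step i)
    then show ?case using cup assms(2)[of i] that(2) by (cases "i \<in> J") auto
  qed (rule that(3))
  obtain k where "k \<in> J" using cups_nonempty by blast
  then have "P 0" using down[of 0 k] cup J_bound by (simp add: less_imp_le)
  then show ?thesis using cyc down[of j m] assms(4) by simp
qed

lemma induct_from_previous_cup:
  assumes cup: "\<And>j. j \<in> J \<Longrightarrow> P (Suc j)"
    and step: "\<And>j. j < m \<Longrightarrow> j \<notin> J \<Longrightarrow> P j \<Longrightarrow> P (Suc j)" and cyc: "P m \<Longrightarrow> P 0" and "j \<le> m"
  shows "P j"
proof -
  have up: "P i" if "k \<le> i" "i \<le> m" "P k" for i k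
    using that(1,2)
  proof (induction rule: dec_induct)
    case (step i)
    then show ?case using cup assms(2)[of i] by (cases "i \<in> J") auto
  qed (rule that(3))
  obtain k where "k \<in> J" using cups_nonempty by blast
  then have "P m" using up[of "Suc k" m] cup J_bound by (simp add: Suc_leI)
  then show ?thesis using cyc up[of 0 j] assms(4) by simp
qed

lemma before_range: "j \<le> m \<Longrightarrow> 1 \<le> before j \<and> before j < n"
  by (rule induct_from_previous_cup[where P = "\<lambda>j. 1 \<le> before j \<and> before j < n"])
    (use letter_range J_bound in \<open>auto simp: before_step before_cyclic\<close>)

lemma after_range: "j \<le> m \<Longrightarrow> 1 \<le> after j \<and> after j < n"
  by (rule induct_to_next_cup[where P = "\<lambda>j. 1 \<le> after j \<and> after j < n"])
    (use letter_range J_bound in \<open>auto simp: after_step after_cup after_cyclic\<close>)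

lemma vertical_conn:
  assumes "j < m" "p \<in> {1..n}" "j \<in> J \<Longrightarrow> p \<noteq> letter j \<and> p \<noteq> letter j + 1"
  shows "((j, p), (Suc j, p)) \<in> conn (ra I)"
  using vertical_arc[of j p I] assms by (intro conn_arc) simp

lemma closing_conn: "p \<in> {1..n} \<Longrightarrow> ((m, p), (0, p)) \<in> conn (ra I)"
  by (intro conn_arc closing_arc)

lemma after_conn: "j \<le> m \<Longrightarrow> ((j, after j), (j, after j + 1)) \<in> conn (ra I)"
proof (rule induct_to_next_cup[where P = "\<lambda>j. ((j, after j), (j, after j + 1)) \<in> conn (ra I)"])
  fix j assume "j \<in> J"
  then show "((j, after j), (j, after j + 1)) \<in> conn (ra I)"
    using cup_arc(1)[OF J_bound] by (simp add: after_cup conn_arc)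
next
  fix j assume j: "j < m" "j \<notin> J" and IH: "((Suc j, after (Suc j)), (Suc j, after (Suc j) + 1)) \<in> conn (ra I)"
  have "after j \<in> {1..n}" "after j + 1 \<in> {1..n}" using after_range[of j] j(1) by auto
  with vertical_conn[OF j(1)] j(2) IH[unfolded after_step[OF j(2)]]
  show "((j, after j), (j, after j + 1)) \<in> conn (ra I)" by (meson conn_trans conn_sym)
next
  assume IH: "((0, after 0), (0, after 0 + 1)) \<in> conn (ra I)"
  have "after 0 \<in> {1..n}" "after 0 + 1 \<in> {1..n}" using after_range[of 0] by auto
  with closing_conn IH show "((m, after m), (m, after m + 1)) \<in> conn (ra I)"
    unfolding after_cyclic by (meson conn_trans conn_sym)
qed

lemma before_conn: "j \<le> m \<Longrightarrow> ((j, before j), (j, before j + 1)) \<in> conn (ra I)"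
proof (rule induct_from_previous_cup[where P = "\<lambda>j. ((j, before j), (j, before j + 1)) \<in> conn (ra I)"])
  fix j assume "j \<in> J"
  then show "((Suc j, before (Suc j)), (Suc j, before (Suc j) + 1)) \<in> conn (ra I)"
    using cup_arc(2)[OF J_bound] by (simp add: before_step conn_arc)
next
  fix j assume j: "j < m" "j \<notin> J" and IH: "((j, before j), (j, before j + 1)) \<in> conn (ra I)"
  have "before j \<in> {1..n}" "before j + 1 \<in> {1..n}" using before_range[of j] j(1) by auto
  with vertical_conn[OF j(1)] j(2) IH
  have "((Suc j, before j), (Suc j, before j + 1)) \<in> conn (ra I)" by (meson conn_trans conn_sym)
  then show "((Suc j, before (Suc j)), (Suc j, before (Suc j) + 1)) \<in> conn (ra I)"
    using j(2) by (simp add: before_step)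
next
  assume IH: "((m, before m), (m, before m + 1)) \<in> conn (ra I)"
  have "before m \<in> {1..n}" "before m + 1 \<in> {1..n}" using before_range[of m] by auto
  with closing_conn IH show "((0, before 0), (0, before 0 + 1)) \<in> conn (ra I)"
    unfolding before_cyclic[symmetric] by (meson conn_trans conn_sym)
qed

lemma conn_same_circle: "C \<in> circles D I \<Longrightarrow> (u, v) \<in> conn (ra I) \<Longrightarrow> u \<in> C \<Longrightarrow> v \<in> C"
  using closed_under_conn[OF circle_closed] by blast

text \<open>A nontrivial circle has an odd number of points on the level \<open>j\<close>. The two pairs of points that are joined
  by the adjacent cup and cap are disjoint; a circle through one of the pairs has at least 2 points more than
  what it contributes to the number of nontrivial circles, and a circle through both has at least 4 more.\<close>

lemma card_nontrivial_distant:
  assumes j: "j \<in> J" and far: "before j + 1 < letter j \<or> letter j + 1 < before j"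
  shows "card {C \<in> circles D I. nontrivial_circle D C} + 4 \<le> n"
proof -
  have jm: "j \<le> m" "j < m" using J_bound[OF j] by simp_all
  let ?a = "before j" and ?b = "letter j" and ?c = "\<lambda>C. level_count C j"
    and ?o = "\<lambda>C. of_bool (nontrivial_circle D C) :: nat"
  let ?S = "circles D I"
  have fin: "finite ?S" using finite_circles[OF finite_vertices] .
  have ranges: "?a \<in> {1..n}" "?a + 1 \<in> {1..n}" "?b \<in> {1..n}" "?b + 1 \<in> {1..n}"
    using before_range[OF jm(1)] letter_range[OF jm(2)] by auto
  have o: "?o C \<le> ?c C" and par: "nontrivial_circle D C \<longleftrightarrow> odd (?c C)" if "C \<in> ?S" for C
    using nontrivial_iff_odd_level_count[OF that jm(1)] by (auto simp: odd_pos Suc_leI)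
  have conns: "((j, ?a), (j, ?a + 1)) \<in> conn (ra I)" "((j, ?b), (j, ?b + 1)) \<in> conn (ra I)"
    using before_conn[OF jm(1)] after_conn[OF jm(1)] after_cup[OF j] by simp_all
  have "(j, ?a) \<in> V" "(j, ?b) \<in> V" using ranges jm by simp_all
  then obtain A B where A: "A \<in> ?S" "(j, ?a) \<in> A" and B: "B \<in> ?S" "(j, ?b) \<in> B"
    using circles_cover by meson
  then have A': "(j, ?a + 1) \<in> A" and B': "(j, ?b + 1) \<in> B"
    using conn_same_circle conns by blast+
  have "sum ?o ?S + 4 \<le> sum ?c ?S"
  proof (cases "A = B")
    case True
    have "{?a, ?a + 1, ?b, ?b + 1} \<subseteq> {p \<in> {1..n}. (j, p) \<in> A}"
      using A A' B B' ranges True by blast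
    moreover have "card {?a, ?a + 1, ?b, ?b + 1} = 4" using far by auto
    ultimately have "4 \<le> ?c A"
      using card_mono[of "{p \<in> {1..n}. (j, p) \<in> A}" "{?a, ?a + 1, ?b, ?b + 1}"]
      unfolding level_count_def by simp
    then have "?o A + 4 \<le> ?c A" using par[OF A(1)] by (cases "?c A = 4") auto
    moreover have "sum ?o (?S - {A}) \<le> sum ?c (?S - {A})" by (rule sum_mono) (use o in blast)
    ultimately show ?thesis using sum.remove[OF fin A(1), of ?o] sum.remove[OF fin A(1), of ?c] by simp
  next
    case False
    have two: "?o C + 2 \<le> ?c C" if "C \<in> ?S" "(j, p) \<in> C" "(j, p + 1) \<in> C" "p \<in> {1..n}" "p + 1 \<in> {1..n}" for C p
    proof -
      have "{p, p + 1} \<subseteq> {p \<in> {1..n}. (j, p) \<in> C}" using that by blast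
      then have "card {p, p + 1} \<le> ?c C" unfolding level_count_def by (rule card_mono[rotated]) simp
      then have "2 \<le> ?c C" by simp
      then show ?thesis using par[OF that(1)] by (cases "?c C = 2") auto
    qed
    have B1: "B \<in> ?S - {A}" using B False by blast
    have "sum ?o (?S - {A} - {B}) \<le> sum ?c (?S - {A} - {B})" by (rule sum_mono) (use o in blast)
    moreover have "?o A + 2 \<le> ?c A" "?o B + 2 \<le> ?c B" using two A A' B B' ranges by blast+
    ultimately show ?thesis
      using sum.remove[OF fin A(1), of ?o] sum.remove[OF fin A(1), of ?c]
        sum.remove[OF _ B1, of ?o] sum.remove[OF _ B1, of ?c] fin by simp
  qed
  moreover have "sum ?o ?S = card {C \<in> ?S. nontrivial_circle D C}" using fin by (simp add: Int_def)
  ultimately show ?thesis using sum_level_count[OF jm(1), of I] by simp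
qed

end

text \<open>Here all consecutive turnbacks meet, and the circles can be listed. Between a cup and a cap of the same letter
  \<open>a\<close>, the positions \<open>a, a + 1\<close> lie on a trivial circle. Between neighbouring letters \<open>a, a + 1\<close>, the
  positions \<open>a, a + 1, a + 2\<close> lie on a zigzag of one through strand. All other positions
  are on straight through strands, those on the right being shifted by two.\<close>

locale connected_state = cupped_state +
  assumes close: "j \<in> J \<Longrightarrow> before j \<le> letter j + 1 \<and> letter j \<le> before j + 1"
begin

lemma before_after_close: "j \<le> m \<Longrightarrow> before j \<le> after j + 1 \<and> after j \<le> before j + 1"
  by (rule induct_to_next_cup[where P = "\<lambda>j. before j \<le> after j + 1 \<and> after j \<le> before j + 1"])
    (use close in \<open>auto simp: after_cup after_step before_step before_cyclic after_cyclic\<close>)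

definition lo :: "nat \<Rightarrow> nat" where "lo j = min (before j) (after j)"
definition hi :: "nat \<Rightarrow> nat" where "hi j = max (before j) (after j)"

definition through :: "nat \<Rightarrow> nat \<Rightarrow> nat" where
  "through j p = (if p \<le> lo j then p else if p > hi j then p - 2 else lo j)"

text \<open>Through strands are numbered by \<open>1, \<dots>, n - 2\<close> from the left, and a trivial circle is named after the position
  of its cap.\<close>

definition strand :: "nat \<times> nat \<Rightarrow> nat + nat" where
  "strand = (\<lambda>(j, p). if before j = after j \<and> (p = after j \<or> p = after j + 1) then Inr (next_cup j)
     else Inl (through j p))"

text \<open>A point of the through strand \<open>r\<close> on the level \<open>j\<close>. For \<open>r = lo j\<close> it is on the right, because the position
  \<open>lo j\<close> itself may be on a trivial circle.\<close>

definition position :: "nat \<Rightarrow> nat \<Rightarrow> nat" where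
  "position j r = (if r < lo j then r else r + 2)"

lemma level_cases:
  assumes "j \<le> m"
  obtains (equal) "before j = after j" "lo j = after j" "hi j = after j"
  | (up) "after j = before j + 1" "lo j = before j" "hi j = before j + 1"
  | (down) "before j = after j + 1" "lo j = after j" "hi j = after j + 1"
  using before_after_close[OF assms] unfolding lo_def hi_def by linarith

text \<open>The numbers of the straight strands next to a turnback do not depend on the adjacent turnbacks, which makes
  the numberings on the two sides of it agree.\<close>

lemma strand_outside:
  assumes j: "j \<in> J" and p: "p \<noteq> letter j" "p \<noteq> letter j + 1"
  shows "strand (j, p) = Inl (if p < letter j then p else p - 2)"
    "strand (Suc j, p) = Inl (if p < letter j then p else p - 2)"
proof -
  have jm: "j \<le> m" "Suc j \<le> m" using J_bound[OF j] by simp_all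
  have a: "after j = letter j" "before (Suc j) = letter j" using j by (simp_all add: after_cup before_step)
  show "strand (j, p) = Inl (if p < letter j then p else p - 2)"
    using jm(1) by (cases rule: level_cases) (use p a in \<open>auto simp: strand_def through_def\<close>)
  show "strand (Suc j, p) = Inl (if p < letter j then p else p - 2)"
    using jm(2) by (cases rule: level_cases) (use p a in \<open>auto simp: strand_def through_def\<close>)
qed

lemma strand_after: "j \<le> m \<Longrightarrow> strand (j, after j) = strand (j, after j + 1)"
  by (erule level_cases) (auto simp: strand_def through_def)

lemma strand_before: "j \<le> m \<Longrightarrow> strand (j, before j) = strand (j, before j + 1)"
  by (erule level_cases) (auto simp: strand_def through_def)

lemma strand_vertical: "j \<notin> J \<Longrightarrow> strand (j, p) = strand (Suc j, p)"
  by (simp add: strand_def through_def lo_def hi_def before_step after_step next_cup_step)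

lemma strand_closing: "strand (m, p) = strand (0, p)"
  by (simp add: strand_def through_def lo_def hi_def before_cyclic after_cyclic next_cup_cyclic)

lemma strand_arc:
  assumes "(u, v) \<in> ra I"
  shows "strand u = strand v"
  using assms
proof (cases rule: resolution_arc_cases)
  case (cup j)
  then show ?thesis using strand_after[of j] by (simp add: after_cup)
next
  case (cap j)
  then show ?thesis using strand_before[of "Suc j"] by (simp add: before_step)
next
  case (vertical j p)
  then show ?thesis using strand_vertical[of j p] strand_outside[of j p] by (cases "j \<in> J") auto
next
  case (closing p)
  then show ?thesis by (simp add: strand_closing)
qed

lemma strand_position:
  assumes "j \<le> m"
  shows "strand (j, position j r) = Inl r"
  using assms by (cases rule: level_cases) (auto simp: strand_def through_def position_def)

lemma position_range: "j \<le> m \<Longrightarrow> 1 \<le> r \<Longrightarrow> r + 2 \<le> n \<Longrightarrow> position j r \<in> {1..n}"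
  by (auto simp: position_def)

text \<open>The three points of a zigzag are connected through the adjacent cup and cap.\<close>

lemma strand_through:
  assumes j: "j \<le> m" and p: "p \<in> {1..n}" and s: "strand (j, p) = Inl r"
  shows "((j, p), (j, position j r)) \<in> conn (ra I)" "1 \<le> r \<and> r + 2 \<le> n"
proof -
  note conns = after_conn[OF j] before_conn[OF j]
  have ranges: "1 \<le> before j" "before j < n" "1 \<le> after j" "after j < n"
    using before_range[OF j] after_range[OF j] by simp_all
  have "((j, p), (j, position j r)) \<in> conn (ra I) \<and> 1 \<le> r \<and> r + 2 \<le> n"
    using j
  proof (cases rule: level_cases)
    case equal
    then have "p \<noteq> after j" "p \<noteq> after j + 1" "r = (if p < after j then p else p - 2)"
      using s by (auto simp: strand_def through_def split: if_splits)
    moreover from this have "p < after j \<or> p = p - 2 + 2 \<and> p > after j + 1" by linarith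
    ultimately show ?thesis using p ranges equal by (auto simp: position_def)
  next
    case up
    have r: "r = (if p \<le> before j then p else if p > before j + 1 then p - 2 else before j)"
      using s up by (auto simp: strand_def through_def)
    consider "p < before j" | "p = before j" | "p = before j + 1" | "p = before j + 2" | "p > before j + 2" "Suc (Suc (p - 2)) = p"
      by linarith
    then show ?thesis
      by cases (use r up p ranges conns in \<open>auto simp: position_def intro: conn_trans\<close>)
  next
    case down
    have r: "r = (if p \<le> after j then p else if p > after j + 1 then p - 2 else after j)"
      using s down by (auto simp: strand_def through_def)
    consider "p < after j" | "p = after j" | "p = after j + 1" | "p = after j + 2" | "p > after j + 2" "Suc (Suc (p - 2)) = p"
      by linarith
    then show ?thesis
      by cases (use r down p ranges conns in \<open>auto simp: position_def intro: conn_trans\<close>)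
  qed
  then show "((j, p), (j, position j r)) \<in> conn (ra I)" "1 \<le> r \<and> r + 2 \<le> n" by simp_all
qed

lemma position_conn:
  assumes r: "1 \<le> r" "r + 2 \<le> n" and "j \<le> m"
  shows "((0, position 0 r), (j, position j r)) \<in> conn (ra I)"
  using assms(3)
proof (induction j)
  case (Suc j)
  have "((j, position j r), (Suc j, position (Suc j) r)) \<in> conn (ra I)"
  proof (cases "j \<in> J")
    case False
    then have "position (Suc j) r = position j r"
      by (simp add: position_def lo_def before_step after_step)
    then show ?thesis
      using vertical_conn[of j "position j r"] position_range[of j r] r False Suc.prems by simp
  next
    case True
    \<comment> \<open>a point of the strand off the turnback, where the vertical arc has not been cut\<close>
    define p where "p = (if r < letter j then r else r + 2)"
    have p: "p \<noteq> letter j" "p \<noteq> letter j + 1" "p \<in> {1..n}" "(if p < letter j then p else p - 2) = r"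
      using r by (auto simp: p_def)
    have "((j, p), (j, position j r)) \<in> conn (ra I)"
      using strand_through(1)[of j p r] strand_outside(1)[OF True p(1,2)] p Suc.prems by simp
    moreover have "((Suc j, p), (Suc j, position (Suc j) r)) \<in> conn (ra I)"
      using strand_through(1)[of "Suc j" p r] strand_outside(2)[OF True p(1,2)] p Suc.prems by simp
    moreover have "((j, p), (Suc j, p)) \<in> conn (ra I)"
      using vertical_conn[of j p] p Suc.prems by simp
    ultimately show ?thesis by (meson conn_sym conn_trans)
  qed
  with Suc show ?case by (auto intro: conn_trans)
qed simp

lemma next_cup_conn: "j \<le> m \<Longrightarrow> ((j, after j), (next_cup j, after j)) \<in> conn (ra I)"
proof (rule induct_to_next_cup[where P = "\<lambda>j. ((j, after j), (next_cup j, after j)) \<in> conn (ra I)"])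
  fix j assume j: "j < m" "j \<notin> J" and IH: "((Suc j, after (Suc j)), (next_cup (Suc j), after (Suc j))) \<in> conn (ra I)"
  have "after j \<in> {1..n}" using after_range[of j] j(1) by auto
  then have "((j, after j), (Suc j, after j)) \<in> conn (ra I)" using vertical_conn j by blast
  then show "((j, after j), (next_cup j, after j)) \<in> conn (ra I)"
    using IH j(2) by (auto simp: after_step next_cup_step intro: conn_trans)
next
  assume IH: "((0, after 0), (next_cup 0, after 0)) \<in> conn (ra I)"
  have "after 0 \<in> {1..n}" using after_range[of 0] by auto
  then show "((m, after m), (next_cup m, after m)) \<in> conn (ra I)"
    using closing_conn IH unfolding after_cyclic next_cup_cyclic by (blast intro: conn_trans)
qed (simp add: next_cup_cup)

lemma strand_trivial:
  assumes j: "j \<le> m" and s: "strand (j, p) = Inr x"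
  shows "((j, p), (x, letter x)) \<in> conn (ra I)" "x = next_cup j" "before j = after j" "p = after j \<or> p = after j + 1"
proof -
  show 1: "x = next_cup j" "before j = after j" "p = after j \<or> p = after j + 1"
    using s by (auto simp: strand_def split: if_splits)
  have "((j, p), (j, after j)) \<in> conn (ra I)" using 1(3) after_conn[OF j] conn_sym by auto
  from conn_trans[OF this next_cup_conn[OF j]] show "((j, p), (x, letter x)) \<in> conn (ra I)"
    unfolding 1(1) after_def[symmetric] .
qed

lemma next_cup_before: "j \<le> m \<Longrightarrow> next_cup j \<in> J \<and> before (next_cup j) = before j"
  by (rule induct_to_next_cup[where P = "\<lambda>j. next_cup j \<in> J \<and> before (next_cup j) = before j"])
    (auto simp: next_cup_cup next_cup_step[symmetric] before_step next_cup_cyclic before_cyclic)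

definition trivial_cups :: "nat set" where
  "trivial_cups = {j \<in> J. before j = letter j}"

lemma circles_eq_strands: "circles D I = fibre strand V ` strand ` V"
proof (rule circles_eq_fibres)
  show "strand u = strand v" if "(u, v) \<in> ra I" for u v using that by (rule strand_arc)
  show "(u, v) \<in> conn (ra I)" if uv: "u \<in> V" "v \<in> V" "strand u = strand v" for u v
  proof -
    obtain j p k q where u: "u = (j, p)" "j \<le> m" "p \<in> {1..n}" and v: "v = (k, q)" "k \<le> m" "q \<in> {1..n}"
      using uv(1,2) by (cases u; cases v) auto
    show ?thesis
    proof (cases "strand u")
      case (Inl r)
      note a = strand_through[OF u(2,3), of r] and b = strand_through[OF v(2,3), of r]
      have s: "strand (j, p) = Inl r" "strand (k, q) = Inl r" using Inl uv(3) u v by simp_all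
      show ?thesis
        using a(1)[OF s(1)] b(1)[OF s(2)] position_conn[of r j] position_conn[of r k] a(2)[OF s(1)] u(2) v(2)
        unfolding u(1) v(1) by (meson conn_sym conn_trans)
    next
      case (Inr x)
      then have s: "strand (j, p) = Inr x" "strand (k, q) = Inr x" using uv(3) u v by simp_all
      show ?thesis
        using strand_trivial(1)[OF u(2) s(1)] strand_trivial(1)[OF v(2) s(2)]
        unfolding u(1) v(1) by (meson conn_sym conn_trans)
    qed
  qed
qed

lemma strand_image: "strand ` V = Inl ` {1..n - 2} \<union> Inr ` trivial_cups"
proof
  show "strand ` V \<subseteq> Inl ` {1..n - 2} \<union> Inr ` trivial_cups"
  proof
    fix y assume "y \<in> strand ` V"
    then obtain j p where j: "j \<le> m" "p \<in> {1..n}" "y = strand (j, p)" by auto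
    show "y \<in> Inl ` {1..n - 2} \<union> Inr ` trivial_cups"
    proof (cases y)
      case (Inl r)
      with strand_through(2)[OF j(1,2), of r] j(3) have "r \<in> {1..n - 2}" by auto
      then show ?thesis unfolding Inl by blast
    next
      case (Inr x)
      note x = strand_trivial[OF j(1), of p x]
      have "strand (j, p) = Inr x" using Inr j(3) by simp
      from x(2,3)[OF this] have "x = next_cup j" "before j = after j" .
      then have "x \<in> trivial_cups"
        using next_cup_before[OF j(1)] unfolding trivial_cups_def by (simp add: after_def)
      then show ?thesis unfolding Inr by blast
    qed
  qed
  have "Inl r \<in> strand ` V" if "r \<in> {1..n - 2}" for r
  proof -
    have r: "1 \<le> r" "r + 2 \<le> n" using that by auto
    then have "(0, position 0 r) \<in> V" using position_range[of 0 r] by simp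
    then show ?thesis using strand_position[of 0 r] by (metis image_eqI le0)
  qed
  moreover have "Inr x \<in> strand ` V" if "x \<in> trivial_cups" for x
  proof -
    have x: "x \<in> J" "before x = letter x" using that by (simp_all add: trivial_cups_def)
    then have "strand (x, letter x) = Inr x" by (simp add: strand_def after_cup next_cup_cup)
    moreover have "(x, letter x) \<in> V" using letter_range[OF J_bound[OF x(1)]] J_bound[OF x(1)] by auto
    ultimately show ?thesis by (metis image_eqI)
  qed
  ultimately show "Inl ` {1..n - 2} \<union> Inr ` trivial_cups \<subseteq> strand ` V" by blast
qed

text \<open>A through strand meets a level in one point, or in the three points of a zigzag.\<close>

lemma nontrivial_strand:
  assumes "r \<in> {1..n - 2}"
  shows "nontrivial_circle D (fibre strand V (Inl r))"
proof -
  have r: "1 \<le> r" "r + 2 \<le> n" using assms by auto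
  have ranges: "before 0 < n" "after 0 < n" "1 \<le> before 0" "1 \<le> after 0"
    using before_range[of 0] after_range[of 0] by simp_all
  have "odd (card {p \<in> {1..n}. strand (0, p) = Inl r})"
  proof (cases "r = lo 0 \<and> before 0 \<noteq> after 0")
    case True
    have "0 \<le> m" by simp
    then have "{p \<in> {1..n}. strand (0, p) = Inl r} = {r, r + 1, r + 2}"
      by (cases rule: level_cases)
        (use True r in \<open>auto simp: strand_def through_def split: if_splits\<close>)
    then show ?thesis by simp
  next
    case False
    have "0 \<le> m" by simp
    then have "{p \<in> {1..n}. strand (0, p) = Inl r} = {position 0 r}"
      by (cases rule: level_cases)
        (use False r ranges in \<open>auto simp: strand_def through_def position_def split: if_splits\<close>)
    then show ?thesis by simp
  qed
  moreover have "fibre strand V (Inl r) \<in> circles D I"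
    unfolding circles_eq_strands strand_image using assms by blast
  note nontrivial_iff_odd_level_count[OF this le0]
  ultimately show ?thesis by (simp only: level_count_fibre[OF le0] not_False_eq_True)
qed

text \<open>The level just before its cap is met by a trivial circle in two points.\<close>

lemma trivial_strand:
  assumes "x \<in> trivial_cups"
  shows "\<not> nontrivial_circle D (fibre strand V (Inr x))"
proof -
  have x: "x \<in> J" "before x = letter x" "x < m" using assms J_bound by (simp_all add: trivial_cups_def)
  have "{p \<in> {1..n}. strand (x, p) = Inr x} = {letter x, letter x + 1}"
    using x letter_range[OF x(3)] by (auto simp: strand_def after_cup next_cup_cup)
  then have "even (card {p \<in> {1..n}. strand (x, p) = Inr x})" by simp
  moreover have "fibre strand V (Inr x) \<in> circles D I"
    unfolding circles_eq_strands strand_image using assms by blast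
  note nontrivial_iff_odd_level_count[OF this less_imp_le[OF x(3)]]
  ultimately show ?thesis by (simp only: level_count_fibre[OF less_imp_le[OF x(3)]] not_not)
qed

lemma card_circles_connected:
  "card {C \<in> circles D I. nontrivial_circle D C} = n - 2"
  "card {C \<in> circles D I. \<not> nontrivial_circle D C} = card trivial_cups"
proof -
  let ?F = "fibre strand V"
  have inj: "inj_on ?F (Inl ` {1..n - 2} \<union> Inr ` trivial_cups)"
    using inj_on_fibre[of strand V] unfolding strand_image .
  have circ: "circles D I = ?F ` Inl ` {1..n - 2} \<union> ?F ` Inr ` trivial_cups"
    unfolding circles_eq_strands strand_image by (rule image_Un)
  have "{C \<in> circles D I. nontrivial_circle D C} = ?F ` Inl ` {1..n - 2}"
    unfolding circ using nontrivial_strand trivial_strand by blast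
  moreover have "card (?F ` Inl ` {1..n - 2}) = card (Inl ` {1..n - 2} :: (nat + nat) set)"
    by (rule card_image) (rule inj_on_subset[OF inj], blast)
  ultimately show "card {C \<in> circles D I. nontrivial_circle D C} = n - 2" by (simp add: card_image)
  have "{C \<in> circles D I. \<not> nontrivial_circle D C} = ?F ` Inr ` trivial_cups"
    unfolding circ using nontrivial_strand trivial_strand by blast
  moreover have "card (?F ` Inr ` trivial_cups) = card (Inr ` trivial_cups :: (nat + nat) set)"
    by (rule card_image) (rule inj_on_subset[OF inj], blast)
  ultimately show "card {C \<in> circles D I. \<not> nontrivial_circle D C} = card trivial_cups"
    by (simp add: card_image)
qed

end

section \<open>The Euler characteristic in \<open>k\<close>-degree \<open>n - 2\<close>\<close>

lemma bij_betw_plus_set: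
  "bij_betw (\<lambda>l. {C \<in> A. l C = v_plus}) (A \<rightarrow>\<^sub>E UNIV) (Pow A)"
proof (rule bij_betwI)
  let ?f = "\<lambda>X. restrict (\<lambda>C. if C \<in> X then v_plus else v_minus) A"
  show "?f {C \<in> A. l C = v_plus} = l" if l: "l \<in> A \<rightarrow>\<^sub>E UNIV" for l
  proof
    fix C show "?f {C \<in> A. l C = v_plus} C = l C"
      using l by (cases "C \<in> A"; cases "l C") (auto simp: PiE_def extensional_def)
  qed
qed (auto split: if_splits)

lemma sum_label_sign:
  assumes "finite A"
  shows "(\<Sum>C\<in>A. label_sign (l C)) = 2 * int (card {C \<in> A. l C = v_plus}) - int (card A)"
proof -
  have "(\<Sum>C\<in>A. label_sign (l C)) = (\<Sum>C\<in>A. 2 * of_bool (l C = v_plus) - 1)"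
  proof (rule sum.cong[OF HOL.refl])
    show "label_sign (l C) = 2 * of_bool (l C = v_plus) - 1" for C by (cases "l C") simp_all
  qed
  then show ?thesis using assms by (simp add: sum_subtractf sum_distrib_left[symmetric] Int_def)
qed

lemma single_power: "Poly_Mapping.single (int k) (1 :: int) = s_var ^ k"
proof (induction k)
  case (Suc k)
  have "Poly_Mapping.single (int (Suc k)) (1 :: int) = Poly_Mapping.single 1 1 * Poly_Mapping.single (int k) 1"
    by (subst mult_single) simp
  with Suc show ?case by (simp add: s_var_def)
qed simp

lemma prod_single: "finite A \<Longrightarrow>
    (\<Prod>x\<in>A. Poly_Mapping.single (f x) (1 :: int)) = Poly_Mapping.single (\<Sum>x\<in>A. f x :: int) 1"
  by (induction rule: finite_induct) (simp_all add: mult_single)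

lemma sum_Pow_power_card:
  fixes x :: "'a::comm_ring_1"
  assumes "finite A"
  shows "(\<Sum>Y\<in>Pow A. x ^ card Y) = (1 + x) ^ card A"
proof -
  have "(\<Prod>a\<in>A. x + 1) = (\<Sum>Y\<in>Pow A. (\<Prod>a\<in>Y. x) * (\<Prod>a\<in>A - Y. 1))"
    by (rule prod_add[OF assms])
  then show ?thesis by (simp add: add.commute)
qed

lemma of_int_parity_sign: "of_int (parity_sign i) = parity_sign i"
  by (simp add: parity_sign_def)

context braid_diagram
begin

text \<open>For the set \<open>J\<close> of turnbacks of a state, this is the homological degree of the state.\<close>

definition cup_signs :: "nat set \<Rightarrow> int" where
  "cup_signs J = (\<Sum>j\<in>J. if snd (w ! j) then 1 else -1)"

abbreviation N where "N I \<equiv> {C \<in> circles D I. nontrivial_circle D C}"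
abbreviation T where "T I \<equiv> {C \<in> circles D I. \<not> nontrivial_circle D C}"

lemma n_plus_eq: "n_plus D = card {j \<in> {..<m}. snd (w ! j)}"
  unfolding n_plus_def n_crossings by (rule arg_cong[where f = card]) auto

lemma n_minus_eq: "n_minus D = card {j \<in> {..<m}. \<not> snd (w ! j)}"
  unfolding n_minus_def n_crossings by (rule arg_cong[where f = card]) auto

lemma word_exponent_sum_eq: "word_exponent_sum w = int (n_plus D) - int (n_minus D)"
proof -
  have "word_exponent_sum w = (\<Sum>j<m. if snd (w ! j) then 1 else -1)"
    unfolding word_exponent_sum_def
    by (simp add: sum_list_sum_nth case_prod_beta lessThan_atLeast0)
  also have "\<dots> = (\<Sum>j<m. of_bool (snd (w ! j)) - of_bool (\<not> snd (w ! j)))"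
    by (rule sum.cong) auto
  also have "\<dots> = int (n_plus D) - int (n_minus D)"
    unfolding n_plus_eq n_minus_eq by (simp add: sum_subtractf Int_def)
  finally show ?thesis .
qed

lemma card_minus_n_minus:
  assumes "I \<subseteq> {..<m}"
  shows "int (card I) - int (n_minus D) = cup_signs (cups I)"
proof -
  have "I = {j \<in> {..<m}. j \<in> I}" using assms by blast
  then have "int (card I) = (\<Sum>j<m. of_bool (j \<in> I))" by (simp add: Int_def)
  then have "int (card I) - int (n_minus D) = (\<Sum>j<m. of_bool (j \<in> I) - of_bool (\<not> snd (w ! j)))"
    unfolding n_minus_eq by (simp add: sum_subtractf Int_def)
  also have "\<dots> = (\<Sum>j<m. if j \<in> cups I then if snd (w ! j) then 1 else -1 else 0)"
    by (rule sum.cong) (auto simp: cups_def)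
  also have "\<dots> = cup_signs (cups I)"
    unfolding cup_signs_def by (subst sum.inter_restrict[symmetric]) (auto simp: cups_def intro!: sum.cong)
  finally show ?thesis .
qed

lemma bij_betw_cups: "bij_betw cups (Pow {..<m}) (Pow {..<m})"
  by (rule bij_betwI[of _ _ _ cups]) (auto simp: cups_def)

text \<open>The exponents are normalized in such a way that the state without turnbacks has exponent 0, and \<open>q\<^sup>2\<close> is
  replaced by \<open>s\<close>.\<close>

definition state_sum :: "nat set \<Rightarrow> laurent" where
  "state_sum I = (\<Sum>l\<in>{l \<in> circles D I \<rightarrow>\<^sub>E UNIV. k_degree D (I, l) = int n - 2}.
     parity_sign (h_degree D (I, l)) *
     Poly_Mapping.single ((q_degree D (I, l) - word_exponent_sum w - int n + 2) div 2) 1)"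

text \<open>A labelling is given by the set \<open>X\<close> of its circles labelled \<open>v_plus\<close>.\<close>

lemma state_sum_eq:
  assumes "I \<subseteq> {..<m}"
  shows "state_sum I = (\<Sum>X\<in>{X \<in> Pow (circles D I). 2 * int (card (X \<inter> N I)) = int (card (N I)) + int n - 2}.
    parity_sign (cup_signs (cups I)) * Poly_Mapping.single
      ((2 * int (card X) - int (card (circles D I)) + cup_signs (cups I) - int n + 2) div 2) 1)"
proof -
  let ?S = "circles D I" and ?p = "\<lambda>l. {C \<in> circles D I. l C = v_plus}"
  have fin: "finite ?S" by (rule finite_circles[OF finite_vertices])
  have k: "k_degree D (I, l) = int n - 2 \<longleftrightarrow> 2 * int (card (?p l \<inter> N I)) = int (card (N I)) + int n - 2" for l
  proof -
    have "k_degree D (I, l) = (\<Sum>C\<in>N I. label_sign (l C))"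
      unfolding k_degree_def case_prod_conv using fin by (rule sum.inter_filter[symmetric])
    also have "\<dots> = 2 * int (card {C \<in> N I. l C = v_plus}) - int (card (N I))"
      by (rule sum_label_sign) (use fin in simp)
    also have "{C \<in> N I. l C = v_plus} = ?p l \<inter> N I" by blast
    finally show ?thesis by linarith
  qed
  have h: "h_degree D (I, l) = cup_signs (cups I)" for l
    using card_minus_n_minus[OF assms] by (simp add: h_degree_def)
  have q: "q_degree D (I, l) - word_exponent_sum w - int n + 2 =
      2 * int (card (?p l)) - int (card ?S) + cup_signs (cups I) - int n + 2" for l
    using card_minus_n_minus[OF assms] word_exponent_sum_eq sum_label_sign[OF fin, of l]
    by (simp add: q_degree_def)
  show ?thesis
    unfolding state_sum_def h q k
    by (rule sum.reindex_bij_betw[OF bij_betw_Collect_image[OF bij_betw_plus_set,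
          where P = "\<lambda>X. 2 * int (card (X \<inter> N I)) = int (card (N I)) + int n - 2"]])
qed

text \<open>All \<open>n\<close> circles are nontrivial, and \<open>k\<close>-degree \<open>n - 2\<close> leaves the choice of one circle to be
  labelled \<open>v_minus\<close>.\<close>

lemma state_sum_without_cups:
  assumes I: "I \<subseteq> {..<m}" and "cups I = {}"
  shows "state_sum I = of_nat n"
proof -
  let ?S = "circles D I"
  have fin: "finite ?S" by (rule finite_circles[OF finite_vertices])
  have N: "N I = ?S" and card: "card ?S = n"
    using circles_without_cups[OF assms(2)] by auto
  have "{X \<in> Pow ?S. 2 * int (card (X \<inter> N I)) = int (card (N I)) + int n - 2} =
      {X. X \<subseteq> ?S \<and> 2 * int (card X) = 2 * int n - 2}"
    unfolding N card by (auto simp: Int_absorb2)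
  also have "card \<dots> = n"
  proof (cases n)
    case 0
    then have "{X. X \<subseteq> ?S \<and> 2 * int (card X) = 2 * int n - 2} = {}" by auto
    then show ?thesis using 0 by simp
  next
    case (Suc k)
    then have "{X. X \<subseteq> ?S \<and> 2 * int (card X) = 2 * int n - 2} = {X. X \<subseteq> ?S \<and> card X = k}" by auto
    then show ?thesis using n_subsets[OF fin, of k] card Suc by simp
  qed
  finally have "card {X \<in> Pow ?S. 2 * int (card (X \<inter> N I)) = int (card (N I)) + int n - 2} = n" .
  moreover have "state_sum I =
      (\<Sum>X\<in>{X \<in> Pow ?S. 2 * int (card (X \<inter> N I)) = int (card (N I)) + int n - 2}. 1)"
    unfolding state_sum_eq[OF I]
  proof (rule sum.cong[OF HOL.refl])
    fix X assume "X \<in> {X \<in> Pow ?S. 2 * int (card (X \<inter> N I)) = int (card (N I)) + int n - 2}"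
    then have "X \<inter> N I = X" "2 * int (card (X \<inter> N I)) = 2 * int n - 2" unfolding N card by auto
    then have "2 * int (card X) = 2 * int n - 2" by simp
    then show "parity_sign (cup_signs (cups I)) * Poly_Mapping.single
        ((2 * int (card X) - int (card ?S) + cup_signs (cups I) - int n + 2) div 2) 1 = (1 :: laurent)"
      unfolding assms(2) card by (simp add: cup_signs_def parity_sign_def)
  qed
  ultimately show ?thesis by simp
qed

end

context cupped_state
begin

lemma state_weight_before:
  "state_weight w (preceding_letter w J 0 m) J =
    (\<Prod>j\<in>J. letter_weight (snd (w ! j)) * pairing (before j) (letter j))"
  unfolding state_weight_def before_def ..

text \<open>Both sides vanish: there are too few nontrivial circles, and one of the pairings is zero.\<close>

lemma state_sum_distant:
  assumes I: "I \<subseteq> {..<m}" and j: "j \<in> J" "before j + 1 < letter j \<or> letter j + 1 < before j"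
  shows "state_sum I = state_weight w (preceding_letter w J 0 m) J"
proof -
  have "2 * int (card (X \<inter> N I)) \<noteq> int (card (N I)) + int n - 2" for X
  proof -
    have "card (X \<inter> N I) \<le> card (N I)"
      by (rule card_mono) (use finite_circles[OF finite_vertices] in auto)
    then show ?thesis using card_nontrivial_distant[OF j] by linarith
  qed
  then have none: "{X \<in> Pow (circles D I). 2 * int (card (X \<inter> N I)) = int (card (N I)) + int n - 2} = {}"
    by blast
  have "state_sum I = 0" unfolding state_sum_eq[OF I] none by (rule sum.empty)
  moreover have "state_weight w (preceding_letter w J 0 m) J = 0"
    unfolding state_weight_before
  proof (rule prod_zero[OF finite_J], rule bexI[OF _ j(1)])
    show "letter_weight (snd (w ! j)) * pairing (before j) (letter j) = 0"
      using j(2) by (auto simp: pairing_def)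
  qed
  ultimately show ?thesis by simp
qed

text \<open>A telescoping sum around the annulus.\<close>

lemma sum_letter_minus_before: "(\<Sum>j\<in>J. int (letter j) - int (before j)) = 0"
proof -
  have "(\<Sum>j\<in>J \<inter> {..<k}. int (letter j) - int (before j)) = int (before k) - int (before 0)" for k
  proof (induction k)
    case (Suc k)
    have "J \<inter> {..<Suc k} = (if k \<in> J then insert k (J \<inter> {..<k}) else J \<inter> {..<k})"
      by (auto simp: lessThan_Suc)
    with Suc show ?case by (simp add: before_step)
  qed simp
  from this[of m] have "(\<Sum>j\<in>J \<inter> {..<m}. int (letter j) - int (before j)) = 0"
    by (simp add: before_cyclic)
  moreover have "J \<inter> {..<m} = J" using J_bound by auto
  ultimately show ?thesis by simp
qed

end

context connected_state
begin

text \<open>The exponent of \<open>s\<close> in the Burau weight: each step up contributes the pairing \<open>s\<close>, and each negative letter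
  the factor \<open>s_inv\<close>.\<close>

definition turn :: int where
  "turn = (\<Sum>j\<in>J. of_bool (letter j = before j + 1) - of_bool (\<not> snd (w ! j)))"

text \<open>Around the annulus there are as many steps up as steps down, so the number of turnbacks is the number of equal
  consecutive letters plus twice the number of steps up.\<close>

lemma cup_signs_turn: "cup_signs J = int (card trivial_cups) + 2 * turn"
proof -
  have "(\<Sum>j\<in>J. of_bool (before j = letter j)) = int (card trivial_cups)"
    unfolding trivial_cups_def using finite_J by (simp add: Int_def)
  moreover have "cup_signs J = (\<Sum>j\<in>J. of_bool (before j = letter j) +
      2 * (of_bool (letter j = before j + 1) - of_bool (\<not> snd (w ! j))) -
      (int (letter j) - int (before j)))"
    unfolding cup_signs_def
  proof (rule sum.cong[OF HOL.refl])
    fix j assume "j \<in> J"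
    from close[OF this] consider "letter j = before j" | "letter j = before j + 1" | "before j = letter j + 1"
      by linarith
    then show "(if snd (w ! j) then 1 else - 1) = of_bool (before j = letter j) +
        2 * (of_bool (letter j = before j + 1) - of_bool (\<not> snd (w ! j))) -
        (int (letter j) - int (before j))"
      by cases auto
  qed
  ultimately show ?thesis
    using sum_letter_minus_before
    by (simp add: turn_def sum.distrib sum_subtractf sum_distrib_left)
qed

lemma state_weight_connected:
  "state_weight w (preceding_letter w J 0 m) J =
    (- (1 + s_var)) ^ card trivial_cups * Poly_Mapping.single turn 1"
proof -
  have "state_weight w (preceding_letter w J 0 m) J =
      (\<Prod>j\<in>J. (if before j = letter j then - (1 + s_var) else 1) *
        Poly_Mapping.single (of_bool (letter j = before j + 1) - of_bool (\<not> snd (w ! j))) 1)"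
    unfolding state_weight_before
  proof (rule prod.cong[OF HOL.refl])
    fix j assume "j \<in> J"
    from close[OF this] consider "letter j = before j" | "letter j = before j + 1" | "before j = letter j + 1"
      by linarith
    then show "letter_weight (snd (w ! j)) * pairing (before j) (letter j) =
        (if before j = letter j then - (1 + s_var) else 1) *
        Poly_Mapping.single (of_bool (letter j = before j + 1) - of_bool (\<not> snd (w ! j))) 1"
      by cases (auto simp: letter_weight_def pairing_def s_inv_def s_var_def mult_single)
  qed
  also have "\<dots> = (\<Prod>j\<in>J. if before j = letter j then - (1 + s_var) else 1) *
      Poly_Mapping.single turn 1"
    unfolding prod.distrib turn_def using finite_J by (simp add: prod_single)
  also have "(\<Prod>j\<in>J. if before j = letter j then - (1 + s_var) else 1) =
      (- (1 + s_var)) ^ card trivial_cups"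
  proof -
    have "(\<Prod>j\<in>J. if before j = letter j then - (1 + s_var) else 1) = (\<Prod>j\<in>trivial_cups. - (1 + s_var))"
      unfolding trivial_cups_def using finite_J by (rule prod.inter_filter[symmetric])
    then show ?thesis by simp
  qed
  finally show ?thesis .
qed

text \<open>The \<open>n - 2\<close> nontrivial circles must all be labelled \<open>v_plus\<close>, while the labels of the trivial circles are
  free. So the possible sets of circles labelled \<open>v_plus\<close> differ in a set \<open>Y\<close> of trivial circles, which
  contributes a factor \<open>s ^ card Y\<close>.\<close>

lemma state_sum_connected:
  assumes I: "I \<subseteq> {..<m}"
  shows "state_sum I = state_weight w (preceding_letter w J 0 m) J"
proof -
  let ?S = "circles D I"
  have fin: "finite ?S" "finite (N I)" "finite (T I)" using finite_circles[OF finite_vertices] by simp_all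
  have n: "int (n - 2) = int n - 2"
  proof -
    obtain j where "j \<in> J" using cups_nonempty by blast
    then show ?thesis using letter_range[OF J_bound] by fastforce
  qed
  have N: "int (card (N I)) = int n - 2" using card_circles_connected(1) n by simp
  have S: "?S = N I \<union> T I" "N I \<inter> T I = {}" by auto
  then have card_S: "int (card ?S) = int n - 2 + int (card trivial_cups)"
    using card_Un_disjoint[OF fin(2,3) S(2)] N card_circles_connected(2) by simp
  have "{X \<in> Pow ?S. 2 * int (card (X \<inter> N I)) = int (card (N I)) + int n - 2} = (\<union>) (N I) ` Pow (T I)"
  proof
    show "{X \<in> Pow ?S. 2 * int (card (X \<inter> N I)) = int (card (N I)) + int n - 2} \<subseteq> (\<union>) (N I) ` Pow (T I)"
    proof
      fix X assume "X \<in> {X \<in> Pow ?S. 2 * int (card (X \<inter> N I)) = int (card (N I)) + int n - 2}"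
      then have X: "X \<subseteq> ?S" "card (X \<inter> N I) = card (N I)" using N by auto
      then have "X \<inter> N I = N I" using fin(2) by (intro card_subset_eq) auto
      then have "X = N I \<union> (X \<inter> T I)" using X(1) by blast
      then show "X \<in> (\<union>) (N I) ` Pow (T I)" by blast
    qed
    show "(\<union>) (N I) ` Pow (T I) \<subseteq> {X \<in> Pow ?S. 2 * int (card (X \<inter> N I)) = int (card (N I)) + int n - 2}"
    proof
      fix X assume "X \<in> (\<union>) (N I) ` Pow (T I)"
      then obtain Y where Y: "Y \<subseteq> T I" "X = N I \<union> Y" by blast
      then have "X \<inter> N I = N I" "X \<subseteq> ?S" by blast+
      then show "X \<in> {X \<in> Pow ?S. 2 * int (card (X \<inter> N I)) = int (card (N I)) + int n - 2}"
        using N by simp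
    qed
  qed
  moreover have "inj_on ((\<union>) (N I)) (Pow (T I))" by (rule inj_onI) blast
  ultimately have "state_sum I = (\<Sum>Y\<in>Pow (T I). parity_sign (cup_signs J) * Poly_Mapping.single
      ((2 * int (card (N I \<union> Y)) - int (card ?S) + cup_signs J - int n + 2) div 2) 1)"
    unfolding state_sum_eq[OF I] by (simp add: sum.reindex)
  also have "\<dots> = (\<Sum>Y\<in>Pow (T I). (- 1) ^ card trivial_cups * Poly_Mapping.single turn 1 * s_var ^ card Y)"
  proof (rule sum.cong[OF HOL.refl])
    fix Y assume "Y \<in> Pow (T I)"
    then have "card (N I \<union> Y) = card (N I) + card Y"
      using fin S(2) by (intro card_Un_disjoint) (auto intro: finite_subset)
    then have "(2 * int (card (N I \<union> Y)) - int (card ?S) + cup_signs J - int n + 2) div 2 = turn + int (card Y)"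
      using N card_S cup_signs_turn by simp
    moreover have "parity_sign (cup_signs J) = ((- 1) ^ card trivial_cups :: laurent)"
      unfolding cup_signs_turn by (simp add: parity_sign_def)
    ultimately show "parity_sign (cup_signs J) * Poly_Mapping.single
        ((2 * int (card (N I \<union> Y)) - int (card ?S) + cup_signs J - int n + 2) div 2) 1 =
        (- 1) ^ card trivial_cups * Poly_Mapping.single turn 1 * s_var ^ card Y"
      by (simp add: single_power[symmetric] mult_single mult.assoc)
  qed
  also have "\<dots> = (- 1) ^ card trivial_cups * Poly_Mapping.single turn 1 * (1 + s_var) ^ card trivial_cups"
    unfolding sum_distrib_left[symmetric] sum_Pow_power_card[OF fin(3)] card_circles_connected(2) ..
  also have "\<dots> = state_weight w (preceding_letter w J 0 m) J"
    unfolding state_weight_connected power_minus[of "1 + s_var"] by (simp add: ac_simps)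
  finally show ?thesis .
qed

end

context braid_diagram
begin

lemma state_sum_cups:
  assumes I: "I \<subseteq> {..<m}" and "cups I \<noteq> {}"
  shows "state_sum I = state_weight w (preceding_letter w (cups I) 0 m) (cups I)"
proof -
  interpret cupped_state n w I by unfold_locales (rule assms(2))
  show ?thesis
  proof (cases "\<exists>j\<in>J. before j + 1 < letter j \<or> letter j + 1 < before j")
    case True
    then show ?thesis using state_sum_distant[OF I] by blast
  next
    case False
    then interpret connected_state n w I by unfold_locales (meson not_less)
    show ?thesis by (rule state_sum_connected[OF I])
  qed
qed

text \<open>Since \<open>cups\<close> is a bijection, the expansions of the Euler characteristic and of the trace can be compared
  term by term.\<close>

theorem sum_state_sum: "(\<Sum>I\<in>Pow {..<m}. state_sum I) = mat_trace (burau_word n w)"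
proof -
  let ?f = "\<lambda>J. if J = {} then of_nat n else state_weight w (preceding_letter w J 0 m) J"
  have "(\<Sum>I\<in>Pow {..<m}. state_sum I) = (\<Sum>I\<in>Pow {..<m}. ?f (cups I))"
    by (rule sum.cong) (use state_sum_without_cups state_sum_cups in auto)
  also have "\<dots> = (\<Sum>J\<in>Pow {..<m}. ?f J)" by (rule sum.reindex_bij_betw[OF bij_betw_cups])
  also have "\<dots> = ?f {} + (\<Sum>J\<in>Pow {..<m} - {{}}. ?f J)" by (rule sum.remove) simp_all
  also have "(\<Sum>J\<in>Pow {..<m} - {{}}. ?f J) =
      (\<Sum>J\<in>Pow {..<m} - {{}}. state_weight w (preceding_letter w J 0 m) J)"
    by (rule sum.cong) auto
  finally show ?thesis using trace_burau_word[OF word] by simp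
qed

definition euler_coefficient :: "int \<Rightarrow> int" where
  "euler_coefficient q = (\<Sum>g\<in>{g \<in> generators D. q_degree D g = q \<and> k_degree D g = int n - 2}.
     parity_sign (h_degree D g))"

text \<open>Grouping the generators by their \<open>q\<close>-degree expresses the trace through numbers that are invariants of the
  homology.\<close>

lemma trace_eq_euler_coefficients:
  assumes "finite Q" and "q_degree D ` generators D \<subseteq> Q"
  shows "mat_trace (burau_word n w) = (\<Sum>q\<in>Q. of_int (euler_coefficient q) *
    Poly_Mapping.single ((q - word_exponent_sum w - int n + 2) div 2) 1)"
proof -
  let ?s = "\<lambda>q. Poly_Mapping.single ((q - word_exponent_sum w - int n + 2) div 2) 1 :: laurent"
  let ?G = "{g \<in> generators D. k_degree D g = int n - 2}"
  have G: "?G = (SIGMA I:Pow {..<m}. {l \<in> circles D I \<rightarrow>\<^sub>E UNIV. k_degree D (I, l) = int n - 2})"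
    by (auto simp: generators_def)
  have fin: "finite ?G" using finite_generators[OF finite_vertices] by simp
  have fin_labels: "finite {l \<in> circles D I \<rightarrow>\<^sub>E UNIV. k_degree D (I, l) = int n - 2}" for I
    by (rule finite_subset[of _ "circles D I \<rightarrow>\<^sub>E UNIV"])
      (use finite_circles[OF finite_vertices] in \<open>auto intro!: finite_PiE\<close>)
  have "mat_trace (burau_word n w) = (\<Sum>I\<in>Pow {..<m}. state_sum I)" by (rule sum_state_sum[symmetric])
  also have "\<dots> = (\<Sum>g\<in>?G. parity_sign (h_degree D g) * ?s (q_degree D g))"
    unfolding G state_sum_def
    by (subst sum.Sigma) (use fin_labels in \<open>auto intro!: sum.cong\<close>)
  also have "\<dots> = (\<Sum>q\<in>Q. \<Sum>g\<in>{g \<in> ?G. q_degree D g = q}. parity_sign (h_degree D g) * ?s (q_degree D g))"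
    by (rule sum.group[symmetric]) (use fin assms in auto)
  also have "\<dots> = (\<Sum>q\<in>Q. of_int (euler_coefficient q) * ?s q)"
  proof (rule sum.cong[OF HOL.refl])
    fix q
    have "{g \<in> generators D. q_degree D g = q \<and> k_degree D g = int n - 2} = {g \<in> ?G. q_degree D g = q}"
      by blast
    then have "of_int (euler_coefficient q) * ?s q =
        (\<Sum>g\<in>{g \<in> ?G. q_degree D g = q}. parity_sign (h_degree D g) * ?s q)"
      unfolding euler_coefficient_def by (simp add: of_int_parity_sign sum_distrib_right)
    also have "\<dots> = (\<Sum>g\<in>{g \<in> ?G. q_degree D g = q}. parity_sign (h_degree D g) * ?s (q_degree D g))"
      by (rule sum.cong) simp_all
    finally show "(\<Sum>g\<in>{g \<in> ?G. q_degree D g = q}. parity_sign (h_degree D g) * ?s (q_degree D g)) =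
        of_int (euler_coefficient q) * ?s q" ..
  qed
  finally show ?thesis .
qed

end

theorem corollary5:
  fixes n :: nat and \<beta>\<^sub>1 \<beta>\<^sub>2 :: "braid_word set"
  assumes "\<beta>\<^sub>1 \<in> carrier (braid_group n)" and "\<beta>\<^sub>2 \<in> carrier (braid_group n)"
    and "exponent_sum \<beta>\<^sub>1 = exponent_sum \<beta>\<^sub>2"
    and "mat_trace (burau n \<beta>\<^sub>1) \<noteq> mat_trace (burau n \<beta>\<^sub>2)"
  shows "\<forall>w\<^sub>1\<in>\<beta>\<^sub>1. \<forall>w\<^sub>2\<in>\<beta>\<^sub>2.
    \<not> SKh_isomorphic (braid_closure n w\<^sub>1) (braid_closure n w\<^sub>2)"
proof (intro ballI notI)
  fix w1 w2
  assume w: "w1 \<in> \<beta>\<^sub>1" "w2 \<in> \<beta>\<^sub>2" and iso: "SKh_isomorphic (braid_closure n w1) (braid_closure n w2)"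
  have rep: "v \<in> braid_words n \<and> \<beta> = braid_class n v" if "\<beta> \<in> carrier (braid_group n)" "v \<in> \<beta>" for \<beta> v
  proof -
    from that(1) obtain u where "\<beta> = braid_class n u" by (auto simp: carrier_braid_group)
    with that(2) show ?thesis using braid_eq_words braid_class_eq by auto
  qed
  note 1 = rep[OF assms(1) w(1)] and 2 = rep[OF assms(2) w(2)]
  interpret D1: braid_diagram n w1 by unfold_locales (use 1 in blast)
  interpret D2: braid_diagram n w2 by unfold_locales (use 2 in blast)
  have e: "word_exponent_sum w1 = word_exponent_sum w2"
    using assms(3) 1 2 exponent_sum_braid_class by metis
  have coeff: "D1.euler_coefficient q = D2.euler_coefficient q" for q
  proof -
    have "real_of_int (D1.euler_coefficient q) = real_of_int (D2.euler_coefficient q)"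
      unfolding D1.euler_coefficient_def D2.euler_coefficient_def of_int_sum of_int_parity_sign
      by (rule SKh_isomorphic_imp_euler_characteristic_eq[OF iso D1.finite_vertices D2.finite_vertices
            D1.annular_differential_squared D2.annular_differential_squared])
    then show ?thesis by simp
  qed
  define Q where "Q = q_degree D1.D ` generators D1.D \<union> q_degree D2.D ` generators D2.D"
  have "finite Q"
    unfolding Q_def using finite_generators D1.finite_vertices D2.finite_vertices by blast
  then have "mat_trace (burau_word n w1) = mat_trace (burau_word n w2)"
    using D1.trace_eq_euler_coefficients[of Q] D2.trace_eq_euler_coefficients[of Q]
    unfolding Q_def coeff e by simp
  then show False using assms(4) 1 2 burau_braid_class by metis
qed

end
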